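(* Let $R(t)$, $t\in(0,+\infty)$, be short rates from the class $\mathbb{A}_g(a,b;\alpha_1,\dots,\alpha_g;\eta_1,\dots,\eta_g)$. Then $R(t)$ converges in distribution, as $t\to+\infty$, to some random variable $R_\infty$ if and only if one of the following holds: (i) $b=0$ and $a\le0$; (ii) $b>0$ and $a<0$; (iii) $b>0$, $a=0$ and $\alpha_g<2$. In case (i), $\mathbb{P}(R_\infty=0)=1$. In case (ii), $\mathbb{E}R_\infty=-b/a$. In case (iii), the tail of $R_\infty$ has the asymptotics $$\mathbb{P}(R_\infty>r)\sim\frac{b}{\eta_g(2-\alpha_g)\Gamma(\alpha_g-1)}\,\frac{1}{r^{2-\alpha_g}}\qquad\text{as } r\to+\infty.$$
   Context: Parameters: $g\ge1$, $a\in\mathbb{R}$, $b\ge0$, $2\ge\alpha_1>\alpha_2>\dots>\alpha_g>1$, $\eta_1,\dots,\eta_g>0$. Put $c_2=\frac12$, $c_\alpha=\frac{\Gamma(2-\alpha)}{\alpha(\alpha-1)}$ for $\alpha\in(1,2)$, where $\Gamma$ is the Gamma function, and $d_i=\eta_i/c_{\alpha_i}$. The class $\mathbb{A}_g(a,b;\alpha_1,\dots,\alpha_g;\eta_1,\dots,\eta_g)$ consists of the nonnegative Markov processes with generator $$\mathcal{A}f(x)=cxf''(x)+(ax+b)f'(x)+x\int_{(0,+\infty)}\{f(x+v)-f(x)-f'(x)v\}\,\mu(dv),\qquad \mu(dv)=\sum_{i=l}^g\frac{d_i}{v^{1+\alpha_i}}dv,\ v>0,$$ where $c=\eta_1$,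 $l=2$ if $\alpha_1=2$, and $c=0$, $l=1$ otherwise. Equivalently, $R$ has the same generator as the unique strong nonnegative solution of the canonical equation $$dR(t)=(aR(t-)+b)\,dt+\sum_{i=1}^gd_i^{1/\alpha_i}R(t-)^{1/\alpha_i}\,dZ^{\alpha_i}(t),\qquad R(0)=r_0,$$ with $r_0$ a nonnegative constant, where $Z^{\alpha_1},\dots,Z^{\alpha_g}$ are independent canonical stable martingales: $Z^2$ is a standard Brownian motion, and for $\alpha\in(1,2)$, $Z^\alpha$ is the real Lévy martingale with no Wiener part and Lévy measure $v^{-\alpha-1}\mathbf{1}_{\{v>0\}}dv$. The notation $f(r)\sim h(r)$ means $f(r)/h(r)\to1$.
   Formalization: The case R(0)=0, b=0, a>0 is excluded: there R is identically 0 and so converges in distribution although none of (i)–(iii) holds, so the stated equivalence fails in exactly that case. *)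

theory Defs
  imports "HOL-Probability.Probability"
begin

section \<open>The generator\<close>

definition c_stable :: "real \<Rightarrow> real" where
  "c_stable \<alpha> = (if \<alpha> = 2 then 1 / 2 else Gamma (2 - \<alpha>) / (\<alpha> * (\<alpha> - 1)))"

text \<open>The indices of the stability indices \<open>\<alpha>\<close> and of the weights \<open>\<eta>\<close> run over \<open>{1..g}\<close>.
  The Gaussian component \<open>\<alpha> 1 = 2\<close>, if there is one, does not contribute to the jump measure.\<close>

definition jump_density :: "nat \<Rightarrow> (nat \<Rightarrow> real) \<Rightarrow> (nat \<Rightarrow> real) \<Rightarrow> real \<Rightarrow> real" where
  "jump_density g \<alpha> \<eta> v =
     (if v > 0
      then \<Sum>i = (if \<alpha> 1 = 2 then 2 else 1)..g. (\<eta> i / c_stable (\<alpha> i)) / v powr (1 + \<alpha> i)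
      else 0)"

definition jump_measure :: "nat \<Rightarrow> (nat \<Rightarrow> real) \<Rightarrow> (nat \<Rightarrow> real) \<Rightarrow> real measure" where
  "jump_measure g \<alpha> \<eta> = density lborel (\<lambda>v. ennreal (jump_density g \<alpha> \<eta> v))"

text \<open>Functions on the state space \<open>[0,\<infinity>)\<close> are represented by functions on the reals whose values
  at negative arguments are irrelevant; the derivative at \<open>0\<close> is the right derivative.\<close>

definition half_line_deriv :: "(real \<Rightarrow> real) \<Rightarrow> real \<Rightarrow> real" where
  "half_line_deriv f x = vector_derivative f (at x within {0..})"

definition generator ::
    "nat \<Rightarrow> real \<Rightarrow> real \<Rightarrow> (nat \<Rightarrow> real) \<Rightarrow> (nat \<Rightarrow> real) \<Rightarrow> (real \<Rightarrow> real) \<Rightarrow> real \<Rightarrow> real" where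
  "generator g a b \<alpha> \<eta> f x =
     (if \<alpha> 1 = 2 then \<eta> 1 else 0) * x * half_line_deriv (half_line_deriv f) x
     + (a * x + b) * half_line_deriv f x
     + x * (LINT v:{0<..}|jump_measure g \<alpha> \<eta>. f (x + v) - f x - half_line_deriv f x * v)"

definition exp_span :: "(real \<Rightarrow> real) set" where
  "exp_span = {f. \<exists>L k. finite L \<and> L \<subseteq> {0<..} \<and> (\<forall>x\<ge>0. f x = (\<Sum>l\<in>L. k l * exp (- l * x)))}"

definition C2_compact :: "(real \<Rightarrow> real) set" where
  "C2_compact = {f. (\<exists>f' f''.
        (\<forall>x\<ge>0. (f has_real_derivative f' x) (at x within {0..})) \<and>
        (\<forall>x\<ge>0. (f' has_real_derivative f'' x) (at x within {0..})) \<and>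
        continuous_on {0..} f'') \<and>
      (\<exists>K. \<forall>x\<ge>K. f x = 0)}"

text \<open>The test functions on which the generator of a conservative affine process on \<open>[0,\<infinity>)\<close> is
  given by its integro-differential expression, as in D. Filipovic, \<open>A general characterization of
  one factor affine term structure models\<close> (Finance and Stochastics, 2001): the linear hull of
  the functions \<open>exp (- l x)\<close> with \<open>l > 0\<close>, together with the compactly supported \<open>C\<^sup>2\<close> functions.\<close>

definition test_functions :: "(real \<Rightarrow> real) set" where
  "test_functions = exp_span \<union> C2_compact"


section \<open>Nonnegative Markov processes with a given generator\<close>

definition half_line :: "real measure" where
  "half_line = restrict_space borel {0..}"

definition transition_semigroup :: "(real \<Rightarrow> real \<Rightarrow> real measure) \<Rightarrow> bool" where
  "transition_semigroup P \<longleftrightarrow>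
     (\<forall>t\<ge>0. P t \<in> measurable half_line (prob_algebra half_line)) \<and>
     (\<forall>x\<ge>0. P 0 x = return half_line x) \<and>
     (\<forall>s\<ge>0. \<forall>t\<ge>0. \<forall>x\<ge>0. P (s + t) x = P s x \<bind> P t)"

definition trans_op :: "(real \<Rightarrow> real \<Rightarrow> real measure) \<Rightarrow> real \<Rightarrow> (real \<Rightarrow> real) \<Rightarrow> real \<Rightarrow> real" where
  "trans_op P t f x = (LINT y|P t x. f y)"

definition C0_half_line :: "(real \<Rightarrow> real) set" where
  "C0_half_line = {f. continuous_on {0..} f \<and> (f \<longlongrightarrow> 0) at_top}"

definition feller_semigroup :: "(real \<Rightarrow> real \<Rightarrow> real measure) \<Rightarrow> bool" where
  "feller_semigroup P \<longleftrightarrow> transition_semigroup P \<and>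
     (\<forall>f\<in>C0_half_line.
        (\<forall>t\<ge>0. trans_op P t f \<in> C0_half_line) \<and>
        uniform_limit {0..} (\<lambda>t. trans_op P t f) f (at_right 0))"

text \<open>The infinitesimal generator of the semigroup (a limit in supremum norm) is defined on \<open>D\<close>
  and coincides there with \<open>A\<close>.\<close>

definition has_generator_on ::
    "(real \<Rightarrow> real \<Rightarrow> real measure) \<Rightarrow> ((real \<Rightarrow> real) \<Rightarrow> real \<Rightarrow> real) \<Rightarrow> (real \<Rightarrow> real) set \<Rightarrow> bool" where
  "has_generator_on P A D \<longleftrightarrow>
     (\<forall>f\<in>D. uniform_limit {0..} (\<lambda>t x. (trans_op P t f x - f x) / t) (A f) (at_right 0))"

definition natural_filtration ::
    "'a measure \<Rightarrow> (real \<Rightarrow> 'a \<Rightarrow> real) \<Rightarrow> real \<Rightarrow> 'a measure" where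
  "natural_filtration M R s =
     sigma (space M) (\<Union>u\<in>{0..s}. {R u -` B \<inter> space M | B. B \<in> sets half_line})"

definition markov_process_with ::
    "'a measure \<Rightarrow> (real \<Rightarrow> 'a \<Rightarrow> real) \<Rightarrow> (real \<Rightarrow> real \<Rightarrow> real measure) \<Rightarrow> bool" where
  "markov_process_with M R P \<longleftrightarrow> prob_space M \<and>
     (\<forall>t\<ge>0. R t \<in> measurable M half_line) \<and>
     (\<forall>s t. 0 \<le> s \<and> s \<le> t \<longrightarrow> (\<forall>B\<in>sets half_line.
        AE \<omega> in M. real_cond_exp M (natural_filtration M R s) (\<lambda>\<omega>'. indicator B (R t \<omega>')) \<omega>
                     = measure (P (t - s) (R s \<omega>)) B))"

text \<open>\<open>R\<close> is a member, started at the constant \<open>r\<^sub>0\<close>, of the class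
  \<open>A\<^sub>g(a, b; \<alpha>\<^sub>1, \<dots>, \<alpha>\<^sub>g; \<eta>\<^sub>1, \<dots>, \<eta>\<^sub>g)\<close>.\<close>

definition short_rate ::
    "nat \<Rightarrow> real \<Rightarrow> real \<Rightarrow> (nat \<Rightarrow> real) \<Rightarrow> (nat \<Rightarrow> real) \<Rightarrow> real
      \<Rightarrow> 'a measure \<Rightarrow> (real \<Rightarrow> 'a \<Rightarrow> real) \<Rightarrow> bool" where
  "short_rate g a b \<alpha> \<eta> r\<^sub>0 M R \<longleftrightarrow>
     (\<exists>P. feller_semigroup P \<and> has_generator_on P (generator g a b \<alpha> \<eta>) test_functions \<and>
          markov_process_with M R P) \<and>
     (AE \<omega> in M. R 0 \<omega> = r\<^sub>0)"


section \<open>Convergence in distribution in continuous time\<close>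

text \<open>Continuous-time version of \<open>weak_conv_m\<close>, applied to the laws of the random variables
  \<open>R t\<close> on \<open>M\<close> and \<open>X\<close> on \<open>N\<close>; the two probability spaces may be different.\<close>

definition conv_in_distr ::
    "'a measure \<Rightarrow> (real \<Rightarrow> 'a \<Rightarrow> real) \<Rightarrow> 'b measure \<Rightarrow> ('b \<Rightarrow> real) \<Rightarrow> bool" where
  "conv_in_distr M R N X \<longleftrightarrow> prob_space N \<and> X \<in> borel_measurable N \<and>
     (\<forall>x. isCont (cdf (distr N borel X)) x \<longrightarrow>
        ((\<lambda>t. cdf (distr M borel (R t)) x) \<longlongrightarrow> cdf (distr N borel X) x) at_top)"

end

theory Submission
  imports Defs
begin

text \<open>Write \<open>J y = (\<Sum>i. \<eta> i * y powr \<alpha> i) - a * y\<close>. On exponentials the generator acts by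
  \<open>A exp (- l x) = (x J(l) - b l) exp (- l x)\<close>, so \<open>s \<longmapsto> P s (\<lambda>y. exp (- q(s) - p(s) y)) x\<close> is constant if
  \<open>p' = J(p)\<close> and \<open>q' = - b p\<close>. For \<open>a \<le> 0\<close> the flow of \<open>- J\<close> from \<open>l\<close> decreases to \<open>0\<close>, and with
  \<open>K' = y / J(y)\<close> this gives \<open>E exp (- l R(t)) = exp (- r w(t) - b (K(l) - K(w(t))))\<close> with
  \<open>w(t) \<rightarrow> 0\<close>. Hence the limiting transform is \<open>exp (- b K(l))\<close> with \<open>K(0) = 0\<close> if \<open>K\<close> is
  finite at \<open>0\<close>, and \<open>0\<close> if \<open>K\<close> diverges there (\<open>a = 0\<close>, \<open>\<alpha> g = 2\<close>). The mean and the tail of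
  the limit are read off from \<open>K(l) \<sim> - l / a\<close>, respectively from
  \<open>K(l) \<sim> l powr (2 - \<alpha> g) / (\<eta> g (2 - \<alpha> g))\<close> by a Tauberian theorem.\<close>

section \<open>The generator on exponentials\<close>

text \<open>The generator is known only as a sup-norm limit on test functions, and no invariance of
  these under \<open>P t\<close> is assumed. Differentiation along a path of exponentials therefore
  applies the generator only to the exponential frozen at time \<open>s\<close>; the motion of the
  parameters is handled by a remainder estimate uniform in the state. The potential \<open>K\<close>
  results from eliminating time: dq/dp = - b p / J(p), so its behaviour at 0 is the question whether
  \<open>y / J y\<close> is integrable there. Laws and transforms are linked through the variable
  \<open>exp (- r)\<close> in [0,1], where transforms at integers become moments and polynomials are
  dense. Allowing weights that vary with the parameter makes this one argument serve for weak
  convergence and for the Tauberian theorem. Where there is no limit law, the transforms are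
  eventually bounded by some \<theta> < 1 that does not depend on \<open>l\<close>, which means that
  mass escapes to infinity.\<close>

lemma ennreal_indicator_mult: "ennreal (indicator A x * y) = ennreal y * indicator A x"
  by (simp add: indicator_def)

lemma nn_integral_powr_tail:
  fixes v \<beta> :: real
  assumes v: "v > 0" and b: "\<beta> > 0"
  shows "(\<integral>\<^sup>+x. ennreal (x powr (- 1 - \<beta>)) * indicator {v..} x \<partial>lborel) = ennreal (v powr (- \<beta>) / \<beta>)"
proof -
  have "(\<integral>\<^sup>+x. ennreal (x powr (- 1 - \<beta>)) * indicator {v..} x \<partial>lborel) = ennreal (0 - - (v powr (- \<beta>) / \<beta>))"
  proof (rule nn_integral_FTC_atLeast)
    show "((\<lambda>x. - (x powr (- \<beta>) / \<beta>)) has_real_derivative x powr (- 1 - \<beta>)) (at x)" if "v \<le> x" for x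
      using that v b by (auto intro!: derivative_eq_intros simp: powr_diff powr_minus field_simps)
    have "((\<lambda>x::real. x powr (- \<beta>)) \<longlongrightarrow> 0) at_top"
      by (rule tendsto_neg_powr) (use b in \<open>auto intro: filterlim_ident\<close>)
    then show "((\<lambda>x. - (x powr (- \<beta>) / \<beta>)) \<longlongrightarrow> 0) at_top"
      using tendsto_minus[OF tendsto_divide[OF _ tendsto_const[of \<beta>]], of "\<lambda>x. x powr (- \<beta>)" 0] b by simp
  qed auto
  then show ?thesis by simp
qed

lemma has_bochner_integral_powr_tail:
  fixes v \<beta> :: real
  assumes v: "v > 0" and b: "\<beta> > 0"
  shows "has_bochner_integral lborel (\<lambda>x. indicator {v..} x * x powr (- 1 - \<beta>)) (v powr (- \<beta>) / \<beta>)"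
  using nn_integral_powr_tail[OF v b] b
  by (intro has_bochner_integral_nn_integral) (auto simp: ennreal_indicator_mult)

text \<open>Tonelli on the triangle 0 \<le> r \<le> x, with \<open>H x\<close> written as the
  integral of \<open>k\<close>: an integration by parts without boundary terms or integrability
  conditions. It lowers the order of the singularity at 0 by one.\<close>

lemma nn_integral_power_weight:
  fixes k H :: "real \<Rightarrow> real"
  assumes g: "\<gamma> > 0" and k[measurable]: "k \<in> borel_measurable borel"
    and k0: "\<And>r. r \<ge> 0 \<Longrightarrow> k r \<ge> 0"
    and H: "\<And>r. r \<ge> 0 \<Longrightarrow> (H has_real_derivative k r) (at r)" and H0: "H 0 = 0"
  shows "(\<integral>\<^sup>+x. ennreal (H x * x powr (- 1 - \<gamma>)) * indicator {0<..} x \<partial>lborel) =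
         (\<integral>\<^sup>+r. ennreal (k r * r powr (- \<gamma>) / \<gamma>) * indicator {0<..} r \<partial>lborel)"
proof -
  let ?J = "\<lambda>x r. ennreal (k r) * indicator {0..x} r * (ennreal (x powr (- 1 - \<gamma>)) * indicator {0<..} x)"
  have inner: "(\<integral>\<^sup>+r. ?J x r \<partial>lborel) = ennreal (H x * x powr (- 1 - \<gamma>)) * indicator {0<..} x" for x
  proof (cases "x > 0")
    case True
    have "(\<integral>\<^sup>+r. ennreal (k r) * indicator {0..x} r \<partial>lborel) = ennreal (H x - H 0)"
      using H k0 True by (intro nn_integral_FTC_Icc) (auto intro: DERIV_subset has_field_derivative_at_within)
    moreover have "H x \<ge> 0"
      using DERIV_nonneg_imp_nondecreasing[of 0 x H] H k0 True H0 by (metis less_imp_le)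
    ultimately show ?thesis
      by (subst nn_integral_multc) (simp_all add: H0 ennreal_mult mult.assoc)
  qed auto
  \<comment> \<open>At \<open>r = 0\<close> nothing cuts off the singularity and the inner integral
    can be infinite, hence only almost every \<open>r\<close>.\<close>
  have outer: "AE r in lborel. (\<integral>\<^sup>+x. ?J x r \<partial>lborel) = ennreal (k r * r powr (- \<gamma>) / \<gamma>) * indicator {0<..} r"
  proof -
    have "(\<integral>\<^sup>+x. ?J x r \<partial>lborel) = ennreal (k r * r powr (- \<gamma>) / \<gamma>) * indicator {0<..} r" if "r \<noteq> 0" for r
    proof (cases "r > 0")
      case True
      have "(\<integral>\<^sup>+x. ?J x r \<partial>lborel) =
          (\<integral>\<^sup>+x. ennreal (k r) * (ennreal (x powr (- 1 - \<gamma>)) * indicator {r..} x) \<partial>lborel)"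
        using True by (intro nn_integral_cong) (auto simp: indicator_def)
      also have "\<dots> = ennreal (k r) * (\<integral>\<^sup>+x. ennreal (x powr (- 1 - \<gamma>)) * indicator {r..} x \<partial>lborel)"
        by (subst nn_integral_cmult) auto
      also have "(\<integral>\<^sup>+x. ennreal (x powr (- 1 - \<gamma>)) * indicator {r..} x \<partial>lborel) =
          ennreal (r powr (- \<gamma>) / \<gamma>)"
        by (rule nn_integral_powr_tail[OF True g])
      finally show ?thesis
        using True k0[of r] g by (simp add: ennreal_mult[symmetric])
    qed (use that in \<open>auto simp: indicator_def\<close>)
    then show ?thesis
      by (auto intro: AE_mp[OF AE_lborel_singleton[of 0]])
  qed
  have "(\<integral>\<^sup>+x. \<integral>\<^sup>+r. ?J x r \<partial>lborel \<partial>lborel) = (\<integral>\<^sup>+r. \<integral>\<^sup>+x. ?J x r \<partial>lborel \<partial>lborel)"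
  proof (rule lborel_pair.Fubini')
    have eq: "(\<lambda>(r, x). ?J x r) = (\<lambda>p. ennreal (k (fst p)) * (if 0 \<le> fst p \<and> fst p \<le> snd p then 1 else 0) *
        (ennreal (snd p powr (- 1 - \<gamma>)) * (if 0 < snd p then 1 else 0)))"
      by (auto simp: indicator_def fun_eq_iff)
    show "(\<lambda>(r, x). ?J x r) \<in> borel_measurable (lborel \<Otimes>\<^sub>M lborel)"
      unfolding eq by measurable
  qed
  then show ?thesis
    unfolding inner using nn_integral_cong_AE[OF outer] by simp
qed

text \<open>Euler's integral rescaled by \<open>t = s * r\<close>. The integral is extended-valued,
  so it is isolated by multiplying with the inverse power.\<close>

lemma nn_integral_exp_powr:
  fixes s \<beta> :: real
  assumes s: "s > 0" and b: "\<beta> < 1"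
  shows "(\<integral>\<^sup>+r. ennreal (exp (- s * r) * r powr (- \<beta>)) * indicator {0<..} r \<partial>lborel) =
         ennreal (Gamma (1 - \<beta>) * s powr (\<beta> - 1))"
proof -
  define I where "I = (\<integral>\<^sup>+r. ennreal (exp (- s * r) * r powr (- \<beta>)) * indicator {0<..} r \<partial>lborel)"
  have "ennreal (Gamma (1 - \<beta>)) = (\<integral>\<^sup>+t. ennreal (indicator {0..} t * t powr (- \<beta>) / exp t) \<partial>lborel)"
    using Gamma_conv_nn_integral_real[of "1 - \<beta>"] b by simp
  also have "\<dots> = ennreal s * (\<integral>\<^sup>+r. ennreal (indicator {0..} (0 + s * r) * (0 + s * r) powr (- \<beta>) / exp (0 + s * r)) \<partial>lborel)"
    using s by (subst nn_integral_real_affine[where c = s and t = 0]) auto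
  also have "(\<integral>\<^sup>+r. ennreal (indicator {0..} (0 + s * r) * (0 + s * r) powr (- \<beta>) / exp (0 + s * r)) \<partial>lborel) =
      (\<integral>\<^sup>+r. ennreal (s powr (- \<beta>)) * (ennreal (exp (- s * r) * r powr (- \<beta>)) * indicator {0<..} r) \<partial>lborel)"
    using s by (intro nn_integral_cong)
      (auto simp: indicator_def powr_mult exp_minus field_simps zero_le_mult_iff ennreal_mult[symmetric])
  also have "\<dots> = ennreal (s powr (- \<beta>)) * I"
    unfolding I_def by (subst nn_integral_cmult) auto
  finally have "ennreal (Gamma (1 - \<beta>)) = ennreal (s powr (1 - \<beta>)) * I"
    using s by (simp add: mult.assoc[symmetric] ennreal_mult[symmetric] powr_diff powr_minus field_simps)
  then have "ennreal (s powr (\<beta> - 1)) * ennreal (Gamma (1 - \<beta>)) = ennreal (s powr (\<beta> - 1) * s powr (1 - \<beta>)) * I"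
    by (simp add: ennreal_mult mult.assoc)
  also have "s powr (\<beta> - 1) * s powr (1 - \<beta>) = 1"
    using s by (simp add: powr_add[symmetric])
  finally show ?thesis
    using b Gamma_real_nonneg[of "1 - \<beta>"] by (simp add: I_def ennreal_mult mult.commute)
qed

text \<open>One integration by parts leaves a Gamma integral. The value \<open>s = 0\<close> is
  included because it serves the zeroth moment in the Tauberian theorem.\<close>

lemma has_bochner_integral_one_minus_exp:
  fixes s \<beta> :: real
  assumes s: "s \<ge> 0" and b: "0 < \<beta>" "\<beta> < 1"
  shows "has_bochner_integral lborel (\<lambda>x. indicator {0<..} x * ((1 - exp (- s * x)) * x powr (- 1 - \<beta>)))
           (Gamma (1 - \<beta>) / \<beta> * s powr \<beta>)"
proof (cases "s = 0")
  case True
  then show ?thesis using has_bochner_integral_zero[of lborel] b by simp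
next
  case False
  with s have s: "s > 0" by simp
  have "(\<integral>\<^sup>+x. ennreal ((1 - exp (- s * x)) * x powr (- 1 - \<beta>)) * indicator {0<..} x \<partial>lborel) =
      (\<integral>\<^sup>+r. ennreal (s * exp (- s * r) * r powr (- \<beta>) / \<beta>) * indicator {0<..} r \<partial>lborel)"
    by (rule nn_integral_power_weight) (use s b in \<open>auto intro!: derivative_eq_intros\<close>)
  also have "\<dots> = (\<integral>\<^sup>+r. ennreal (s / \<beta>) * (ennreal (exp (- s * r) * r powr (- \<beta>)) * indicator {0<..} r) \<partial>lborel)"
    using s b by (intro nn_integral_cong) (auto simp: indicator_def ennreal_mult[symmetric] field_simps)
  also have "\<dots> = ennreal (s / \<beta>) * ennreal (Gamma (1 - \<beta>) * s powr (\<beta> - 1))"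
    using s b by (subst nn_integral_cmult) (simp_all only: nn_integral_exp_powr, measurable)
  also have "\<dots> = ennreal (Gamma (1 - \<beta>) / \<beta> * s powr \<beta>)"
    using s b Gamma_real_nonneg[of "1 - \<beta>"] by (simp add: ennreal_mult[symmetric] powr_diff field_simps)
  finally have "(\<integral>\<^sup>+x. ennreal (indicator {0<..} x * ((1 - exp (- s * x)) * x powr (- 1 - \<beta>))) \<partial>lborel) =
       ennreal (Gamma (1 - \<beta>) / \<beta> * s powr \<beta>)"
    by (simp add: ennreal_indicator_mult)
  then show ?thesis
    using s b Gamma_real_nonneg[of "1 - \<beta>"]
    by (intro has_bochner_integral_nn_integral) (auto simp: indicator_def)
qed

text \<open>An integration by parts leads to the preceding integral with exponent
  \<open>\<alpha> - 1\<close>. The factor of \<open>s powr \<alpha>\<close> is exactly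
  \<open>c_stable \<alpha>\<close>, which is why the weights
  \<open>\<eta> i / c_stable (\<alpha> i)\<close> of the jump density turn into
  \<open>\<eta> i\<close>.\<close>

lemma has_bochner_integral_compensated_exp:
  fixes s \<alpha> :: real
  assumes s: "s > 0" and a: "1 < \<alpha>" "\<alpha> < 2"
  shows "has_bochner_integral lborel (\<lambda>x. indicator {0<..} x * ((exp (- s * x) - 1 + s * x) / x powr (1 + \<alpha>)))
           (Gamma (2 - \<alpha>) / (\<alpha> * (\<alpha> - 1)) * s powr \<alpha>)"
proof -
  have power_swap: "y / x powr (1 + \<alpha>) = y * x powr (- 1 - \<alpha>)" for x y
    using powr_minus[of x "1 + \<alpha>"] by (simp add: divide_inverse)
  have e: "exp (- s * x) - 1 + s * x \<ge> 0" for x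
    using exp_ge_add_one_self[of "- s * x"] by simp
  have nn: "indicator {0<..} x * ((1 - exp (- s * x)) * x powr (- 1 - (\<alpha> - 1))) \<ge> 0" for x :: real
    using s by (auto simp: indicator_def)
  have "(\<integral>\<^sup>+x. ennreal ((exp (- s * x) - 1 + s * x) * x powr (- 1 - \<alpha>)) * indicator {0<..} x \<partial>lborel) =
      (\<integral>\<^sup>+r. ennreal ((s - s * exp (- s * r)) * r powr (- \<alpha>) / \<alpha>) * indicator {0<..} r \<partial>lborel)"
    by (rule nn_integral_power_weight) (use s a in \<open>auto intro!: derivative_eq_intros\<close>)
  also have "\<dots> = (\<integral>\<^sup>+r. ennreal (s / \<alpha>) *
      ennreal (indicator {0<..} r * ((1 - exp (- s * r)) * r powr (- 1 - (\<alpha> - 1)))) \<partial>lborel)"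
    using s a by (intro nn_integral_cong) (auto simp: indicator_def ennreal_mult[symmetric] field_simps)
  also have "\<dots> = ennreal (s / \<alpha>) * ennreal (Gamma (1 - (\<alpha> - 1)) / (\<alpha> - 1) * s powr (\<alpha> - 1))"
    using has_bochner_integral_one_minus_exp[of s "\<alpha> - 1"] s a nn
    by (subst nn_integral_cmult) (auto simp: has_bochner_integral_iff nn_integral_eq_integral)
  also have "\<dots> = ennreal (Gamma (2 - \<alpha>) / (\<alpha> * (\<alpha> - 1)) * s powr \<alpha>)"
    using s a Gamma_real_nonneg[of "2 - \<alpha>"] by (simp add: ennreal_mult[symmetric] powr_diff field_simps)
  finally have "(\<integral>\<^sup>+x. ennreal (indicator {0<..} x * ((exp (- s * x) - 1 + s * x) / x powr (1 + \<alpha>))) \<partial>lborel) =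
       ennreal (Gamma (2 - \<alpha>) / (\<alpha> * (\<alpha> - 1)) * s powr \<alpha>)"
    by (simp add: ennreal_indicator_mult power_swap)
  then show ?thesis
    using s a e Gamma_real_nonneg[of "2 - \<alpha>"]
    by (intro has_bochner_integral_nn_integral) (auto simp: indicator_def)
qed

text \<open>The function \<open>J\<close> of the overview; the name is the one used for
  continuous-state branching processes with immigration. The Gaussian part has no separate term: it
  contributes \<open>\<eta> 1 * y powr 2\<close>, the summand of index 1.\<close>

definition branching_mechanism :: "nat \<Rightarrow> real \<Rightarrow> (nat \<Rightarrow> real) \<Rightarrow> (nat \<Rightarrow> real) \<Rightarrow> real \<Rightarrow> real" where
  "branching_mechanism g a \<alpha> \<eta> y = (\<Sum>i = 1..g. \<eta> i * y powr \<alpha> i) - a * y"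

lemma half_line_deriv_eq:
  assumes "x \<ge> 0" "(f has_real_derivative D) (at x)"
  shows "half_line_deriv f x = D"
  unfolding half_line_deriv_def
proof (rule vector_derivative_within)
  show "at x within {0::real..} \<noteq> bot"
  proof -
    have "at_right x \<le> at x within {0..}"
      using assms(1) by (intro at_le subsetI) simp
    then show ?thesis
      using trivial_limit_at_right_real[of x] by (auto simp: bot_unique)
  qed
  show "(f has_vector_derivative D) (at x within {0..})"
    using assms(2) has_real_derivative_iff_has_vector_derivative has_vector_derivative_at_within by blast
qed

text \<open>Serves the second derivative: the first derivative of an exponential is known in closed
  form only at nonnegative arguments.\<close>

lemma half_line_deriv_cong:
  assumes "x \<ge> 0" "\<And>y. y \<ge> 0 \<Longrightarrow> f y = h y"
  shows "half_line_deriv f x = half_line_deriv h x"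
proof -
  have "(f has_vector_derivative D) (at x within {0..}) \<longleftrightarrow> (h has_vector_derivative D) (at x within {0..})" for D
    using assms by (intro has_vector_derivative_cong_ev) (auto simp: eventually_at_filter)
  then show ?thesis
    by (simp add: half_line_deriv_def vector_derivative_def)
qed

lemma half_line_deriv_exp:
  assumes "x \<ge> 0"
  shows "half_line_deriv (\<lambda>x. k * exp (- l * x)) x = - l * k * exp (- l * x)"
  by (rule half_line_deriv_eq) (use assms in \<open>auto intro!: derivative_eq_intros\<close>)

text \<open>Exponentials turn the translation by \<open>v\<close> into a factor, so
  \<open>exp (- l * x)\<close> can be pulled out of the jump integral, and what remains is affine in
  \<open>x\<close>.\<close>

lemma generator_exp:
  fixes \<alpha> \<eta> :: "nat \<Rightarrow> real"
  assumes g: "g \<ge> 1" and a1: "\<alpha> 1 \<le> 2" and am: "strict_antimono_on {1..g} \<alpha>" and ag: "\<alpha> g > 1"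
    and eta: "\<forall>i\<in>{1..g}. \<eta> i > 0" and l: "l > 0" and x: "x \<ge> 0"
  shows "generator g a b \<alpha> \<eta> (\<lambda>x. k * exp (- l * x)) x =
           k * exp (- l * x) * (x * branching_mechanism g a \<alpha> \<eta> l - b * l)"
proof -
  \<comment> \<open>The first index with a jump part; strict monotonicity allows the value 2 only at
    index 1.\<close>
  define m :: nat where "m = (if \<alpha> 1 = 2 then 2 else 1)"
  have al: "1 < \<alpha> i \<and> \<alpha> i < 2" if "i \<in> {m..g}" for i
  proof
    have "i = g \<or> \<alpha> g < \<alpha> i"
      using that monotone_onD[OF am, of i g] g by (fastforce simp: m_def split: if_splits)
    then show "1 < \<alpha> i" using ag by auto
    have "i = 1 \<or> \<alpha> i < \<alpha> 1"
      using that monotone_onD[OF am, of 1 i] g by (fastforce simp: m_def split: if_splits)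
    then show "\<alpha> i < 2" using a1 that by (auto simp: m_def split: if_splits)
  qed
  have c: "c_stable (\<alpha> i) > 0" "c_stable (\<alpha> i) = Gamma (2 - \<alpha> i) / (\<alpha> i * (\<alpha> i - 1))" if "i \<in> {m..g}" for i
    using al[OF that] by (auto simp: c_stable_def intro!: divide_pos_pos mult_pos_pos Gamma_real_pos)
  have jd: "jump_density g \<alpha> \<eta> v = (if v > 0 then \<Sum>i = m..g. (\<eta> i / c_stable (\<alpha> i)) / v powr (1 + \<alpha> i) else 0)" for v
    by (simp add: jump_density_def m_def)
  have eta': "\<eta> i > 0" if "i \<in> {m..g}" for i
    using eta that by (auto simp: m_def split: if_splits)
  have jd0: "jump_density g \<alpha> \<eta> v \<ge> 0" for v
    unfolding jd using c(1) eta' by (auto intro!: sum_nonneg divide_nonneg_nonneg simp: less_imp_le)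
  have [measurable]: "jump_density g \<alpha> \<eta> \<in> borel_measurable borel"
    unfolding jd[abs_def] by measurable
  have d: "half_line_deriv (\<lambda>x. k * exp (- l * x)) y = - l * k * exp (- l * y)" if "y \<ge> 0" for y
    using half_line_deriv_exp[OF that] .
  have d2: "half_line_deriv (half_line_deriv (\<lambda>x. k * exp (- l * x))) x = l * l * k * exp (- l * x)"
    using half_line_deriv_cong[OF x d] half_line_deriv_exp[OF x, of "- l * k" l] by (simp add: mult.assoc)
  have "(LINT v:{0<..}|jump_measure g \<alpha> \<eta>. k * exp (- l * (x + v)) - k * exp (- l * x) - - l * k * exp (- l * x) * v) =
      (LINT v|lborel. (\<Sum>i = m..g. k * exp (- l * x) * (\<eta> i / c_stable (\<alpha> i)) *
         (indicator {0<..} v * ((exp (- l * v) - 1 + l * v) / v powr (1 + \<alpha> i)))))"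
  proof -
    have aux: "jump_density g \<alpha> \<eta> v * (indicator {0<..} v * (C * E)) =
        (\<Sum>i = m..g. C * (\<eta> i / c_stable (\<alpha> i)) * (indicator {0<..} v * (E / v powr (1 + \<alpha> i))))" for v C E
      by (simp add: jd indicator_def sum_distrib_left sum_distrib_right mult.assoc mult.commute mult.left_commute divide_inverse)
    have "k * exp (- l * (x + v)) - k * exp (- l * x) - - l * k * exp (- l * x) * v =
        k * exp (- l * x) * (exp (- l * v) - 1 + l * v)" for v
      by (simp add: algebra_simps exp_add[symmetric])
    then have "jump_density g \<alpha> \<eta> v *\<^sub>R indicator {0<..} v *\<^sub>R
          (k * exp (- l * (x + v)) - k * exp (- l * x) - - l * k * exp (- l * x) * v) =
        (\<Sum>i = m..g. k * exp (- l * x) * (\<eta> i / c_stable (\<alpha> i)) *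
         (indicator {0<..} v * ((exp (- l * v) - 1 + l * v) / v powr (1 + \<alpha> i))))" for v
      unfolding aux[symmetric] by simp
    then show ?thesis
      unfolding jump_measure_def set_lebesgue_integral_def by (subst integral_density) (auto simp: jd0)
  qed
  also have "\<dots> = (\<Sum>i = m..g. k * exp (- l * x) * (\<eta> i / c_stable (\<alpha> i)) * (c_stable (\<alpha> i) * l powr \<alpha> i))"
  proof (intro has_bochner_integral_integral_eq has_bochner_integral_sum has_bochner_integral_mult_right)
    fix i assume "i \<in> {m..g}"
    then show "has_bochner_integral lborel (\<lambda>v. indicator {0<..} v * ((exp (- l * v) - 1 + l * v) / v powr (1 + \<alpha> i)))
        (c_stable (\<alpha> i) * l powr \<alpha> i)"
      using has_bochner_integral_compensated_exp[OF l, of "\<alpha> i"] al c(2) by simp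
  qed
  also have "\<dots> = k * exp (- l * x) * (\<Sum>i = m..g. \<eta> i * l powr \<alpha> i)"
    unfolding sum_distrib_left using c(1) by (intro sum.cong) (auto simp: less_le)
  finally have int: "(LINT v:{0<..}|jump_measure g \<alpha> \<eta>. k * exp (- l * (x + v)) - k * exp (- l * x) - - l * k * exp (- l * x) * v) =
      k * exp (- l * x) * (\<Sum>i = m..g. \<eta> i * l powr \<alpha> i)" .
  \<comment> \<open>For \<open>\<alpha> 1 = 2\<close> the second-order term supplies exactly the
    summand of index 1 that is missing from \<open>{m..g}\<close>.\<close>
  have "{1..g} = insert 1 {2..g}" using g by auto
  then have "(\<Sum>i = 1..g. \<eta> i * l powr \<alpha> i) = (if \<alpha> 1 = 2 then \<eta> 1 else 0) * (l * l) + (\<Sum>i = m..g. \<eta> i * l powr \<alpha> i)"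
    using l by (auto simp: m_def power2_eq_square)
  then show ?thesis
    unfolding generator_def d2 d[OF x] int branching_mechanism_def by (simp add: algebra_simps)
qed

section \<open>Feller semigroups on the half-line\<close>

lemma space_half_line [simp]: "space half_line = {0..}"
  by (simp add: half_line_def space_restrict_space)

lemma C0_half_line_add: "f \<in> C0_half_line \<Longrightarrow> h \<in> C0_half_line \<Longrightarrow> (\<lambda>x. f x + h x) \<in> C0_half_line"
  by (auto simp: C0_half_line_def intro!: continuous_intros tendsto_add_zero)

lemma C0_half_line_cmult: "f \<in> C0_half_line \<Longrightarrow> (\<lambda>x. c * f x) \<in> C0_half_line"
  by (auto simp: C0_half_line_def intro!: continuous_intros tendsto_mult_right_zero)

lemma C0_half_line_diff: "f \<in> C0_half_line \<Longrightarrow> h \<in> C0_half_line \<Longrightarrow> (\<lambda>x. f x - h x) \<in> C0_half_line"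
  using C0_half_line_add[of f "\<lambda>x. (-1) * h x"] C0_half_line_cmult[of h "-1"] by simp

text \<open>The affine factor is what the generator and the time derivative of a path of
  exponentials produce.\<close>

lemma C0_half_line_affine_exp:
  assumes "l > 0"
  shows "(\<lambda>x. (c + d * x) * exp (- l * x)) \<in> C0_half_line"
proof -
  have lx: "LIM x at_top. l * x :> at_top"
    by (rule filterlim_tendsto_pos_mult_at_top[OF tendsto_const assms filterlim_ident])
  have "((\<lambda>x. (l * x) ^ k / exp (l * x)) \<longlongrightarrow> 0) at_top" for k
    using filterlim_compose[OF tendsto_power_div_exp_0 lx] by simp
  from tendsto_add[OF tendsto_mult_right_zero[OF this[of 0], of c] tendsto_mult_right_zero[OF this[of 1], of "d / l"]]
  have "((\<lambda>x. (c + d * x) * exp (- l * x)) \<longlongrightarrow> 0) at_top"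
    using assms by (simp add: exp_minus field_simps)
  then show ?thesis
    by (auto simp: C0_half_line_def intro!: continuous_intros)
qed

lemma C0_half_line_exp: "l > 0 \<Longrightarrow> (\<lambda>x. k * exp (- l * x)) \<in> C0_half_line"
  using C0_half_line_affine_exp[of l k 0] by simp

lemma C0_half_line_measurable: "f \<in> C0_half_line \<Longrightarrow> f \<in> borel_measurable half_line"
  unfolding half_line_def C0_half_line_def by (auto intro: borel_measurable_continuous_on_restrict)

lemma C0_half_line_bounded:
  assumes "f \<in> C0_half_line"
  obtains B where "\<And>x. x \<ge> 0 \<Longrightarrow> \<bar>f x\<bar> \<le> B"
proof -
  have "eventually (\<lambda>x. \<bar>f x\<bar> < 1) at_top"
    using assms tendstoD[of f 0 at_top 1] by (simp add: C0_half_line_def dist_real_def)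
  then obtain K where K: "\<And>x. x \<ge> K \<Longrightarrow> \<bar>f x\<bar> < 1"
    by (auto simp: eventually_at_top_linorder)
  have "continuous_on {0..} f"
    using assms by (simp add: C0_half_line_def)
  then have "continuous_on {0..K} f"
    by (rule continuous_on_subset) auto
  then have "bounded (f ` {0..K})"
    by (intro compact_imp_bounded compact_continuous_image) auto
  then obtain B where B: "\<And>x. x \<in> {0..K} \<Longrightarrow> \<bar>f x\<bar> \<le> B"
    unfolding bounded_iff by force
  show thesis
  proof (rule that[of "max B 1"])
    fix x :: real assume "x \<ge> 0"
    then show "\<bar>f x\<bar> \<le> max B 1"
      using B[of x] K[of x] by (cases "x \<le> K") auto
  qed
qed

context
  fixes P assumes P: "feller_semigroup P"
begin

lemma transition_prob:
  assumes "t \<ge> 0" "x \<ge> 0"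
  shows "prob_space (P t x)" "sets (P t x) = sets half_line" "space (P t x) = {0..}"
proof -
  have "P t \<in> measurable half_line (prob_algebra half_line)"
    using P assms by (simp add: feller_semigroup_def transition_semigroup_def)
  from measurable_space[OF this, of x] have "P t x \<in> space (prob_algebra half_line)"
    using assms by simp
  then show "prob_space (P t x)" and *: "sets (P t x) = sets half_line"
    by (auto simp: space_prob_algebra)
  from sets_eq_imp_space_eq[OF *] show "space (P t x) = {0..}" by simp
qed

lemma transition_integrable:
  assumes "t \<ge> 0" "x \<ge> 0" "f \<in> C0_half_line"
  shows "integrable (P t x) f"
proof -
  interpret prob_space "P t x" using transition_prob assms by simp
  obtain B where "\<And>x. x \<ge> 0 \<Longrightarrow> \<bar>f x\<bar> \<le> B" using C0_half_line_bounded assms by metis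
  moreover have "f \<in> borel_measurable (P t x)"
    using C0_half_line_measurable[OF assms(3)] transition_prob[OF assms(1,2)]
    by (subst measurable_cong_sets[of _ half_line]) auto
  ultimately show ?thesis
    using transition_prob(3)[OF assms(1,2)] by (intro integrable_const_bound[where B = B]) auto
qed

lemma trans_op_diff:
  "t \<ge> 0 \<Longrightarrow> x \<ge> 0 \<Longrightarrow> f \<in> C0_half_line \<Longrightarrow> h \<in> C0_half_line \<Longrightarrow>
    trans_op P t (\<lambda>y. f y - h y) x = trans_op P t f x - trans_op P t h x"
  unfolding trans_op_def by (intro Bochner_Integration.integral_diff transition_integrable)

lemma trans_op_cmult: "trans_op P t (\<lambda>y. c * f y) x = c * trans_op P t f x"
  unfolding trans_op_def by simp

lemma trans_op_C0: "t \<ge> 0 \<Longrightarrow> f \<in> C0_half_line \<Longrightarrow> trans_op P t f \<in> C0_half_line"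
  using P by (auto simp: feller_semigroup_def)

lemma trans_op_mono:
  assumes "t \<ge> 0" "x \<ge> 0" "f \<in> C0_half_line" "h \<in> C0_half_line" "\<And>y. y \<ge> 0 \<Longrightarrow> f y \<le> h y"
  shows "trans_op P t f x \<le> trans_op P t h x"
  unfolding trans_op_def
  using assms transition_prob(3) by (intro integral_mono transition_integrable) auto

text \<open>Contraction: error bounds uniform in the state survive an application of
  \<open>P t\<close>.\<close>

lemma trans_op_bound:
  assumes "t \<ge> 0" "x \<ge> 0" "f \<in> C0_half_line" "\<And>y. y \<ge> 0 \<Longrightarrow> \<bar>f y\<bar> \<le> c"
  shows "\<bar>trans_op P t f x\<bar> \<le> c"
proof -
  interpret prob_space "P t x" using transition_prob assms by simp
  have f: "integrable (P t x) f" using transition_integrable assms by simp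
  have "\<bar>trans_op P t f x\<bar> \<le> (LINT y|P t x. \<bar>f y\<bar>)"
    unfolding trans_op_def by (rule integral_abs_bound)
  also have "\<dots> \<le> (LINT y|P t x. c)"
    using f assms transition_prob(3) by (intro integral_mono) auto
  finally show ?thesis by (simp add: prob_space)
qed

lemma trans_op_0: "x \<ge> 0 \<Longrightarrow> f \<in> C0_half_line \<Longrightarrow> trans_op P 0 f x = f x"
  using P by (simp add: trans_op_def feller_semigroup_def transition_semigroup_def integral_return C0_half_line_measurable)

lemma trans_op_semigroup:
  assumes "s \<ge> 0" "t \<ge> 0" "x \<ge> 0" "f \<in> C0_half_line"
  shows "trans_op P (s + t) f x = trans_op P s (trans_op P t f) x"
proof -
  interpret prob_space "P s x" using transition_prob assms by simp
  obtain B where B: "\<And>x. x \<ge> 0 \<Longrightarrow> \<bar>f x\<bar> \<le> B" using C0_half_line_bounded assms by metis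
  have m: "P t \<in> measurable half_line (prob_algebra half_line)"
    using P assms by (auto simp: feller_semigroup_def transition_semigroup_def)
  have "P t \<in> measurable (P s x) (subprob_algebra half_line)"
    using measurable_prob_algebraD[OF m] transition_prob(2)[OF assms(1,3)]
    by (subst measurable_cong_sets[of _ half_line]) auto
  moreover have "AE y in P s x. emeasure (P t y) (space (P t y)) \<le> ennreal 1"
    using prob_space.emeasure_space_1[OF transition_prob(1)[OF assms(2)]] transition_prob(3)[OF assms(1,3)]
    by (intro AE_I2) simp
  ultimately have "integral\<^sup>L (P s x \<bind> P t) f = (LINT y|P s x. integral\<^sup>L (P t y) f)"
    using B C0_half_line_measurable[OF assms(4)]
    by (intro integral_bind[where K = half_line and B = B and B' = 1]) (auto simp: finite_measure_axioms)
  then show ?thesis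
    using P assms by (simp add: trans_op_def[abs_def] feller_semigroup_def transition_semigroup_def)
qed

lemma trans_op_strongly_continuous:
  assumes "f \<in> C0_half_line" "e > 0"
  obtains d where "d > 0" "\<And>h x. 0 < h \<Longrightarrow> h < d \<Longrightarrow> x \<ge> 0 \<Longrightarrow> \<bar>trans_op P h f x - f x\<bar> < e"
proof -
  have "uniform_limit {0..} (\<lambda>t. trans_op P t f) f (at_right 0)"
    using P assms by (auto simp: feller_semigroup_def)
  from uniform_limitD[OF this assms(2)] show thesis
    using that by (auto simp: eventually_at_right_field dist_real_def)
qed

end

section \<open>Exponentials along a path\<close>

text \<open>From \<open>exp w * (1 - w) \<le> 1\<close> follows
  \<open>exp w - 1 - w \<le> w * (exp w - 1)\<close>, which is of second order for either sign of
  \<open>w\<close>.\<close>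

lemma abs_exp_minus_linear_le:
  fixes w :: real
  shows "\<bar>exp w - 1 - w\<bar> \<le> w\<^sup>2 * exp \<bar>w\<bar>"
proof -
  have "exp w * (1 - w) \<le> exp w * exp (- w)"
    using exp_ge_add_one_self[of "- w"] by (intro mult_left_mono) auto
  then have up: "exp w - 1 \<le> w * exp w"
    by (simp add: exp_minus algebra_simps)
  have lo: "exp w - 1 \<ge> w"
    using exp_ge_add_one_self[of w] by linarith
  have "exp w - 1 - w \<le> w * (exp w - 1)"
    using up by (simp add: algebra_simps)
  also have "\<dots> \<le> w\<^sup>2 * exp \<bar>w\<bar>"
  proof (cases "w \<ge> 0")
    case True
    then show ?thesis
      using mult_left_mono[OF up, of w] by (simp add: power2_eq_square)
  next
    case False
    then have "w * (exp w - 1) \<le> w * w"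
      using lo by (intro mult_left_mono_neg) auto
    also have "\<dots> \<le> w * w * exp \<bar>w\<bar>"
      using mult_left_mono[of 1 "exp \<bar>w\<bar>" "w * w"] by simp
    finally show ?thesis by (simp add: power2_eq_square)
  qed
  finally show ?thesis using lo by simp
qed

lemma square_times_exp_bounded:
  fixes c :: real
  assumes "c > 0"
  obtains C where "C > 0" "\<And>x. x \<ge> 0 \<Longrightarrow> (x + 1)\<^sup>2 * exp (- c * x) \<le> C"
proof -
  \<comment> \<open>The bound \<open>c / 2\<close> gives
    \<open>m * (x + 1) \<le> exp (c / 2 * x)\<close>, which is then squared; the cap 1 handles the
    constant term.\<close>
  define m where "m = min 1 (c / 2)"
  have m: "m > 0" using assms by (simp add: m_def)
  have "(x + 1)\<^sup>2 * exp (- c * x) \<le> 1 / m\<^sup>2" if "x \<ge> 0" for x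
  proof -
    have "m * x \<le> c / 2 * x"
      using that by (intro mult_right_mono) (simp_all add: m_def)
    moreover have "m \<le> 1" by (simp add: m_def)
    ultimately have "m * (x + 1) \<le> 1 + c / 2 * x"
      by (simp add: distrib_left)
    also have "\<dots> \<le> exp (c / 2 * x)" by (rule exp_ge_add_one_self)
    finally have "(m * (x + 1))\<^sup>2 \<le> (exp (c / 2 * x))\<^sup>2"
      using m that by (intro power_mono) auto
    also have "\<dots> = exp (c * x)"
      by (simp add: power2_eq_square exp_add[symmetric])
    finally have "m\<^sup>2 * (x + 1)\<^sup>2 * exp (- c * x) \<le> exp (c * x) * exp (- c * x)"
      unfolding power_mult_distrib by (intro mult_right_mono) auto
    then show ?thesis
      using m by (simp add: pos_le_divide_eq exp_add[symmetric] mult_ac)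
  qed
  then show thesis using that[of "1 / m\<^sup>2"] m by simp
qed

text \<open>The estimate has to be uniform in \<open>x\<close>, since \<open>P s\<close> will
  integrate over it. The Taylor remainder grows like \<open>(x + 1)\<^sup>2\<close> times an
  exponential of small rate, and the decay of \<open>exp (- p s * x)\<close> absorbs both because
  \<open>p s > 0\<close>. Working within \<open>S\<close> covers the end points of a time
  interval.\<close>

lemma exp_path_uniformly_differentiable:
  fixes p q :: "real \<Rightarrow> real"
  assumes p: "(p has_real_derivative p') (at s within S)" and q: "(q has_real_derivative q') (at s within S)"
    and ps: "p s > 0" and e: "e > 0"
  obtains d where "d > 0"
    "\<And>u x. u \<in> S \<Longrightarrow> \<bar>u - s\<bar> < d \<Longrightarrow> x \<ge> 0 \<Longrightarrow>
      \<bar>exp (- q u) * exp (- p u * x) - exp (- q s) * exp (- p s * x)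
        + (u - s) * ((q' + p' * x) * (exp (- q s) * exp (- p s * x)))\<bar> \<le> e * \<bar>u - s\<bar>"
proof -
  \<comment> \<open>Half of the rate \<open>p s\<close> is kept to beat the polynomial; the other
    half pays for \<open>exp \<bar>z\<bar>\<close>.\<close>
  obtain C where C: "C > 0" "\<And>x. x \<ge> 0 \<Longrightarrow> (x + 1)\<^sup>2 * exp (- (p s / 2) * x) \<le> C"
    using square_times_exp_bounded[of "p s / 2"] ps by auto
  define M where "M = \<bar>p'\<bar> + \<bar>q'\<bar> + 1"
  define D where "D = exp (- q s) * C"
  define e1 where "e1 = min 1 (e / (2 * D))"
  have M: "M > 0" and D: "D > 0" and e1: "e1 > 0" "e1 \<le> 1" "e1 * D \<le> e / 2"
    using C e by (auto simp: M_def D_def e1_def min_def field_simps)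
  have "\<forall>e>0. \<exists>d>0. \<forall>y\<in>S. \<bar>y - s\<bar> < d \<longrightarrow> \<bar>p y - p s - p' * (y - s)\<bar> \<le> e * \<bar>y - s\<bar>"
    using p by (simp add: has_field_derivative_def has_derivative_within_alt)
  then obtain d1 where d1: "d1 > 0" "\<And>u. u \<in> S \<Longrightarrow> \<bar>u - s\<bar> < d1 \<Longrightarrow> \<bar>p u - p s - p' * (u - s)\<bar> \<le> e1 * \<bar>u - s\<bar>"
    using e1(1) by meson
  have "\<forall>e>0. \<exists>d>0. \<forall>y\<in>S. \<bar>y - s\<bar> < d \<longrightarrow> \<bar>q y - q s - q' * (y - s)\<bar> \<le> e * \<bar>y - s\<bar>"
    using q by (simp add: has_field_derivative_def has_derivative_within_alt)
  then obtain d2 where d2: "d2 > 0" "\<And>u. u \<in> S \<Longrightarrow> \<bar>u - s\<bar> < d2 \<Longrightarrow> \<bar>q u - q s - q' * (u - s)\<bar> \<le> e1 * \<bar>u - s\<bar>"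
    using e1(1) by meson
  \<comment> \<open>The bounds \<open>1 / M\<close> and \<open>p s / (2 * M)\<close> give
    \<open>\<bar>z\<bar> \<le> 1 + p s / 2 * x\<close>. The last entry makes the quadratic error at
    most half of the allowed one; \<open>e1\<close> does the same for the linear remainder.\<close>
  define d where "d = Min {d1, d2, 1 / M, p s / (2 * M), e / (2 * (D * M\<^sup>2 * exp 1))}"
  have d: "d > 0" "d \<le> d1" "d \<le> d2" "d \<le> 1 / M" "d \<le> p s / (2 * M)" "d \<le> e / (2 * (D * M\<^sup>2 * exp 1))"
    using d1(1) d2(1) M D ps e by (auto simp: d_def)
  show thesis
  proof (rule that[OF d(1)])
    fix u x :: real assume u: "u \<in> S" "\<bar>u - s\<bar> < d" and x: "x \<ge> 0"
    define h z where "h = u - s" and "z = x * (p u - p s) + (q u - q s)"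
    have hp: "\<bar>p u - p s - p' * h\<bar> \<le> e1 * \<bar>h\<bar>" and hq: "\<bar>q u - q s - q' * h\<bar> \<le> e1 * \<bar>h\<bar>"
      using d1(2)[OF u(1)] d2(2)[OF u(1)] u(2) d by (auto simp: h_def)
    have "\<bar>z - h * (q' + p' * x)\<bar> = \<bar>x * (p u - p s - p' * h) + (q u - q s - q' * h)\<bar>"
      by (simp add: z_def algebra_simps)
    also have "\<dots> \<le> x * (e1 * \<bar>h\<bar>) + e1 * \<bar>h\<bar>"
      using hp hq x mult_left_mono[OF hp x] by (intro order_trans[OF abs_triangle_ineq] add_mono) (auto simp: abs_mult)
    finally have z1: "\<bar>z - h * (q' + p' * x)\<bar> \<le> e1 * \<bar>h\<bar> * (x + 1)"
      by (simp add: algebra_simps)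
    have "\<bar>h * (q' + p' * x)\<bar> \<le> \<bar>h\<bar> * (\<bar>q'\<bar> + \<bar>p'\<bar> * x)"
      using x abs_triangle_ineq[of q' "p' * x"] by (simp add: abs_mult mult_left_mono)
    also have "\<dots> \<le> \<bar>h\<bar> * ((\<bar>p'\<bar> + \<bar>q'\<bar>) * (x + 1))"
      using x by (intro mult_left_mono) (auto simp: algebra_simps)
    finally have "\<bar>z\<bar> \<le> e1 * \<bar>h\<bar> * (x + 1) + \<bar>h\<bar> * ((\<bar>p'\<bar> + \<bar>q'\<bar>) * (x + 1))"
      using z1 by linarith
    also have "\<dots> \<le> 1 * \<bar>h\<bar> * (x + 1) + \<bar>h\<bar> * ((\<bar>p'\<bar> + \<bar>q'\<bar>) * (x + 1))"
      using e1 x by (intro add_mono mult_right_mono) auto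
    finally have z2: "\<bar>z\<bar> \<le> M * \<bar>h\<bar> * (x + 1)"
      by (simp add: M_def algebra_simps)
    have hM: "M * \<bar>h\<bar> \<le> 1" "M * \<bar>h\<bar> \<le> p s / 2"
    proof -
      have "M * \<bar>h\<bar> \<le> M * d" using u(2) M by (simp add: h_def)
      moreover have "M * d \<le> 1" "M * d \<le> p s / 2" using d M by (auto simp: field_simps)
      ultimately show "M * \<bar>h\<bar> \<le> 1" "M * \<bar>h\<bar> \<le> p s / 2" by linarith+
    qed
    have "z\<^sup>2 * exp \<bar>z\<bar> \<le> (M * \<bar>h\<bar> * (x + 1))\<^sup>2 * exp (1 + p s / 2 * x)"
    proof (rule mult_mono)
      show "z\<^sup>2 \<le> (M * \<bar>h\<bar> * (x + 1))\<^sup>2"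
        using z2 by (metis abs_le_square_iff abs_ge_zero abs_of_nonneg order_trans)
      have "M * \<bar>h\<bar> * (x + 1) \<le> 1 + p s / 2 * x"
        using hM mult_right_mono[OF hM(2) x] by (simp add: algebra_simps)
      then show "exp \<bar>z\<bar> \<le> exp (1 + p s / 2 * x)" using z2 by simp
    qed auto
    then have t1: "\<bar>exp (- z) - 1 + z\<bar> \<le> M\<^sup>2 * h\<^sup>2 * exp 1 * ((x + 1)\<^sup>2 * exp (p s / 2 * x))"
      using abs_exp_minus_linear_le[of "- z"] by (simp add: power_mult_distrib exp_add mult_ac)
    define E where "E = exp (- p s * x)"
    have E: "E > 0" "E * exp (p s / 2 * x) = exp (- (p s / 2) * x)" "E \<le> exp (- (p s / 2) * x)"
      using ps x by (auto simp: E_def exp_add[symmetric] field_simps)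
    have "exp (- q u) * exp (- p u * x) = exp (- q s) * E * exp (- z)"
      by (simp add: E_def z_def exp_add[symmetric] algebra_simps)
    then have "\<bar>exp (- q u) * exp (- p u * x) - exp (- q s) * E + h * ((q' + p' * x) * (exp (- q s) * E))\<bar>
        = exp (- q s) * E * \<bar>(exp (- z) - 1 + z) - (z - h * (q' + p' * x))\<bar>"
      using E(1) by (subst abs_of_pos[of "exp (- q s) * E", symmetric], simp, subst abs_mult[symmetric]) (simp add: algebra_simps)
    also have "\<dots> \<le> exp (- q s) * E * (M\<^sup>2 * h\<^sup>2 * exp 1 * ((x + 1)\<^sup>2 * exp (p s / 2 * x)) + e1 * \<bar>h\<bar> * (x + 1))"
    proof (rule mult_left_mono)
      show "\<bar>(exp (- z) - 1 + z) - (z - h * (q' + p' * x))\<bar> \<le>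
          M\<^sup>2 * h\<^sup>2 * exp 1 * ((x + 1)\<^sup>2 * exp (p s / 2 * x)) + e1 * \<bar>h\<bar> * (x + 1)"
        using t1 z1 abs_triangle_ineq4[of "exp (- z) - 1 + z" "z - h * (q' + p' * x)"] by linarith
    qed (use E(1) in simp)
    also have "\<dots> = exp (- q s) * (M\<^sup>2 * h\<^sup>2 * exp 1 * ((x + 1)\<^sup>2 * (E * exp (p s / 2 * x))) + e1 * \<bar>h\<bar> * ((x + 1) * E))"
      by (simp add: algebra_simps)
    also have "\<dots> \<le> exp (- q s) * (M\<^sup>2 * h\<^sup>2 * exp 1 * C + e1 * \<bar>h\<bar> * C)"
    proof -
      have "(x + 1) * E \<le> (x + 1)\<^sup>2 * exp (- (p s / 2) * x)"
        using x E by (intro mult_mono) (auto simp: power2_eq_square)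
      then show ?thesis
        using C(2)[OF x] e1(1) unfolding E(2) by (intro mult_left_mono add_mono) auto
    qed
    also have "\<dots> = (D * M\<^sup>2 * exp 1 * \<bar>h\<bar> + e1 * D) * \<bar>h\<bar>"
      by (simp add: D_def algebra_simps power2_eq_square)
    also have "\<dots> \<le> (e / 2 + e / 2) * \<bar>h\<bar>"
    proof (intro mult_right_mono add_mono e1(3))
      have "\<bar>h\<bar> \<le> e / (2 * (D * M\<^sup>2 * exp 1))" using u(2) d(6) by (simp add: h_def)
      then show "D * M\<^sup>2 * exp 1 * \<bar>h\<bar> \<le> e / 2"
        using D M by (simp add: field_simps)
    qed simp
    finally show "\<bar>exp (- q u) * exp (- p u * x) - exp (- q s) * exp (- p s * x)
        + (u - s) * ((q' + p' * x) * (exp (- q s) * exp (- p s * x)))\<bar> \<le> e * \<bar>u - s\<bar>"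
      by (simp add: h_def E_def)
  qed
qed

lemma abs_le_of_thirds:
  fixes X Y Z W :: real
  shows "\<bar>X\<bar> \<le> e / 3 * h \<Longrightarrow> \<bar>Y\<bar> \<le> e / 3 * h \<Longrightarrow> \<bar>Z\<bar> \<le> e / 3 * h \<Longrightarrow> W = X + Y + Z \<Longrightarrow> \<bar>W\<bar> \<le> e * h"
  by linarith

lemma exp_in_test_functions:
  assumes "l > 0"
  shows "(\<lambda>x. k * exp (- l * x)) \<in> test_functions"
proof -
  have "(\<lambda>x. k * exp (- l * x)) \<in> exp_span"
    unfolding exp_span_def using assms by (intro CollectI exI[of _ "{l}"] exI[of _ "\<lambda>_. k"]) auto
  then show ?thesis by (simp add: test_functions_def)
qed

context
  fixes P g a b and \<alpha> \<eta> :: "nat \<Rightarrow> real"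
  assumes P: "feller_semigroup P" and gen: "has_generator_on P (generator g a b \<alpha> \<eta>) test_functions"
    and g: "g \<ge> 1" and a1: "\<alpha> 1 \<le> 2" and am: "strict_antimono_on {1..g} \<alpha>" and ag: "\<alpha> g > 1"
    and eta: "\<forall>i\<in>{1..g}. \<eta> i > 0"
begin

lemma generator_exp_limit:
  assumes l: "l > 0" and e: "e > 0"
  obtains d where "d > 0"
    "\<And>h y. 0 < h \<Longrightarrow> h < d \<Longrightarrow> y \<ge> 0 \<Longrightarrow>
      \<bar>trans_op P h (\<lambda>x. k * exp (- l * x)) y - k * exp (- l * y)
        - h * (k * exp (- l * y) * (y * branching_mechanism g a \<alpha> \<eta> l - b * l))\<bar> \<le> e * h"
proof -
  let ?f = "\<lambda>x. k * exp (- l * x)"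
  have "uniform_limit {0..} (\<lambda>t x. (trans_op P t ?f x - ?f x) / t) (generator g a b \<alpha> \<eta> ?f) (at_right 0)"
    using gen exp_in_test_functions[OF l, of k] unfolding has_generator_on_def by blast
  from uniform_limitD[OF this e] obtain d where d: "d > 0" and
    *: "\<And>h y. 0 < h \<Longrightarrow> h < d \<Longrightarrow> y \<ge> 0 \<Longrightarrow> \<bar>(trans_op P h ?f y - ?f y) / h - generator g a b \<alpha> \<eta> ?f y\<bar> < e"
    by (auto simp: eventually_at_right_field dist_real_def)
  show thesis
  proof (rule that[OF d])
    fix h y :: real assume h: "0 < h" "h < d" and y: "y \<ge> 0"
    have "h * \<bar>(trans_op P h ?f y - ?f y) / h - generator g a b \<alpha> \<eta> ?f y\<bar> \<le> h * e"
      using *[OF h y] h by (intro mult_left_mono) auto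
    also have "h * \<bar>(trans_op P h ?f y - ?f y) / h - generator g a b \<alpha> \<eta> ?f y\<bar> =
        \<bar>h * ((trans_op P h ?f y - ?f y) / h - generator g a b \<alpha> \<eta> ?f y)\<bar>"
      using h by (simp add: abs_mult)
    also have "h * ((trans_op P h ?f y - ?f y) / h - generator g a b \<alpha> \<eta> ?f y) =
        trans_op P h ?f y - ?f y - h * generator g a b \<alpha> \<eta> ?f y"
      using h by (simp add: field_simps)
    finally show "\<bar>trans_op P h ?f y - ?f y - h * (k * exp (- l * y) * (y * branching_mechanism g a \<alpha> \<eta> l - b * l))\<bar> \<le> e * h"
      unfolding generator_exp[OF g a1 am ag eta l y] by (simp add: mult.commute)
  qed
qed

text \<open>The left difference quotients use that \<open>P (s - h)\<close> is a contraction, the right ones in addition the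
  strong continuity on the derivative of the path, which is again of the form (affine) \<open>\<times>\<close> (exponential).\<close>

lemma trans_op_exp_path_derivative:
  fixes p q :: "real \<Rightarrow> real"
  assumes x: "x \<ge> 0" and s: "s \<in> {0..T}" and p0: "\<And>s. s \<in> {0..T} \<Longrightarrow> p s > 0"
    and p: "(p has_real_derivative p') (at s within {0..T})"
    and q: "(q has_real_derivative q') (at s within {0..T})"
  shows "((\<lambda>s. trans_op P s (\<lambda>y. exp (- q s) * exp (- p s * y)) x) has_real_derivative
      trans_op P s (\<lambda>y. exp (- q s) * exp (- p s * y) *
        (y * (branching_mechanism g a \<alpha> \<eta> (p s) - p') - (b * p s + q'))) x) (at s within {0..T})"
proof -
  define J where "J = branching_mechanism g a \<alpha> \<eta> (p s)"
  define f where "f u y = exp (- q u) * exp (- p u * y)" for u y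
  define A where "A y = f s y * (y * J - b * p s)" for y
  define G where "G y = - ((q' + p' * y) * f s y)" for y
  define D where "D y = f s y * (y * (J - p') - (b * p s + q'))" for y
  have DAG: "D = (\<lambda>y. A y + G y)"
    by (auto simp: D_def A_def G_def algebra_simps)
  have f0: "f u \<in> C0_half_line" if "u \<in> {0..T}" for u
    unfolding f_def by (rule C0_half_line_exp) (use p0[OF that] in simp)
  have A0: "A \<in> C0_half_line"
    using C0_half_line_affine_exp[OF p0[OF s], of "- exp (- q s) * (b * p s)" "exp (- q s) * J"]
    by (simp add: A_def[abs_def] f_def algebra_simps)
  have G0: "G \<in> C0_half_line"
    using C0_half_line_affine_exp[OF p0[OF s], of "- exp (- q s) * q'" "- exp (- q s) * p'"]
    by (simp add: G_def[abs_def] f_def algebra_simps)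
  have D0: "D \<in> C0_half_line"
    unfolding DAG by (rule C0_half_line_add[OF A0 G0])
  note C0 = f0 A0 G0 D0 trans_op_C0[OF P] C0_half_line_add C0_half_line_diff C0_half_line_cmult
  have "\<exists>d>0. \<forall>u\<in>{0..T}. norm (u - s) < d \<longrightarrow>
      norm (trans_op P u (f u) x - trans_op P s (f s) x - trans_op P s D x * (u - s)) \<le> e * norm (u - s)"
    if e: "e > 0" for e
  proof -
    have e3: "e / 3 > 0" using e by simp
    obtain d1 where d1: "d1 > 0" "\<And>h y. 0 < h \<Longrightarrow> h < d1 \<Longrightarrow> y \<ge> 0 \<Longrightarrow>
        \<bar>trans_op P h (f s) y - f s y - h * A y\<bar> \<le> e / 3 * h"
      using generator_exp_limit[OF p0[OF s] e3, of "exp (- q s)"] unfolding f_def A_def J_def by metis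
    obtain d2 where d2: "d2 > 0" "\<And>u y. u \<in> {0..T} \<Longrightarrow> \<bar>u - s\<bar> < d2 \<Longrightarrow> y \<ge> 0 \<Longrightarrow>
        \<bar>f u y - f s y - (u - s) * G y\<bar> \<le> e / 3 * \<bar>u - s\<bar>"
      using exp_path_uniformly_differentiable[OF p q p0[OF s] e3] unfolding f_def G_def by (smt (verit) mult_minus_right)
    obtain d3 where d3: "d3 > 0" "\<And>h y. 0 < h \<Longrightarrow> h < d3 \<Longrightarrow> y \<ge> 0 \<Longrightarrow> \<bar>trans_op P h G y - G y\<bar> < e / 3"
      using trans_op_strongly_continuous[OF P G0 e3] by metis
    obtain d4 where d4: "d4 > 0" "\<And>h y. 0 < h \<Longrightarrow> h < d4 \<Longrightarrow> y \<ge> 0 \<Longrightarrow> \<bar>trans_op P h D y - D y\<bar> < e / 3"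
      using trans_op_strongly_continuous[OF P D0 e3] by metis
    define d where "d = Min {d1, d2, d3, d4}"
    have d: "d > 0" "d \<le> d1" "d \<le> d2" "d \<le> d3" "d \<le> d4"
      using d1(1) d2(1) d3(1) d4(1) by (auto simp: d_def)
    have "\<bar>trans_op P u (f u) x - trans_op P s (f s) x - trans_op P s D x * (u - s)\<bar> \<le> e * \<bar>u - s\<bar>"
      if u: "u \<in> {0..T}" "\<bar>u - s\<bar> < d" for u
    proof (cases u s rule: linorder_cases)
      case greater
      define h where "h = u - s"
      have h: "h > 0" "h < d" "u = s + h" using greater u by (auto simp: h_def)
      have "\<bar>trans_op P h (f u) y - f s y - h * D y\<bar> \<le> e * h" if y: "y \<ge> 0" for y
      proof -
        have X: "\<bar>trans_op P h (\<lambda>y. f u y - f s y - h * G y) y\<bar> \<le> e / 3 * h"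
          using h y d d2(2)[OF u(1)] u(1) s by (intro trans_op_bound[OF P] C0) auto
        have eq: "trans_op P h (\<lambda>y. f u y - f s y - h * G y) y =
            trans_op P h (f u) y - trans_op P h (f s) y - h * trans_op P h G y"
          using h y u(1) s by (simp add: trans_op_diff[OF P] trans_op_cmult[OF P] C0)
        have Y: "\<bar>h * (trans_op P h G y - G y)\<bar> \<le> e / 3 * h"
          using d3(2)[of h y] h d y by (simp add: abs_mult mult.commute)
        have Z: "\<bar>trans_op P h (f s) y - f s y - h * A y\<bar> \<le> e / 3 * h"
          using d1(2)[of h y] h d y by simp
        show ?thesis
          by (rule abs_le_of_thirds[OF X Y Z]) (unfold eq DAG, simp add: algebra_simps)
      qed
      then have "\<bar>trans_op P s (\<lambda>y. trans_op P h (f u) y - f s y - h * D y) x\<bar> \<le> e * h"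
        using h x u(1) s by (intro trans_op_bound[OF P] C0) auto
      also have "trans_op P s (\<lambda>y. trans_op P h (f u) y - f s y - h * D y) x =
          trans_op P u (f u) x - trans_op P s (f s) x - h * trans_op P s D x"
        using h x u(1) s
        by (simp add: trans_op_diff[OF P] trans_op_cmult[OF P] C0 trans_op_semigroup[OF P])
      finally show ?thesis using h by (simp add: mult.commute)
    next
      case less
      define h where "h = s - u"
      have h: "h > 0" "h < d" "s = u + h" using less u by (auto simp: h_def)
      \<comment> \<open>The derivative appears here as \<open>P h D\<close>, because applying
        \<open>P u\<close> must produce \<open>P s D\<close>; strong continuity on \<open>D\<close>
        pays for this.\<close>
      have "\<bar>trans_op P h (f s) y - f u y - h * trans_op P h D y\<bar> \<le> e * h" if y: "y \<ge> 0" for y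
      proof -
        have "\<bar>f u y - f s y - (u - s) * G y\<bar> \<le> e / 3 * h"
          using h y d d2(2)[OF u(1)] by (metis abs_minus_commute abs_of_pos h_def less_le_trans u(2))
        then have X: "\<bar>f s y - f u y - h * G y\<bar> \<le> e / 3 * h"
          by (simp add: h_def abs_minus_commute algebra_simps)
        have Y: "\<bar>h * (D y - trans_op P h D y)\<bar> \<le> e / 3 * h"
          using d4(2)[of h y] h d y by (simp add: abs_mult mult.commute abs_minus_commute)
        have Z: "\<bar>trans_op P h (f s) y - f s y - h * A y\<bar> \<le> e / 3 * h"
          using d1(2)[of h y] h d y by simp
        show ?thesis
          by (rule abs_le_of_thirds[OF X Y Z]) (simp add: DAG algebra_simps)
      qed
      then have "\<bar>trans_op P u (\<lambda>y. trans_op P h (f s) y - f u y - h * trans_op P h D y) x\<bar> \<le> e * h"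
        using h x u(1) s by (intro trans_op_bound[OF P] C0) auto
      also have "trans_op P u (\<lambda>y. trans_op P h (f s) y - f u y - h * trans_op P h D y) x =
          trans_op P s (f s) x - trans_op P u (f u) x - h * trans_op P s D x"
      proof -
        have "trans_op P s F x = trans_op P u (trans_op P h F) x" if "F \<in> C0_half_line" for F
          using trans_op_semigroup[OF P, of u h x F] h x u(1) that by simp
        then show ?thesis
          using h(1) x u(1) s by (simp add: trans_op_diff[OF P] trans_op_cmult[OF P] C0)
      qed
      finally show ?thesis using h by (simp add: abs_minus_commute algebra_simps)
    qed simp
    then show ?thesis using d(1) by auto
  qed
  then have "((\<lambda>s. trans_op P s (f s) x) has_real_derivative trans_op P s D x) (at s within {0..T})"
    by (simp add: has_field_derivative_def has_derivative_within_alt bounded_linear_mult_right)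
  then show ?thesis
    unfolding f_def[abs_def] D_def[abs_def] J_def by simp
qed

text \<open>Along a supersolution both brackets in the derivative have a sign, so the integrand is
  nonpositive for every \<open>y \<ge> 0\<close> and the quantity decreases in \<open>s\<close>.
  This serves positive drift.\<close>

lemma laplace_upper_bound:
  fixes p q p' q' :: "real \<Rightarrow> real"
  assumes x: "x \<ge> 0" and T: "T \<ge> 0" and p0: "\<And>s. s \<in> {0..T} \<Longrightarrow> p s > 0"
    and p: "\<And>s. s \<in> {0..T} \<Longrightarrow> (p has_real_derivative p' s) (at s within {0..T})"
    and q: "\<And>s. s \<in> {0..T} \<Longrightarrow> (q has_real_derivative q' s) (at s within {0..T})"
    and p': "\<And>s. s \<in> {0..T} \<Longrightarrow> branching_mechanism g a \<alpha> \<eta> (p s) \<le> p' s"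
    and q': "\<And>s. s \<in> {0..T} \<Longrightarrow> - b * p s \<le> q' s"
  shows "trans_op P T (\<lambda>y. exp (- q T) * exp (- p T * y)) x \<le> exp (- q 0) * exp (- p 0 * x)"
proof -
  let ?F = "\<lambda>s. trans_op P s (\<lambda>y. exp (- q s) * exp (- p s * y)) x"
  let ?D = "\<lambda>s. trans_op P s (\<lambda>y. exp (- q s) * exp (- p s * y) *
        (y * (branching_mechanism g a \<alpha> \<eta> (p s) - p' s) - (b * p s + q' s))) x"
  have der: "(?F has_real_derivative ?D s) (at s within {0..T})" if "s \<in> {0..T}" for s
    by (rule trans_op_exp_path_derivative[OF x that p0 p[OF that] q[OF that]])
  have nonpos: "?D s \<le> 0" if "s \<in> {0..T}" for s
  proof -
    have "(LINT y|P s x. - (exp (- q s) * exp (- p s * y) *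
        (y * (branching_mechanism g a \<alpha> \<eta> (p s) - p' s) - (b * p s + q' s)))) \<ge> 0"
    proof (rule Bochner_Integration.integral_nonneg)
      fix y assume "y \<in> space (P s x)"
      then have y: "y \<ge> 0" using transition_prob(3)[OF P _ x, of s] that by auto
      have "y * (branching_mechanism g a \<alpha> \<eta> (p s) - p' s) \<le> 0"
        using y p'[OF that] by (simp add: mult_nonneg_nonpos)
      then show "- (exp (- q s) * exp (- p s * y) *
          (y * (branching_mechanism g a \<alpha> \<eta> (p s) - p' s) - (b * p s + q' s))) \<ge> 0"
        using q'[OF that] by (intro iffD2[OF neg_0_le_iff_le] mult_nonneg_nonpos) auto
    qed
    then show ?thesis by (simp add: trans_op_def)
  qed
  have "?F T \<le> ?F 0"
  proof (rule DERIV_nonpos_imp_decreasing_open[OF T])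
    show "\<exists>y. (?F has_real_derivative y) (at s) \<and> y \<le> 0" if "0 < s" "s < T" for s
      using der[of s] nonpos[of s] that by (auto simp: at_within_Icc_at)
    show "continuous_on {0..T} ?F"
      using der by (meson DERIV_continuous continuous_on_eq_continuous_within)
  qed
  also have "?F 0 = exp (- q 0) * exp (- p 0 * x)"
    using p0[of 0] T by (intro trans_op_0[OF P x] C0_half_line_exp) auto
  finally show ?thesis .
qed

text \<open>Along an exact solution both brackets vanish and the quantity is constant.\<close>

lemma laplace_eq:
  fixes p q :: "real \<Rightarrow> real"
  assumes x: "x \<ge> 0" and T: "T \<ge> 0" and p0: "\<And>s. s \<in> {0..T} \<Longrightarrow> p s > 0"
    and p: "\<And>s. s \<in> {0..T} \<Longrightarrow> (p has_real_derivative branching_mechanism g a \<alpha> \<eta> (p s)) (at s within {0..T})"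
    and q: "\<And>s. s \<in> {0..T} \<Longrightarrow> (q has_real_derivative - b * p s) (at s within {0..T})"
  shows "trans_op P T (\<lambda>y. exp (- q T) * exp (- p T * y)) x = exp (- q 0) * exp (- p 0 * x)"
proof -
  let ?F = "\<lambda>s. trans_op P s (\<lambda>y. exp (- q s) * exp (- p s * y)) x"
  have "(?F has_real_derivative 0) (at s within {0..T})" if "s \<in> {0..T}" for s
    using trans_op_exp_path_derivative[OF x that p0 p[OF that] q[OF that]] by (simp add: trans_op_def)
  then obtain c where "\<And>s. s \<in> {0..T} \<Longrightarrow> ?F s = c"
    using has_field_derivative_zero_constant[of "{0..T}" ?F] by auto
  then have "?F T = ?F 0" using T by simp
  also have "?F 0 = exp (- q 0) * exp (- p 0 * x)"
    using p0[of 0] T by (intro trans_op_0[OF P x] C0_half_line_exp) auto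
  finally show ?thesis .
qed

end

section \<open>The flow of the branching mechanism\<close>

text \<open>Nothing is asked of \<open>f\<close> at 0, where it may fail to be integrable; hence
  there is no canonical constant, and each use fixes its own.\<close>

lemma antiderivative_on_pos:
  fixes f :: "real \<Rightarrow> real"
  assumes "\<And>y. y > 0 \<Longrightarrow> isCont f y"
  shows "\<exists>F. \<forall>y>0. (F has_real_derivative f y) (at y)"
proof -
  have "\<exists>F. \<forall>x. 0 < ereal x \<longrightarrow> ereal x < \<infinity> \<longrightarrow> (F has_vector_derivative f x) (at x)"
    by (rule einterval_antiderivative) (use assms in auto)
  then obtain F where F: "\<And>x. 0 < ereal x \<Longrightarrow> ereal x < \<infinity> \<Longrightarrow> (F has_vector_derivative f x) (at x)"
    by blast
  have "(F has_real_derivative f y) (at y)" if "y > 0" for y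
    unfolding has_real_derivative_iff_has_vector_derivative by (rule F) (use that in simp_all)
  then show ?thesis by blast
qed

lemma tendsto_powr_at_right_0:
  fixes r :: real
  assumes "r > 0"
  shows "((\<lambda>y. y powr r) \<longlongrightarrow> 0) (at_right 0)"
proof (rule tendsto_zero_powrI[OF tendsto_ident_at tendsto_const _ assms])
  show "eventually (\<lambda>y::real. 0 \<le> y) (at_right 0)"
    using eventually_at_right_less[of "0::real"] by (rule eventually_mono) simp
qed

context
  fixes g :: nat and a :: real and \<alpha> \<eta> :: "nat \<Rightarrow> real"
  assumes g: "g \<ge> 1" and am: "strict_antimono_on {1..g} \<alpha>" and ag: "\<alpha> g > 1" and eta: "\<forall>i\<in>{1..g}. \<eta> i > 0"
begin

lemma alpha_ge: "i \<in> {1..g} \<Longrightarrow> \<alpha> g \<le> \<alpha> i"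
  using monotone_onD[OF am, of i g] g by (cases "i = g") auto

lemma branching_mechanism_isCont: "y > 0 \<Longrightarrow> isCont (branching_mechanism g a \<alpha> \<eta>) y"
  unfolding branching_mechanism_def[abs_def] by (intro continuous_intros) auto

lemma branching_mechanism_lower:
  assumes "y \<ge> 0"
  shows "\<eta> g * y powr \<alpha> g - a * y \<le> branching_mechanism g a \<alpha> \<eta> y"
  using member_le_sum[of g "{1..g}" "\<lambda>i. \<eta> i * y powr \<alpha> i"] g eta
  by (simp add: branching_mechanism_def less_imp_le)

lemma branching_mechanism_pos:
  assumes "a \<le> 0" "y > 0"
  shows "branching_mechanism g a \<alpha> \<eta> y > 0"
proof -
  have "0 < \<eta> g * y powr \<alpha> g" using eta g assms by simp
  moreover have "a * y \<le> 0" using assms by (simp add: mult_nonpos_nonneg)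
  ultimately show ?thesis using branching_mechanism_lower[of y] assms by linarith
qed

text \<open>On (0,1] a smaller exponent gives a larger power, so \<open>\<alpha> g\<close> controls
  every summand.\<close>

lemma branching_mechanism_upper:
  assumes "0 < y" "y \<le> 1"
  shows "branching_mechanism g a \<alpha> \<eta> y \<le> (\<Sum>i = 1..g. \<eta> i) * y powr \<alpha> g - a * y"
proof -
  have "(\<Sum>i = 1..g. \<eta> i * y powr \<alpha> i) \<le> (\<Sum>i = 1..g. \<eta> i * y powr \<alpha> g)"
    using alpha_ge eta assms by (intro sum_mono mult_left_mono powr_mono') (auto simp: less_imp_le)
  then show ?thesis by (simp add: branching_mechanism_def sum_distrib_right)
qed

text \<open>Separation of variables: \<open>H\<close> inverts the antiderivative \<open>G\<close> of
  \<open>1 / J\<close> with \<open>G l = 0\<close>. The flow exists for all negative times because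
  \<open>J\<close> is at most linear near 0, which forces \<open>G\<close> down to minus infinity
  there.\<close>

lemma branching_flow:
  assumes a: "a \<le> 0" and l: "l > 0"
  obtains H where "H 0 = l" "\<And>z. z \<le> 0 \<Longrightarrow> H z > 0"
    "\<And>z. z \<le> 0 \<Longrightarrow> (H has_real_derivative branching_mechanism g a \<alpha> \<eta> (H z)) (at z)"
    "(H \<longlongrightarrow> 0) at_bot"
proof -
  let ?J = "branching_mechanism g a \<alpha> \<eta>"
  note J0 = branching_mechanism_pos[OF a]
  have cont_inv: "isCont (\<lambda>y. 1 / ?J y) y" if "y > 0" for y
    using branching_mechanism_isCont[OF that] J0[OF that] by (intro isCont_divide continuous_const) auto
  obtain G0 where G0: "\<And>y. y > 0 \<Longrightarrow> (G0 has_real_derivative 1 / ?J y) (at y)"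
    using antiderivative_on_pos[of "\<lambda>y. 1 / ?J y", OF cont_inv] by auto
  define G where "G y = G0 y - G0 l" for y
  have G: "(G has_real_derivative 1 / ?J y) (at y)" if "y > 0" for y
    unfolding G_def[abs_def] using G0[OF that] by (auto intro!: derivative_eq_intros)
  have mono: "G y < G y'" if "0 < y" "y < y'" for y y'
  proof (rule DERIV_pos_imp_increasing[OF that(2)])
    fix x assume "y \<le> x" "x \<le> y'"
    then have "x > 0" using that by linarith
    then show "\<exists>D. (G has_real_derivative D) (at x) \<and> 0 < D" using G J0 by fastforce
  qed
  have cont: "isCont G y" if "y > 0" for y using G[OF that] by (rule DERIV_isCont)
  \<comment> \<open>As \<open>\<alpha> g > 1\<close>, \<open>J x \<le> C * x\<close> on (0,1];
    comparing derivatives then bounds \<open>G\<close> above by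
    \<open>G 1 + ln y / C\<close>.\<close>
  define C where "C = (\<Sum>i = 1..g. \<eta> i) - a"
  have "(\<Sum>i = 1..g. \<eta> i) > 0" using eta g by (intro sum_pos) auto
  then have C: "C > 0" using a by (simp add: C_def)
  have low: "G y \<le> G 1 + ln y / C" if "0 < y" "y \<le> 1" for y
  proof -
    have "G y - ln y / C \<le> G 1 - ln 1 / C"
    proof (rule DERIV_nonneg_imp_nondecreasing[OF that(2)])
      fix x assume x: "y \<le> x" "x \<le> 1"
      have x0: "x > 0" using x that by linarith
      have "x powr \<alpha> g \<le> x powr 1" using x x0 ag by (intro powr_mono') auto
      then have "(\<Sum>i = 1..g. \<eta> i) * x powr \<alpha> g \<le> (\<Sum>i = 1..g. \<eta> i) * x"
        using x0 \<open>(\<Sum>i = 1..g. \<eta> i) > 0\<close> by (intro mult_left_mono) auto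
      then have "?J x \<le> C * x"
        using branching_mechanism_upper[OF x0 x(2)] unfolding C_def left_diff_distrib by linarith
      then have "1 / x / C \<le> 1 / ?J x"
        using J0[OF x0] C x0 by (simp add: frac_le mult.commute)
      then show "\<exists>D. ((\<lambda>y. G y - ln y / C) has_real_derivative D) (at x) \<and> 0 \<le> D"
        using G[OF x0] x0 C by (intro exI[of _ "1 / ?J x - 1 / x / C"]) (auto intro!: derivative_eq_intros)
    qed
    then show ?thesis by simp
  qed
  \<comment> \<open>The margin beyond \<open>l\<close> makes 0 an interior point of the range of
    \<open>G\<close>, so that \<open>H\<close> has a two-sided derivative at 0.\<close>
  have ex: "\<exists>y>0. y < l + 1 \<and> G y = z" if z: "z < G (l + 1)" for z
  proof -
    \<comment> \<open>The last entry brings the logarithmic bound down to \<open>z\<close>, so that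
      the intermediate value theorem applies between \<open>y\<close> and
      \<open>l + 1\<close>.\<close>
    define y where "y = min (min 1 (l / 2)) (exp (C * (z - G 1)))"
    have y: "0 < y" "y \<le> 1" "y < l + 1" using l by (auto simp: y_def)
    have "ln y \<le> ln (exp (C * (z - G 1)))" using y(1) by (subst ln_le_cancel_iff) (auto simp: y_def)
    then have "ln y / C \<le> z - G 1" using C by (simp add: field_simps)
    then have "G y \<le> z" using low[OF y(1,2)] by linarith
    then obtain x where x: "y \<le> x" "x \<le> l + 1" "G x = z"
      using IVT[of G y z "l + 1"] z y cont by (auto simp: less_imp_le)
    moreover have "x \<noteq> l + 1" using x z by auto
    ultimately show ?thesis using y(1) by (intro exI[of _ x]) auto
  qed
  define H where "H z = (SOME y. 0 < y \<and> y < l + 1 \<and> G y = z)" for z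
  have "0 < H z \<and> H z < l + 1 \<and> G (H z) = z" if "z < G (l + 1)" for z
    unfolding H_def by (rule someI_ex) (use ex[OF that] in blast)
  then have H: "0 < H z" "H z < l + 1" "G (H z) = z" if "z < G (l + 1)" for z
    using that by blast+
  have inj: "y = y'" if "0 < y" "0 < y'" "G y = G y'" for y y'
    using mono[of y y'] mono[of y' y] that by (cases y y' rule: linorder_cases) auto
  have HG: "H (G y) = y" if "0 < y" "y < l + 1" for y
    using H[OF mono[OF that]] that(1) by (rule_tac inj) simp_all
  have z0: "z < G (l + 1)" if "z \<le> 0" for z
    using mono[OF l, of "l + 1"] that by (simp add: G_def)
  show thesis
  proof (rule that[of H])
    show "H 0 = l" using HG[of l] l by (simp add: G_def)
    show "H z > 0" if "z \<le> 0" for z using H(1) z0[OF that] .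
    show "(H has_real_derivative ?J (H z)) (at z)" if "z \<le> 0" for z
    proof -
      note hz = H[OF z0[OF that]]
      have "isCont H (G (H z))"
      proof (rule isCont_inverse_function[where f = G and x = "H z" and d = "min (H z) (l + 1 - H z) / 2"])
        fix y assume "\<bar>y - H z\<bar> \<le> min (H z) (l + 1 - H z) / 2"
        then have "\<bar>y - H z\<bar> \<le> H z / 2" "\<bar>y - H z\<bar> \<le> (l + 1 - H z) / 2" by auto
        moreover have "y - H z \<le> \<bar>y - H z\<bar>" "H z - y \<le> \<bar>y - H z\<bar>" by simp_all
        ultimately have "0 < y" "y < l + 1" using hz(1,2) by argo+
        then show "H (G y) = y" "isCont G y" using HG cont by auto
      qed (use hz in auto)
      then have "isCont H z" using hz by simp
      then have "(H has_real_derivative inverse (1 / ?J (H z))) (at z)"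
        using G[OF hz(1)] J0[OF hz(1)] z0[OF that] H(3)
        by (intro DERIV_inverse_function[where f = G and a = "z - 1" and b = "G (l + 1)"]) simp_all
      then show ?thesis by simp
    qed
    show "(H \<longlongrightarrow> 0) at_bot"
    proof (rule order_tendstoI)
      fix e :: real assume e: "e < 0"
      show "eventually (\<lambda>z. e < H z) at_bot"
        using eventually_le_at_bot[of 0]
      proof eventually_elim
        case (elim z)
        show ?case using H(1)[OF z0[OF elim]] e by linarith
      qed
    next
      fix e :: real assume e: "0 < e"
      show "eventually (\<lambda>z. H z < e) at_bot"
        using eventually_gt_at_bot[of "min 0 (G e)"]
      proof eventually_elim
        case (elim z)
        then have "z \<le> 0" "z < G e" by auto
        then have "G (H z) < G e" "0 < H z" using H[OF z0[of z]] by auto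
        then show "H z < e" using mono[of e "H z"] e by (cases e "H z" rule: linorder_cases) auto
      qed
    qed
  qed
qed

end

section \<open>Laplace transforms of the short rate\<close>

text \<open>The Markov property at time 0: since the start is constant, integrating the conditional
  probabilities identifies the law of \<open>R t\<close> with \<open>P t r\<^sub>0\<close>.\<close>

lemma markov_process_expectation:
  fixes M :: "'a measure"
  assumes P: "feller_semigroup P" and R: "markov_process_with M R P" and r0: "AE \<omega> in M. R 0 \<omega> = r\<^sub>0" "r\<^sub>0 \<ge> 0"
    and t: "t \<ge> 0" and f: "f \<in> C0_half_line"
  shows "(LINT \<omega>|M. f (R t \<omega>)) = trans_op P t f r\<^sub>0"
proof -
  interpret M: prob_space M using R by (simp add: markov_process_with_def)
  have Rm [measurable]: "R u \<in> measurable M half_line" if "u \<ge> 0" for u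
    using R that by (simp add: markov_process_with_def)
  note Rt = Rm[OF t]
  define F where "F = natural_filtration M R 0"
  let ?S = "\<Union>u\<in>{0..0}. {R u -` B \<inter> space M |B. B \<in> sets half_line}"
  have S: "?S \<subseteq> sets M"
    using measurable_sets[OF Rm[of 0]] by auto
  then have S': "?S \<subseteq> Pow (space M)"
    using sets.space_closed[of M] by (rule order_trans)
  have "sets F = sigma_sets (space M) ?S" "space F = space M"
    unfolding F_def natural_filtration_def using sets_measure_of[OF S'] space_measure_of[OF S'] by simp_all
  then have sub: "subalgebra M F"
    using sets.sigma_sets_subset[OF S] by (simp add: subalgebra_def)
  interpret finite_measure_subalgebra M F
    by unfold_locales (rule sub)
  have "distr M half_line (R t) = P t r\<^sub>0"
  proof (rule measure_eqI)
    show "sets (distr M half_line (R t)) = sets (P t r\<^sub>0)"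
      using transition_prob(2)[OF P t r0(2)] by simp
    fix B assume "B \<in> sets (distr M half_line (R t))"
    then have B [measurable]: "B \<in> sets half_line" by simp
    interpret Pt: prob_space "P t r\<^sub>0" using transition_prob(1)[OF P t r0(2)] .
    interpret D: prob_space "distr M half_line (R t)"
      using Rt by (rule M.prob_space_distr)
    have i: "integrable M (\<lambda>\<omega>'. indicator B (R t \<omega>') :: real)"
      using Rt by (intro M.integrable_const_bound[where B = 1]) (auto simp: indicator_def)
    have "measure (distr M half_line (R t)) B = (LINT \<omega>|M. indicator B (R t \<omega>))"
    proof -
      have "(LINT \<omega>|M. indicator B (R t \<omega>)) = (LINT x|distr M half_line (R t). indicator B x :: real)"
        using Rt by (subst integral_distr) auto
      then show ?thesis using sets.sets_into_space[OF B] by (simp add: Int_absorb2)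
    qed
    also have "\<dots> = (LINT \<omega>|M. real_cond_exp M F (\<lambda>\<omega>'. indicator B (R t \<omega>')) \<omega>)"
      by (rule real_cond_exp_int(2)[OF i, symmetric])
    also have "\<dots> = (LINT \<omega>|M. measure (P t r\<^sub>0) B)"
    proof (rule integral_cong_AE)
      have "AE \<omega> in M. real_cond_exp M F (\<lambda>\<omega>'. indicator B (R t \<omega>')) \<omega> = measure (P (t - 0) (R 0 \<omega>)) B"
        using R[unfolded markov_process_with_def, THEN conjunct2, THEN conjunct2, rule_format, of 0 t B] t B
        unfolding F_def by simp
      then show "AE \<omega> in M. real_cond_exp M F (\<lambda>\<omega>'. indicator B (R t \<omega>')) \<omega> = measure (P t r\<^sub>0) B"
        using r0(1) by eventually_elim simp
    qed auto
    finally have "measure (distr M half_line (R t)) B = measure (P t r\<^sub>0) B"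
      by (simp add: M.prob_space)
    then show "emeasure (distr M half_line (R t)) B = emeasure (P t r\<^sub>0) B"
      by (simp add: D.emeasure_eq_measure Pt.emeasure_eq_measure)
  qed
  then have "trans_op P t f r\<^sub>0 = (LINT x|distr M half_line (R t). f x)"
    by (simp add: trans_op_def)
  also have "\<dots> = (LINT \<omega>|M. f (R t \<omega>))"
    using Rt C0_half_line_measurable[OF f] by (rule integral_distr)
  finally show ?thesis by simp
qed

context
  fixes P g a b and \<alpha> \<eta> :: "nat \<Rightarrow> real"
  assumes P: "feller_semigroup P" and gen: "has_generator_on P (generator g a b \<alpha> \<eta>) test_functions"
    and g: "g \<ge> 1" and a1: "\<alpha> 1 \<le> 2" and am: "strict_antimono_on {1..g} \<alpha>" and ag: "\<alpha> g > 1"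
    and eta: "\<forall>i\<in>{1..g}. \<eta> i > 0"
begin

text \<open>Time is reversed: the path rises from \<open>w T\<close> at time 0 to \<open>l\<close>
  at time \<open>T\<close>, so that \<open>P T\<close> is applied to the exponential of rate
  \<open>l\<close>, while \<open>w T\<close> and the accumulated \<open>q\<close> are read off at
  the start.\<close>

lemma laplace_nonpos_drift:
  assumes a: "a \<le> 0" and l: "l > 0"
    and K: "\<And>y. y > 0 \<Longrightarrow> (K has_real_derivative y / branching_mechanism g a \<alpha> \<eta> y) (at y)"
  obtains w where "\<And>T. T \<ge> 0 \<Longrightarrow> w T > 0" "(w \<longlongrightarrow> 0) at_top"
    "\<And>T x. T \<ge> 0 \<Longrightarrow> x \<ge> 0 \<Longrightarrow> trans_op P T (\<lambda>y. exp (- l * y)) x = exp (- b * (K l - K (w T)) - w T * x)"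
proof -
  let ?J = "branching_mechanism g a \<alpha> \<eta>"
  obtain H where H: "H 0 = l" "\<And>z. z \<le> 0 \<Longrightarrow> H z > 0"
    "\<And>z. z \<le> 0 \<Longrightarrow> (H has_real_derivative ?J (H z)) (at z)" "(H \<longlongrightarrow> 0) at_bot"
    using branching_flow[OF g am ag eta a l] by metis
  show thesis
  proof (rule that[of "\<lambda>T. H (- T)"])
    show "H (- T) > 0" if "T \<ge> 0" for T using H(2) that by simp
    show "((\<lambda>T. H (- T)) \<longlongrightarrow> 0) at_top"
      using H(4) by (simp add: filterlim_at_bot_mirror)
    fix T x :: real assume T: "T \<ge> 0" and x: "x \<ge> 0"
    define p q where "p s = H (s - T)" and "q s = b * (K l - K (p s))" for s
    have p0: "p s > 0" if "s \<in> {0..T}" for s using H(2) that by (simp add: p_def)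
    have p: "(p has_real_derivative ?J (p s)) (at s)" if "s \<in> {0..T}" for s
      unfolding p_def[abs_def] using H(3)[of "s - T"] DERIV_shift[of H _ s "- T"] that by simp
    have q: "(q has_real_derivative - b * p s) (at s)" if "s \<in> {0..T}" for s
    proof -
      have "(q has_real_derivative b * (0 - p s / ?J (p s) * ?J (p s))) (at s)"
        unfolding q_def[abs_def]
        by (intro DERIV_cmult DERIV_diff DERIV_const DERIV_chain2[where f = K, OF K[OF p0[OF that]] p[OF that]])
      then show ?thesis
        using branching_mechanism_pos[OF g am ag eta a p0[OF that]] by simp
    qed
    have "trans_op P T (\<lambda>y. exp (- q T) * exp (- p T * y)) x = exp (- q 0) * exp (- p 0 * x)"
      by (rule laplace_eq[OF P gen g a1 am ag eta x T p0 has_field_derivative_at_within[OF p] has_field_derivative_at_within[OF q]])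
    then show "trans_op P T (\<lambda>y. exp (- l * y)) x = exp (- b * (K l - K (H (- T))) - H (- T) * x)"
      using H(1) by (simp add: p_def q_def mult_exp_exp)
  qed
qed

text \<open>For \<open>a > 0\<close> no exact solution is needed: near \<open>0\<close> the branching mechanism is below
  \<open>- (a / 2) y\<close>, so \<open>s \<longmapsto> y0 exp (- a s / 2)\<close> is an explicit supersolution along which the Laplace
  transform stays bounded away from \<open>1\<close> although its argument tends to \<open>0\<close>.\<close>

lemma laplace_pos_drift:
  assumes a: "a > 0" and b: "b \<ge> 0" and x: "x \<ge> 0" "x > 0 \<or> b > 0"
  obtains \<theta> where "\<theta> < 1" "\<And>l. l > 0 \<Longrightarrow> eventually (\<lambda>T. trans_op P T (\<lambda>y. exp (- l * y)) x \<le> \<theta>) at_top"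
proof -
  let ?J = "branching_mechanism g a \<alpha> \<eta>"
  have "((\<lambda>y. (\<Sum>i = 1..g. \<eta> i) * y powr (\<alpha> g - 1)) \<longlongrightarrow> (\<Sum>i = 1..g. \<eta> i) * 0) (at_right 0)"
    using ag by (intro tendsto_mult tendsto_const tendsto_powr_at_right_0) simp
  then have "eventually (\<lambda>y. (\<Sum>i = 1..g. \<eta> i) * y powr (\<alpha> g - 1) < a / 2) (at_right 0)"
    by (rule order_tendstoD(2)) (use a in simp)
  then obtain y1 where y1: "y1 > 0" "\<And>y. 0 < y \<Longrightarrow> y < y1 \<Longrightarrow> (\<Sum>i = 1..g. \<eta> i) * y powr (\<alpha> g - 1) < a / 2"
    by (auto simp: eventually_at_right_field)
  \<comment> \<open>The cap 1 is for \<open>branching_mechanism_upper\<close>; the half keeps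
    \<open>y0\<close> strictly below \<open>y1\<close>.\<close>
  define y0 where "y0 = min (y1 / 2) 1"
  have y0: "y0 > 0" "y0 < y1" "y0 \<le> 1" using y1(1) by (auto simp: y0_def)
  have J: "?J y \<le> - (a / 2) * y" if "0 < y" "y \<le> y0" for y
  proof -
    have "?J y \<le> ((\<Sum>i = 1..g. \<eta> i) * y powr (\<alpha> g - 1)) * y - a * y"
      using branching_mechanism_upper[OF g am ag eta, of y a] that y0 by (simp add: powr_diff)
    also have "\<dots> \<le> a / 2 * y - a * y"
      using y1(2)[of y] that y0 by (intro diff_right_mono mult_right_mono) auto
    finally show ?thesis by simp
  qed
  define w where "w T = y0 * exp (- (a / 2) * T)" for T
  have w0: "(w \<longlongrightarrow> 0) at_top"
  proof -
    have "LIM T at_top. - (a / 2) * T :> at_bot"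
      using a by (intro filterlim_tendsto_neg_mult_at_bot[OF tendsto_const]) (auto intro: filterlim_ident)
    from tendsto_mult_right_zero[OF filterlim_compose[OF exp_at_bot this], of y0]
    show ?thesis by (simp add: w_def[abs_def])
  qed
  have bound: "trans_op P T (\<lambda>y. exp (- w T * y)) x \<le> exp (- (2 * b / a) * (y0 - w T) - y0 * x)" if T: "T \<ge> 0" for T
  proof -
    \<comment> \<open>Solves \<open>q' = - b * w\<close> with \<open>q T = 0\<close>, because
      \<open>w' = - (a / 2) * w\<close>.\<close>
    define q where "q s = 2 * b / a * (w s - w T)" for s
    have w: "(w has_real_derivative - (a / 2) * w s) (at s)" for s
      unfolding w_def[abs_def] by (auto intro!: derivative_eq_intros)
    have q: "(q has_real_derivative - b * w s) (at s)" for s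
      unfolding q_def[abs_def] using a by (auto intro!: derivative_eq_intros w)
    have "trans_op P T (\<lambda>y. exp (- q T) * exp (- w T * y)) x \<le> exp (- q 0) * exp (- w 0 * x)"
    proof (rule laplace_upper_bound[OF P gen g a1 am ag eta x(1) T])
      show "w s > 0" for s using y0 by (simp add: w_def)
      show "?J (w s) \<le> - (a / 2) * w s" if "s \<in> {0..T}" for s
        using that y0 a by (intro J) (auto simp: w_def)
      show "(w has_real_derivative - (a / 2) * w s) (at s within {0..T})" for s
        by (rule has_field_derivative_at_within[OF w])
      show "(q has_real_derivative - b * w s) (at s within {0..T})" for s
        by (rule has_field_derivative_at_within[OF q])
    qed simp
    moreover have "q T = 0" "w 0 = y0" by (simp_all add: q_def w_def)
    ultimately show ?thesis by (simp add: q_def mult_exp_exp)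
  qed
  \<comment> \<open>The bound evaluated at \<open>w T = y0 / 2\<close>, valid once
    \<open>w T\<close> has fallen below that value. The rate \<open>l\<close> enters only through
    the time after which \<open>w T < l\<close>, hence \<theta> does not depend on it.\<close>
  define \<theta> where "\<theta> = exp (- (2 * b / a) * (y0 / 2) - y0 * x)"
  show thesis
  proof (rule that[of \<theta>])
    have "0 \<le> b / a * y0" "0 \<le> y0 * x" using a b y0 x by simp_all
    moreover have "0 < b / a * y0 \<or> 0 < y0 * x" using x(2) a y0 by auto
    ultimately have "- (2 * b / a) * (y0 / 2) - y0 * x < 0" by auto
    then show "\<theta> < 1" unfolding \<theta>_def by (subst exp_less_one_iff)
    fix l :: real assume l: "l > 0"
    have "eventually (\<lambda>T. w T < min l (y0 / 2)) at_top"
      using order_tendstoD(2)[OF w0, of "min l (y0 / 2)"] l y0 by simp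
    then show "eventually (\<lambda>T. trans_op P T (\<lambda>y. exp (- l * y)) x \<le> \<theta>) at_top"
      using eventually_ge_at_top[of 0]
    proof eventually_elim
      case (elim T)
      have wT: "w T > 0" using y0 by (simp add: w_def)
      have "trans_op P T (\<lambda>y. exp (- l * y)) x \<le> trans_op P T (\<lambda>y. exp (- w T * y)) x"
      proof (rule trans_op_mono[OF P])
        show "(\<lambda>y. exp (- l * y)) \<in> C0_half_line" "(\<lambda>y. exp (- w T * y)) \<in> C0_half_line"
          using C0_half_line_exp[OF l, of 1] C0_half_line_exp[OF wT, of 1] by simp_all
        fix y :: real assume "y \<ge> 0"
        then have "w T * y \<le> l * y" using elim by (intro mult_right_mono) auto
        then show "exp (- l * y) \<le> exp (- w T * y)" by simp
      qed (use elim x in auto)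
      also have "\<dots> \<le> exp (- (2 * b / a) * (y0 - w T) - y0 * x)"
        using bound elim by simp
      also have "\<dots> \<le> \<theta>"
      proof -
        have "2 * b / a * (y0 / 2) \<le> 2 * b / a * (y0 - w T)"
          using elim a b by (intro mult_left_mono) auto
        then show ?thesis unfolding \<theta>_def by simp
      qed
      finally show ?case .
    qed
  qed
qed

end

section \<open>The potential \<open>K\<close> near the origin\<close>

lemma tendsto_inf_at_right_0:
  fixes K :: "real \<Rightarrow> real"
  assumes mono: "\<And>x y. 0 < x \<Longrightarrow> x \<le> y \<Longrightarrow> K x \<le> K y" and bdd: "\<And>x. 0 < x \<Longrightarrow> c \<le> K x"
  obtains L where "(K \<longlongrightarrow> L) (at_right 0)"
proof -
  have bb: "bdd_below (K ` {0<..})" using bdd by (intro bdd_belowI[of _ c]) auto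
  define L where "L = Inf (K ` {0<..})"
  have low: "L \<le> K x" if "x > 0" for x unfolding L_def using bb that by (intro cInf_lower) auto
  have "(K \<longlongrightarrow> L) (at_right 0)"
  proof (rule order_tendstoI)
    fix e assume "e < L"
    then show "eventually (\<lambda>x. e < K x) (at_right 0)"
      using low by (auto simp: eventually_at_right_field intro!: exI[of _ 1] intro: less_le_trans)
  next
    fix e assume "L < e"
    then obtain y where y: "y > 0" "K y < e"
      unfolding L_def using cInf_lessD[of "K ` {0<..}" e] by auto
    then show "eventually (\<lambda>x. K x < e) (at_right 0)"
      using mono by (auto simp: eventually_at_right_field intro!: exI[of _ y]) (meson le_less_trans less_imp_le)
  qed
  then show thesis by (rule that)
qed

context
  fixes g :: nat and a :: real and \<alpha> \<eta> :: "nat \<Rightarrow> real"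
  assumes g: "g \<ge> 1" and am: "strict_antimono_on {1..g} \<alpha>" and ag: "\<alpha> g > 1" and eta: "\<forall>i\<in>{1..g}. \<eta> i > 0"
begin

lemma branching_potential_exists:
  assumes a: "a \<le> 0"
  obtains K where "\<And>y. y > 0 \<Longrightarrow> (K has_real_derivative y / branching_mechanism g a \<alpha> \<eta> y) (at y)"
proof -
  let ?J = "branching_mechanism g a \<alpha> \<eta>"
  have cont: "isCont (\<lambda>y. y / ?J y) y" if "y > 0" for y
    using branching_mechanism_isCont[OF g am ag eta that] branching_mechanism_pos[OF g am ag eta a that]
    by (intro isCont_divide) auto
  show thesis
    using antiderivative_on_pos[of "\<lambda>y. y / ?J y", OF cont] that by auto
qed

text \<open>Here \<open>2 - \<beta>\<close> is the order of \<open>J\<close> at 0, so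
  \<open>y / J y\<close> behaves like \<open>y powr (\<beta> - 1) / \<kappa>\<close> and is
  integrable there. Subtracting the limit of an antiderivative at 0 normalises \<open>K\<close>, and
  l'Hopital's rule gives the asymptotics.\<close>

lemma branching_potential:
  assumes a: "a \<le> 0" and low: "\<And>y. y > 0 \<Longrightarrow> \<kappa> * y powr (2 - \<beta>) \<le> branching_mechanism g a \<alpha> \<eta> y"
    and lim: "((\<lambda>y. branching_mechanism g a \<alpha> \<eta> y / y powr (2 - \<beta>)) \<longlongrightarrow> \<kappa>) (at_right 0)"
    and k: "\<kappa> > 0" and b: "\<beta> > 0"
  obtains K where "\<And>y. y > 0 \<Longrightarrow> (K has_real_derivative y / branching_mechanism g a \<alpha> \<eta> y) (at y)"
    "(K \<longlongrightarrow> 0) (at_right 0)" "((\<lambda>y. K y / y powr \<beta>) \<longlongrightarrow> 1 / (\<kappa> * \<beta>)) (at_right 0)"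
proof -
  let ?J = "branching_mechanism g a \<alpha> \<eta>"
  note J0 = branching_mechanism_pos[OF g am ag eta a]
  obtain K0 where K0: "\<And>y. y > 0 \<Longrightarrow> (K0 has_real_derivative y / ?J y) (at y)"
    using branching_potential_exists[OF a] by metis
  \<comment> \<open>Antiderivative of the majorant of \<open>y / J y\<close>. As
    \<open>B - K0\<close> increases and \<open>B \<ge> 0\<close>, \<open>K0\<close> stays bounded
    below near 0.\<close>
  define B where "B y = y powr \<beta> / (\<kappa> * \<beta>)" for y
  have Bd: "(B has_real_derivative y powr (\<beta> - 1) / \<kappa>) (at y)" if "y > 0" for y
    unfolding B_def[abs_def] using that k b by (auto intro!: derivative_eq_intros)
  have mono: "K0 x \<le> K0 y" if "0 < x" "x \<le> y" for x y
  proof (rule DERIV_nonneg_imp_nondecreasing[OF that(2)])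
    fix z assume "x \<le> z" "z \<le> y"
    then have "z > 0" using that by linarith
    then show "\<exists>D. (K0 has_real_derivative D) (at z) \<and> 0 \<le> D"
      using K0 J0 by (intro exI[of _ "z / ?J z"]) (auto simp: less_imp_le)
  qed
  have KB: "B x - K0 x \<le> B y - K0 y" if "0 < x" "x \<le> y" for x y
  proof (rule DERIV_nonneg_imp_nondecreasing[OF that(2)])
    fix z assume "x \<le> z" "z \<le> y"
    then have z: "z > 0" using that by linarith
    have "z / ?J z \<le> z / (\<kappa> * z powr (2 - \<beta>))"
      using low[OF z] z k J0[OF z] by (intro divide_left_mono mult_pos_pos) auto
    also have "\<dots> = z powr (\<beta> - 1) / \<kappa>"
      using z by (simp add: powr_diff power2_eq_square field_simps)
    finally show "\<exists>D. ((\<lambda>z. B z - K0 z) has_real_derivative D) (at z) \<and> 0 \<le> D"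
      using z by (intro exI[of _ "z powr (\<beta> - 1) / \<kappa> - z / ?J z"]) (auto intro!: derivative_intros Bd K0)
  qed
  have "min (K0 1) (K0 1 - B 1) \<le> K0 x" if x: "x > 0" for x
  proof (cases "x \<le> 1")
    case True
    have "B x \<ge> 0" using k b by (simp add: B_def)
    then show ?thesis using KB[OF x True] by linarith
  next
    case False
    then show ?thesis using mono[of 1 x] by linarith
  qed
  with mono obtain L where L: "(K0 \<longlongrightarrow> L) (at_right 0)"
    using tendsto_inf_at_right_0[of K0] by metis
  define K where "K y = K0 y - L" for y
  have K: "(K has_real_derivative y / ?J y) (at y)" if "y > 0" for y
    unfolding K_def[abs_def] using K0[OF that] by (auto intro!: derivative_eq_intros)
  have K_0: "(K \<longlongrightarrow> 0) (at_right 0)"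
    unfolding K_def[abs_def] using tendsto_diff[OF L tendsto_const[of L]] by simp
  have ev: "eventually (\<lambda>y::real. y > 0) (at_right 0)" by (simp add: eventually_at_right_less)
  have "((\<lambda>y. K y / y powr \<beta>) \<longlongrightarrow> 1 / (\<kappa> * \<beta>)) (at_right 0)"
  proof (rule lhopital_right_0[OF K_0])
    show "((\<lambda>y. y powr \<beta>) \<longlongrightarrow> 0) (at_right 0)"
      by (rule tendsto_powr_at_right_0[OF b])
    show "eventually (\<lambda>y. y powr \<beta> \<noteq> 0) (at_right 0)" using ev by eventually_elim simp
    show "eventually (\<lambda>y. \<beta> * y powr (\<beta> - 1) \<noteq> 0) (at_right 0)" using ev by eventually_elim (use b in simp)
    show "eventually (\<lambda>y. (K has_real_derivative y / ?J y) (at y)) (at_right 0)"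
      using ev by eventually_elim (rule K)
    show "eventually (\<lambda>y. ((\<lambda>y. y powr \<beta>) has_real_derivative \<beta> * y powr (\<beta> - 1)) (at y)) (at_right 0)"
      using ev by eventually_elim (auto intro!: derivative_eq_intros)
    have "((\<lambda>y. 1 / (?J y / y powr (2 - \<beta>) * \<beta>)) \<longlongrightarrow> 1 / (\<kappa> * \<beta>)) (at_right 0)"
      using k b by (intro tendsto_intros lim) auto
    then show "((\<lambda>y. (y / ?J y) / (\<beta> * y powr (\<beta> - 1))) \<longlongrightarrow> 1 / (\<kappa> * \<beta>)) (at_right 0)"
    proof (rule Lim_transform_eventually)
      show "eventually (\<lambda>y. 1 / (?J y / y powr (2 - \<beta>) * \<beta>) = (y / ?J y) / (\<beta> * y powr (\<beta> - 1))) (at_right 0)"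
        using ev by eventually_elim (simp add: powr_diff power2_eq_square field_simps)
    qed
  qed
  then show thesis using K K_0 that by blast
qed

text \<open>The linear term dominates at 0, hence \<open>\<beta> = 1\<close> and
  \<open>\<kappa> = - a\<close>.\<close>

lemma branching_potential_neg_drift:
  assumes a: "a < 0"
  obtains K where "\<And>y. y > 0 \<Longrightarrow> (K has_real_derivative y / branching_mechanism g a \<alpha> \<eta> y) (at y)"
    "(K \<longlongrightarrow> 0) (at_right 0)" "((\<lambda>y. K y / y) \<longlongrightarrow> - 1 / a) (at_right 0)"
proof -
  have ev: "eventually (\<lambda>y::real. y > 0) (at_right 0)" by (simp add: eventually_at_right_less)
  have "((\<lambda>y. (\<Sum>i = 1..g. \<eta> i * y powr (\<alpha> i - 1)) - a) \<longlongrightarrow> (\<Sum>i = 1..g. \<eta> i * 0) - a) (at_right 0)"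
    using ag alpha_ge[OF g am ag eta]
    by (intro tendsto_diff tendsto_sum tendsto_mult_left tendsto_const tendsto_powr_at_right_0) (auto simp: less_le_trans)
  then have "((\<lambda>y. (\<Sum>i = 1..g. \<eta> i * y powr (\<alpha> i - 1)) - a) \<longlongrightarrow> - a) (at_right 0)" by simp
  then have lim: "((\<lambda>y. branching_mechanism g a \<alpha> \<eta> y / y powr (2 - 1)) \<longlongrightarrow> - a) (at_right 0)"
  proof (rule Lim_transform_eventually)
    show "eventually (\<lambda>y. (\<Sum>i = 1..g. \<eta> i * y powr (\<alpha> i - 1)) - a = branching_mechanism g a \<alpha> \<eta> y / y powr (2 - 1)) (at_right 0)"
      using ev by eventually_elim (simp add: branching_mechanism_def powr_diff diff_divide_distrib sum_divide_distrib)
  qed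
  have low: "- a * y powr (2 - 1) \<le> branching_mechanism g a \<alpha> \<eta> y" if "y > 0" for y
    using eta g that by (auto simp: branching_mechanism_def intro!: sum_nonneg simp: less_imp_le)
  show thesis
  proof (rule branching_potential[OF _ low lim])
    fix K assume K: "\<And>y. y > 0 \<Longrightarrow> (K has_real_derivative y / branching_mechanism g a \<alpha> \<eta> y) (at y)"
      "(K \<longlongrightarrow> 0) (at_right 0)" "((\<lambda>y. K y / y powr 1) \<longlongrightarrow> 1 / (- a * 1)) (at_right 0)"
    have "((\<lambda>y. K y / y) \<longlongrightarrow> - 1 / a) (at_right 0)"
      by (rule Lim_transform_eventually[of "\<lambda>y. K y / y powr 1"])
        (use K(3) ev in \<open>auto elim: eventually_mono\<close>)
    with K(1,2) show thesis by (rule that)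
  qed (use a in auto)
qed

text \<open>The smallest index dominates at 0, hence \<open>\<beta> = 2 - \<alpha> g\<close> and
  \<open>\<kappa> = \<eta> g\<close>; positivity of this \<beta> is where
  \<open>\<alpha> g < 2\<close> enters.\<close>

lemma branching_potential_zero_drift:
  assumes a: "a = 0" and a2: "\<alpha> g < 2"
  obtains K where "\<And>y. y > 0 \<Longrightarrow> (K has_real_derivative y / branching_mechanism g a \<alpha> \<eta> y) (at y)"
    "(K \<longlongrightarrow> 0) (at_right 0)" "((\<lambda>y. K y / y powr (2 - \<alpha> g)) \<longlongrightarrow> 1 / (\<eta> g * (2 - \<alpha> g))) (at_right 0)"
proof -
  have ev: "eventually (\<lambda>y::real. y > 0) (at_right 0)" by (simp add: eventually_at_right_less)
  have "((\<lambda>y. \<Sum>i = 1..g. \<eta> i * y powr (\<alpha> i - \<alpha> g)) \<longlongrightarrow> (\<Sum>i = 1..g. \<eta> i * (if i = g then 1 else 0))) (at_right 0)"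
  proof (intro tendsto_intros)
    fix i assume i: "i \<in> {1..g}"
    show "((\<lambda>y. y powr (\<alpha> i - \<alpha> g)) \<longlongrightarrow> (if i = g then 1 else 0)) (at_right 0)"
    proof (cases "i = g")
      case True
      then show ?thesis
        by (auto intro!: tendsto_eventually eventually_mono[OF ev])
    next
      case False
      then have "\<alpha> g < \<alpha> i" using monotone_onD[OF am, of i g] g i by auto
      then show ?thesis using False tendsto_powr_at_right_0[of "\<alpha> i - \<alpha> g"] by simp
    qed
  qed
  then have "((\<lambda>y. \<Sum>i = 1..g. \<eta> i * y powr (\<alpha> i - \<alpha> g)) \<longlongrightarrow> \<eta> g) (at_right 0)"
    using g by (simp add: if_distrib cong: if_cong)
  then have lim: "((\<lambda>y. branching_mechanism g a \<alpha> \<eta> y / y powr (2 - (2 - \<alpha> g))) \<longlongrightarrow> \<eta> g) (at_right 0)"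
  proof (rule Lim_transform_eventually)
    show "eventually (\<lambda>y. (\<Sum>i = 1..g. \<eta> i * y powr (\<alpha> i - \<alpha> g)) = branching_mechanism g a \<alpha> \<eta> y / y powr (2 - (2 - \<alpha> g))) (at_right 0)"
      using ev by eventually_elim (simp add: a branching_mechanism_def powr_diff sum_divide_distrib)
  qed
  have low: "\<eta> g * y powr (2 - (2 - \<alpha> g)) \<le> branching_mechanism g a \<alpha> \<eta> y" if "y > 0" for y
    using branching_mechanism_lower[OF g am ag eta, of y a] that a by simp
  have "\<eta> g > 0" using eta g by auto
  then show thesis
    using branching_potential[OF _ low lim] that a a2 by auto
qed

end

section \<open>Weighted moments and continuous functions\<close>

lemma weighted_continuous_integrable:
  fixes W Y :: "'a \<Rightarrow> real" and h :: "real \<Rightarrow> real"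
  assumes W: "integrable M W" and Y: "Y \<in> borel_measurable M" "\<And>x. x \<in> space M \<Longrightarrow> Y x \<in> {0..1}"
    and h: "continuous_on {0..1} h"
  shows "integrable M (\<lambda>x. W x * h (Y x))"
proof -
  have "bounded (h ` {0..1})" using h by (intro compact_imp_bounded compact_continuous_image) auto
  then obtain B where B: "\<forall>z\<in>h ` {0..1}. norm z \<le> B" unfolding bounded_iff by blast
  have "Y \<in> measurable M (restrict_space borel {0..1})"
    by (rule measurable_restrict_space2[OF _ Y(1)]) (use Y(2) in blast)
  then have "(\<lambda>x. h (Y x)) \<in> borel_measurable M"
    using borel_measurable_continuous_on_restrict[OF h] by (rule measurable_compose)
  then have meas: "(\<lambda>x. W x * h (Y x)) \<in> borel_measurable M"
    using borel_measurable_integrable[OF W] by (intro borel_measurable_times)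
  have bound: "norm (W x * h (Y x)) \<le> norm (B * W x)" if "x \<in> space M" for x
  proof -
    have "\<bar>h (Y x)\<bar> \<le> \<bar>B\<bar>"
      using bspec[OF B imageI[OF Y(2)[OF that]]] by simp
    then show ?thesis
      using mult_left_mono[of "\<bar>h (Y x)\<bar>" "\<bar>B\<bar>" "\<bar>W x\<bar>"] by (simp add: abs_mult mult.commute)
  qed
  show ?thesis
    by (rule Bochner_Integration.integrable_bound[OF integrable_mult_right[OF W] meas AE_I2[OF bound]])
qed

text \<open>For nonnegative weights a uniform error \<open>e\<close> costs at most \<open>e\<close>
  times the total weight.\<close>

lemma weighted_polynomial_approx:
  fixes W Y :: "'a \<Rightarrow> real" and h :: "real \<Rightarrow> real"
  assumes W: "integrable M W" "\<And>x. x \<in> space M \<Longrightarrow> W x \<ge> 0"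
    and Y: "Y \<in> borel_measurable M" "\<And>x. x \<in> space M \<Longrightarrow> Y x \<in> {0..1}"
    and h: "continuous_on {0..1} h"
    and p: "\<And>y. y \<in> {0..1} \<Longrightarrow> \<bar>h y - (\<Sum>i\<le>n. c i * y ^ i)\<bar> < e"
  shows "\<bar>(LINT x|M. W x * h (Y x)) - (\<Sum>i\<le>n. c i * (LINT x|M. W x * Y x ^ i))\<bar> \<le> e * (LINT x|M. W x)"
proof -
  have ih: "integrable M (\<lambda>x. W x * h (Y x))"
    by (rule weighted_continuous_integrable[OF W(1) Y h])
  have im: "integrable M (\<lambda>x. c i * (W x * Y x ^ i))" for i
    using weighted_continuous_integrable[OF W(1) Y, of "\<lambda>y. y ^ i"]
    by (intro integrable_mult_right) (simp add: continuous_on_power)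
  have "(LINT x|M. W x * h (Y x)) - (\<Sum>i\<le>n. c i * (LINT x|M. W x * Y x ^ i)) =
      (LINT x|M. W x * h (Y x) - (\<Sum>i\<le>n. c i * (W x * Y x ^ i)))"
    by (simp add: Bochner_Integration.integral_diff[OF ih Bochner_Integration.integrable_sum[OF im]]
        Bochner_Integration.integral_sum[OF im])
  also have "\<bar>\<dots>\<bar> \<le> (LINT x|M. \<bar>W x * h (Y x) - (\<Sum>i\<le>n. c i * (W x * Y x ^ i))\<bar>)"
    by (rule integral_abs_bound)
  also have "\<dots> \<le> (LINT x|M. e * W x)"
  proof (rule integral_mono)
    show "integrable M (\<lambda>x. \<bar>W x * h (Y x) - (\<Sum>i\<le>n. c i * (W x * Y x ^ i))\<bar>)"
      using ih im by (intro integrable_abs Bochner_Integration.integrable_diff Bochner_Integration.integrable_sum)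
    show "integrable M (\<lambda>x. e * W x)" using W(1) by simp
    fix x assume x: "x \<in> space M"
    have "W x * h (Y x) - (\<Sum>i\<le>n. c i * (W x * Y x ^ i)) = W x * (h (Y x) - (\<Sum>i\<le>n. c i * Y x ^ i))"
      by (simp add: right_diff_distrib sum_distrib_left mult.left_commute)
    then show "\<bar>W x * h (Y x) - (\<Sum>i\<le>n. c i * (W x * Y x ^ i))\<bar> \<le> e * W x"
      using mult_left_mono[OF less_imp_le[OF p[OF Y(2)[OF x]]] W(2)[OF x]] W(2)[OF x]
      by (simp add: abs_mult mult.commute)
  qed
  finally show ?thesis by simp
qed

text \<open>Weierstrass approximation: the moments of order 0 keep the total weights bounded, so one
  polynomial serves all late indices. Weight 1 will give weak convergence; varying weights give the
  unnormalised measures of the Tauberian theorem.\<close>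

lemma tendsto_weighted_moments:
  fixes W Y :: "'i \<Rightarrow> 'a \<Rightarrow> real" and V Z :: "'b \<Rightarrow> real" and h :: "real \<Rightarrow> real"
  assumes W: "\<And>i. integrable M (W i)" "\<And>i x. x \<in> space M \<Longrightarrow> W i x \<ge> 0"
    and Y: "\<And>i. Y i \<in> borel_measurable M" "\<And>i x. x \<in> space M \<Longrightarrow> Y i x \<in> {0..1}"
    and V: "integrable N V" "\<And>x. x \<in> space N \<Longrightarrow> V x \<ge> 0"
    and Z: "Z \<in> borel_measurable N" "\<And>x. x \<in> space N \<Longrightarrow> Z x \<in> {0..1}"
    and mom: "\<And>n. ((\<lambda>i. LINT x|M. W i x * Y i x ^ n) \<longlongrightarrow> (LINT x|N. V x * Z x ^ n)) F"
    and h: "continuous_on {0..1} h"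
  shows "((\<lambda>i. LINT x|M. W i x * h (Y i x)) \<longlongrightarrow> (LINT x|N. V x * h (Z x))) F"
proof (rule tendstoI)
  fix \<epsilon> :: real assume eps: "\<epsilon> > 0"
  \<comment> \<open>The summand 1 puts \<open>C\<close> strictly above the limiting total weight, so
    that the total weights eventually fall below \<open>C\<close>.\<close>
  define C where "C = (LINT x|N. V x) + 1"
  have "(LINT x|N. V x) \<ge> 0" using V(2) by (intro Bochner_Integration.integral_nonneg)
  then have C: "C > 0" by (simp add: C_def)
  define e where "e = \<epsilon> / (3 * C)"
  have e: "e > 0" using eps C by (simp add: e_def)
  obtain f where f: "real_polynomial_function f" "\<And>y. y \<in> {0..1} \<Longrightarrow> \<bar>h y - f y\<bar> < e"
    using Stone_Weierstrass_real_polynomial_function[of "{0..1}" h e] h e by auto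
  obtain c n where "f = (\<lambda>y. \<Sum>i\<le>n. c i * y ^ i)"
    using f(1) by (auto simp: real_polynomial_function_iff_sum)
  with f have p: "\<And>y. y \<in> {0..1} \<Longrightarrow> \<bar>h y - (\<Sum>i\<le>n. c i * y ^ i)\<bar> < e" by simp
  have "((\<lambda>i. LINT x|M. W i x) \<longlongrightarrow> (LINT x|N. V x)) F"
    using mom[of 0] by simp
  then have "eventually (\<lambda>i. (LINT x|M. W i x) < C) F"
    by (rule order_tendstoD(2)) (simp add: C_def)
  moreover have "((\<lambda>i. \<Sum>k\<le>n. c k * (LINT x|M. W i x * Y i x ^ k)) \<longlongrightarrow> (\<Sum>k\<le>n. c k * (LINT x|N. V x * Z x ^ k))) F"
    by (intro tendsto_intros mom)
  from tendstoD[OF this, of "\<epsilon> / 3"] eps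
  have "eventually (\<lambda>i. \<bar>(\<Sum>k\<le>n. c k * (LINT x|M. W i x * Y i x ^ k)) - (\<Sum>k\<le>n. c k * (LINT x|N. V x * Z x ^ k))\<bar> < \<epsilon> / 3) F"
    by (simp add: dist_real_def)
  ultimately show "eventually (\<lambda>i. dist (LINT x|M. W i x * h (Y i x)) (LINT x|N. V x * h (Z x)) < \<epsilon>) F"
  proof eventually_elim
    case (elim i)
    have "\<bar>(LINT x|M. W i x * h (Y i x)) - (\<Sum>k\<le>n. c k * (LINT x|M. W i x * Y i x ^ k))\<bar> \<le> e * (LINT x|M. W i x)"
      by (rule weighted_polynomial_approx[OF W Y h p])
    also have "\<dots> \<le> e * C" using elim(1) e by (intro mult_left_mono) auto
    also have "\<dots> = \<epsilon> / 3" using C by (simp add: e_def)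
    finally have 1: "\<bar>(LINT x|M. W i x * h (Y i x)) - (\<Sum>k\<le>n. c k * (LINT x|M. W i x * Y i x ^ k))\<bar> \<le> \<epsilon> / 3" .
    have "\<bar>(LINT x|N. V x * h (Z x)) - (\<Sum>k\<le>n. c k * (LINT x|N. V x * Z x ^ k))\<bar> \<le> e * (LINT x|N. V x)"
      by (rule weighted_polynomial_approx[OF V Z h p])
    also have "\<dots> \<le> e * C" using e by (intro mult_left_mono) (auto simp: C_def)
    also have "\<dots> = \<epsilon> / 3" using C by (simp add: e_def)
    finally show ?case using 1 elim(2) unfolding dist_real_def by linarith
  qed
qed

text \<open>A ramp on the scale \<open>u = exp (- r)\<close>. Truncation at \<open>exp (- b)\<close>
  removes the singularity of the logarithm at 0 and does not change the value, since
  \<open>cts_step a b\<close> vanishes from \<open>b\<close> on.\<close>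

lemma continuous_on_cts_step_ln:
  assumes "a < b"
  shows "continuous_on S (\<lambda>u. cts_step a b (- ln (max u (exp (- b)))))"
proof -
  have "continuous_on UNIV (cts_step a b)"
    using cts_step_uniformly_continuous[OF assms] by (rule uniformly_continuous_imp_continuous)
  moreover have "max u (exp (- b)) > 0" for u :: real
    by (simp add: less_max_iff_disj)
  then have "continuous_on S (\<lambda>u. - ln (max u (exp (- b))))"
    by (intro continuous_intros) (auto simp: less_le)
  ultimately show ?thesis by (rule continuous_on_compose2) simp
qed

lemma cts_step_ln_exp: "a < b \<Longrightarrow> cts_step a b (- ln (max (exp (- r)) (exp (- b)))) = cts_step a b r"
  by (auto simp: cts_step_def max_def)

section \<open>Convergence in distribution and Laplace transforms\<close>

lemma measurable_half_line_borel: "f \<in> measurable M half_line \<Longrightarrow> f \<in> borel_measurable M"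
  by (simp add: half_line_def measurable_restrict_space2_iff)

lemma measurable_half_line_nonneg: "f \<in> measurable M half_line \<Longrightarrow> x \<in> space M \<Longrightarrow> f x \<ge> 0"
  using measurable_space[of f M half_line x] by simp

text \<open>Limits in continuous time are tested along arbitrary sequences of times tending to
  infinity; the next lemma is the converse passage.\<close>

lemma conv_in_distr_imp_weak_conv:
  assumes "conv_in_distr M R N X" "filterlim t at_top sequentially"
  shows "weak_conv_m (\<lambda>n. distr M borel (R (t n))) (distr N borel X)"
  unfolding weak_conv_m_def weak_conv_def
proof (intro allI impI)
  fix x assume "isCont (cdf (distr N borel X)) x"
  then have "((\<lambda>t. cdf (distr M borel (R t)) x) \<longlongrightarrow> cdf (distr N borel X) x) at_top"
    using assms(1) by (simp add: conv_in_distr_def)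
  then show "(\<lambda>n. cdf (distr M borel (R (t n))) x) \<longlonglongrightarrow> cdf (distr N borel X) x"
    using assms(2) by (rule filterlim_compose)
qed

lemma conv_in_distr_weak_convI:
  assumes "prob_space N" "X \<in> borel_measurable N"
    and "\<And>t. filterlim t at_top sequentially \<Longrightarrow> weak_conv_m (\<lambda>n. distr M borel (R (t n))) (distr N borel X)"
  shows "conv_in_distr M R N X"
  unfolding conv_in_distr_def
proof (intro conjI allI impI assms(1,2))
  fix x assume x: "isCont (cdf (distr N borel X)) x"
  show "((\<lambda>t. cdf (distr M borel (R t)) x) \<longlongrightarrow> cdf (distr N borel X) x) at_top"
  proof (rule tendsto_at_topI_sequentially)
    fix t :: "nat \<Rightarrow> real" assume "filterlim t at_top sequentially"
    from assms(3)[OF this] x show "(\<lambda>n. cdf (distr M borel (R (t n))) x) \<longlonglongrightarrow> cdf (distr N borel X) x"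
      by (simp add: weak_conv_m_def weak_conv_def)
  qed
qed

text \<open>Nothing is known about \<open>R t\<close> for negative \<open>t\<close>, not even measurability.\<close>

lemma conv_in_distr_shift:
  "conv_in_distr M (\<lambda>t. R (max 0 t)) N X \<longleftrightarrow> conv_in_distr M R N X"
proof -
  have "eventually (\<lambda>t. cdf (distr M borel (R (max 0 t))) x = cdf (distr M borel (R t)) x) at_top" for x
    using eventually_ge_at_top[of 0] by eventually_elim simp
  from tendsto_cong[OF this] show ?thesis
    unfolding conv_in_distr_def by simp
qed

text \<open>In the variable \<open>exp (- R t)\<close> the transforms at positive integers are
  moments. These determine the limits of integrals of ramps, which characterise weak
  convergence.\<close>

lemma laplace_convergence_imp_conv_in_distr:
  fixes R :: "real \<Rightarrow> 'a \<Rightarrow> real" and X :: "'b \<Rightarrow> real"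
  assumes M: "prob_space M" and R: "\<And>t. t \<ge> 0 \<Longrightarrow> R t \<in> measurable M half_line"
    and N: "prob_space N" and X: "X \<in> borel_measurable N" "\<And>\<omega>. \<omega> \<in> space N \<Longrightarrow> X \<omega> \<ge> 0"
    and lim: "\<And>l. l > 0 \<Longrightarrow> ((\<lambda>t. LINT \<omega>|M. exp (- l * R t \<omega>)) \<longlongrightarrow> (LINT \<omega>|N. exp (- l * X \<omega>))) at_top"
  shows "conv_in_distr M R N X"
proof -
  interpret M: prob_space M by (rule M)
  interpret N: prob_space N by (rule N)
  define Q where "Q t = R (max 0 t)" for t
  have Q: "Q t \<in> measurable M half_line" for t unfolding Q_def by (rule R) simp
  note Qb = measurable_half_line_borel[OF Q] and Q0 = measurable_half_line_nonneg[OF Q]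
  have mom: "((\<lambda>t. LINT \<omega>|M. 1 * exp (- Q t \<omega>) ^ n) \<longlongrightarrow> (LINT \<omega>|N. 1 * exp (- X \<omega>) ^ n)) at_top" for n
  proof (cases "n = 0")
    case True
    then show ?thesis by (simp add: M.prob_space N.prob_space)
  next
    case False
    then have "((\<lambda>t. LINT \<omega>|M. exp (- real n * R t \<omega>)) \<longlongrightarrow> (LINT \<omega>|N. exp (- real n * X \<omega>))) at_top"
      by (intro lim) simp
    then have "((\<lambda>t. LINT \<omega>|M. exp (- real n * Q t \<omega>)) \<longlongrightarrow> (LINT \<omega>|N. exp (- real n * X \<omega>))) at_top"
      by (rule Lim_transform_eventually) (auto simp: Q_def intro!: eventually_mono[OF eventually_ge_at_top[of 0]])
    then show ?thesis by (simp add: exp_of_nat_mult[symmetric])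
  qed
  have step: "((\<lambda>t. LINT \<omega>|M. cts_step a b (Q t \<omega>)) \<longlongrightarrow> (LINT \<omega>|N. cts_step a b (X \<omega>))) at_top" if "a < b" for a b
  proof -
    let ?h = "\<lambda>u. cts_step a b (- ln (max u (exp (- b))))"
    have "((\<lambda>t. LINT \<omega>|M. 1 * ?h (exp (- Q t \<omega>))) \<longlongrightarrow> (LINT \<omega>|N. 1 * ?h (exp (- X \<omega>)))) at_top"
      by (rule tendsto_weighted_moments[OF _ _ _ _ _ _ _ _ mom continuous_on_cts_step_ln[OF that]])
        (use Qb Q0 X in auto)
    then show ?thesis by (simp add: cts_step_ln_exp[OF that])
  qed
  have "conv_in_distr M Q N X"
  proof (rule conv_in_distr_weak_convI[OF N X(1)])
    fix t :: "nat \<Rightarrow> real" assume t: "filterlim t at_top sequentially"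
    show "weak_conv_m (\<lambda>n. distr M borel (Q (t n))) (distr N borel X)"
    proof (rule integral_cts_step_conv_imp_weak_conv)
      show "real_distribution (distr M borel (Q (t n)))" for n
        by (rule prob_space.real_distribution_distr[OF M Qb])
      show "real_distribution (distr N borel X)" by (rule prob_space.real_distribution_distr[OF N X(1)])
      fix a b :: real assume "a < b"
      from filterlim_compose[OF step[OF this] t]
      show "(\<lambda>n. integral\<^sup>L (distr M borel (Q (t n))) (cts_step a b)) \<longlonglongrightarrow> integral\<^sup>L (distr N borel X) (cts_step a b)"
        using Qb X(1) \<open>a < b\<close>
        by (simp add: integral_distr borel_measurable_continuous_onI uniformly_continuous_imp_continuous cts_step_uniformly_continuous)
    qed
  qed
  then show ?thesis unfolding Q_def by (rule conv_in_distr_shift[THEN iffD1])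
qed

text \<open>Convergence of distribution functions leaves \<open>X\<close> free on null sets, so
  nonnegativity comes from testing with a bounded continuous function that vanishes on the
  half-line. The exponential is unbounded on the reals and becomes a test function by clipping its
  argument at 0.\<close>

lemma conv_in_distr_imp_laplace:
  fixes R :: "real \<Rightarrow> 'a \<Rightarrow> real" and X :: "'b \<Rightarrow> real"
  assumes M: "prob_space M" and R: "\<And>t. t \<ge> 0 \<Longrightarrow> R t \<in> measurable M half_line"
    and conv: "conv_in_distr M R N X"
  shows "AE \<omega> in N. X \<omega> \<ge> 0"
    and "l > 0 \<Longrightarrow> ((\<lambda>t. LINT \<omega>|M. exp (- l * R t \<omega>)) \<longlongrightarrow> (LINT \<omega>|N. exp (- l * X \<omega>))) at_top"
proof -
  interpret M: prob_space M by (rule M)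
  have N: "prob_space N" and X [measurable]: "X \<in> borel_measurable N"
    using conv by (auto simp: conv_in_distr_def)
  interpret N: prob_space N by (rule N)
  define Q where "Q t = R (max 0 t)" for t
  have Q: "Q t \<in> measurable M half_line" for t unfolding Q_def by (rule R) simp
  note Qb = measurable_half_line_borel[OF Q] and Q0 = measurable_half_line_nonneg[OF Q]
  have convQ: "conv_in_distr M Q N X"
    unfolding Q_def using conv by (rule conv_in_distr_shift[THEN iffD2])
  have lim: "((\<lambda>t. LINT \<omega>|M. f (Q t \<omega>)) \<longlongrightarrow> (LINT \<omega>|N. f (X \<omega>))) at_top"
    if f: "\<And>x. isCont f x" "\<And>x. norm (f x) \<le> B" for f :: "real \<Rightarrow> real" and B
  proof (rule tendsto_at_topI_sequentially)
    fix t :: "nat \<Rightarrow> real" assume t: "filterlim t at_top sequentially"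
    have fb: "f \<in> borel_measurable borel"
      using f(1) by (intro borel_measurable_continuous_onI continuous_at_imp_continuous_on) auto
    have "(\<lambda>n. integral\<^sup>L (distr M borel (Q (t n))) f) \<longlonglongrightarrow> integral\<^sup>L (distr N borel X) f"
      using conv_in_distr_imp_weak_conv[OF convQ t] f
      by (intro weak_conv_imp_integral_bdd_continuous_conv M.real_distribution_distr N.real_distribution_distr X Qb)
    then show "(\<lambda>n. LINT \<omega>|M. f (Q (t n) \<omega>)) \<longlonglongrightarrow> (LINT \<omega>|N. f (X \<omega>))"
      using Qb X fb by (simp add: integral_distr)
  qed
  have "((\<lambda>t. LINT \<omega>|M. min 1 (max 0 (- Q t \<omega>))) \<longlongrightarrow> (LINT \<omega>|N. min 1 (max 0 (- X \<omega>)))) at_top"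
    by (rule lim[of _ 1]) (auto intro!: continuous_intros)
  moreover have "(LINT \<omega>|M. min 1 (max 0 (- Q t \<omega>))) = 0" for t
    using Q0 by (intro integral_eq_zero_AE AE_I2) auto
  ultimately have "(LINT \<omega>|N. min 1 (max 0 (- X \<omega>))) = 0"
    by (simp add: LIMSEQ_const_iff tendsto_const_iff)
  moreover have "integrable N (\<lambda>\<omega>. min 1 (max 0 (- X \<omega>)))"
    by (intro N.integrable_const_bound[where B = 1]) auto
  ultimately have "AE \<omega> in N. min 1 (max 0 (- X \<omega>)) = 0"
    by (subst (asm) integral_nonneg_eq_0_iff_AE) auto
  then show pos: "AE \<omega> in N. X \<omega> \<ge> 0"
    by eventually_elim (auto simp: min_def max_def split: if_splits)
  assume l: "l > 0"
  have "((\<lambda>t. LINT \<omega>|M. exp (- l * max 0 (Q t \<omega>))) \<longlongrightarrow> (LINT \<omega>|N. exp (- l * max 0 (X \<omega>)))) at_top"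
    using l by (intro lim[of _ 1]) (auto intro!: continuous_intros)
  moreover have "(LINT \<omega>|N. exp (- l * max 0 (X \<omega>))) = (LINT \<omega>|N. exp (- l * X \<omega>))"
    by (rule integral_cong_AE) (use pos in \<open>auto simp: max_def\<close>)
  moreover have "eventually (\<lambda>t. (LINT \<omega>|M. exp (- l * max 0 (Q t \<omega>))) = (LINT \<omega>|M. exp (- l * R t \<omega>))) at_top"
    using eventually_ge_at_top[of 0]
  proof eventually_elim
    case (elim t)
    then show ?case
      using Q0[of _ t] by (intro Bochner_Integration.integral_cong) (auto simp: Q_def max_def)
  qed
  ultimately show "((\<lambda>t. LINT \<omega>|M. exp (- l * R t \<omega>)) \<longlongrightarrow> (LINT \<omega>|N. exp (- l * X \<omega>))) at_top"
    by (auto intro: Lim_transform_eventually)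
qed

text \<open>The laws of \<open>exp (- R t)\<close> live on \<open>[0, 1]\<close>, hence are tight; \<open>\<phi> \<longlongrightarrow> 1\<close> at \<open>0\<close> excludes an atom at \<open>0\<close>
  of a limit point, that is, an escape of \<open>R t\<close> to infinity.\<close>

lemma laplace_limit_realised:
  fixes R :: "real \<Rightarrow> 'a \<Rightarrow> real"
  assumes M: "prob_space M" and R: "\<And>t. t \<ge> 0 \<Longrightarrow> R t \<in> measurable M half_line"
    and lim: "\<And>l. l > 0 \<Longrightarrow> ((\<lambda>t. LINT \<omega>|M. exp (- l * R t \<omega>)) \<longlongrightarrow> \<phi> l) at_top"
    and phi: "(\<phi> \<longlongrightarrow> 1) (at_right 0)"
  obtains N :: "real measure" and X :: "real \<Rightarrow> real"
  where "prob_space N" "X \<in> borel_measurable N" "\<And>\<omega>. X \<omega> \<ge> 0" "\<And>l. l > 0 \<Longrightarrow> (LINT \<omega>|N. exp (- l * X \<omega>)) = \<phi> l"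
proof -
  interpret M: prob_space M by (rule M)
  have Rb: "R (real n) \<in> borel_measurable M" and R0: "\<And>\<omega>. \<omega> \<in> space M \<Longrightarrow> R (real n) \<omega> \<ge> 0" for n
    using measurable_half_line_borel[OF R] measurable_half_line_nonneg[OF R] by auto
  define \<mu> where "\<mu> n = distr M borel (\<lambda>\<omega>. exp (- R (real n) \<omega>))" for n
  have \<mu>: "real_distribution (\<mu> n)" for n
    unfolding \<mu>_def using Rb by (intro prob_space.real_distribution_distr[OF M]) simp
  have "tight \<mu>"
    unfolding tight_def
  proof (intro conjI allI impI \<mu>)
    fix e :: real assume e: "e > 0"
    have "measure (\<mu> n) {-1<..1} = 1" for n
    proof -
      have "(\<lambda>\<omega>. exp (- R (real n) \<omega>)) -` {-1<..1} \<inter> space M = space M"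
        using R0 less_trans[OF _ exp_gt_zero, of "-1"] by auto
      then show ?thesis
        unfolding \<mu>_def using Rb by (subst measure_distr) (auto simp: M.prob_space)
    qed
    then show "\<exists>a b. a < b \<and> (\<forall>n. 1 - e < measure (\<mu> n) {a<..b})"
      using e by (intro exI[of _ "-1"] exI[of _ 1]) auto
  qed
  from tight_imp_convergent_subsubsequence[OF this strict_mono_id]
  obtain r \<nu> where r: "strict_mono r" and \<nu>: "real_distribution \<nu>" and wc: "weak_conv_m (\<mu> \<circ> id \<circ> r) \<nu>" by blast
  interpret \<nu>: real_distribution \<nu> by (rule \<nu>)
  have wlim: "(\<lambda>n. LINT \<omega>|M. f (exp (- R (real (r n)) \<omega>))) \<longlonglongrightarrow> (LINT y|\<nu>. f y)"
    if f: "\<And>x. isCont f x" "\<And>x. norm (f x) \<le> B" for f :: "real \<Rightarrow> real" and B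
  proof -
    have fb: "f \<in> borel_measurable borel"
      using f(1) by (intro borel_measurable_continuous_onI continuous_at_imp_continuous_on) auto
    have "(\<lambda>n. integral\<^sup>L ((\<mu> \<circ> id \<circ> r) n) f) \<longlonglongrightarrow> integral\<^sup>L \<nu> f"
      using wc f by (intro weak_conv_imp_integral_bdd_continuous_conv) (auto simp: \<mu> \<nu> o_def)
    then show ?thesis
      using Rb fb by (simp add: \<mu>_def integral_distr)
  qed
  \<comment> \<open>The limit law lives a priori on all reals. Clipping makes
    \<open>y powr l\<close> bounded and continuous and does not affect the values
    \<open>exp (- R t)\<close>.\<close>
  define clip where "clip y = max 0 (min 1 y)" for y :: real
  have clip: "0 \<le> clip y" "clip y \<le> 1" "isCont clip y" "clip \<in> borel_measurable borel" for y
    unfolding clip_def[abs_def] by (auto intro!: continuous_intros)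
  have clip_exp: "clip (exp (- R (real n) \<omega>)) = exp (- R (real n) \<omega>)" if "\<omega> \<in> space M" for n \<omega>
    using R0[OF that] by (simp add: clip_def)
  have real_lim: "filterlim (\<lambda>n. real (r n)) at_top sequentially"
    using filterlim_compose[OF filterlim_real_sequentially filterlim_subseq[OF r]] .
  have int: "(LINT y|\<nu>. clip y powr l) = \<phi> l" if l: "l > 0" for l
  proof -
    have "isCont (\<lambda>y. clip y powr l) y" for y
      using clip(1,3) l unfolding isCont_def by (intro tendsto_powr' tendsto_const) auto
    moreover have "norm (clip y powr l) \<le> 1" for y
      using clip(1,2)[of y] l by (simp add: powr_le1)
    ultimately have "(\<lambda>n. LINT \<omega>|M. clip (exp (- R (real (r n)) \<omega>)) powr l) \<longlonglongrightarrow> (LINT y|\<nu>. clip y powr l)"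
      by (rule wlim)
    moreover have "(LINT \<omega>|M. clip (exp (- R (real n) \<omega>)) powr l) = (LINT \<omega>|M. exp (- l * R (real n) \<omega>))" for n
      using clip_exp by (intro Bochner_Integration.integral_cong) (auto simp: exp_powr_real mult.commute)
    ultimately have "(\<lambda>n. LINT \<omega>|M. exp (- l * R (real (r n)) \<omega>)) \<longlonglongrightarrow> (LINT y|\<nu>. clip y powr l)"
      by simp
    moreover have "(\<lambda>n. LINT \<omega>|M. exp (- l * R (real (r n)) \<omega>)) \<longlonglongrightarrow> \<phi> l"
      by (rule filterlim_compose[OF lim[OF l] real_lim])
    ultimately show ?thesis by (rule LIMSEQ_unique)
  qed
  have le1: "AE y in \<nu>. y \<le> 1"
  proof -
    have "(\<lambda>n. LINT \<omega>|M. min 1 (max 0 (exp (- R (real (r n)) \<omega>) - 1))) \<longlonglongrightarrow> (LINT y|\<nu>. min 1 (max 0 (y - 1)))"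
      by (rule wlim[of _ 1]) (auto intro!: continuous_intros)
    moreover have "(LINT \<omega>|M. min 1 (max 0 (exp (- R (real n) \<omega>) - 1))) = 0" for n
      using R0 by (intro integral_eq_zero_AE AE_I2) auto
    ultimately have "(LINT y|\<nu>. min 1 (max 0 (y - 1))) = 0"
      by (simp add: LIMSEQ_const_iff)
    moreover have "integrable \<nu> (\<lambda>y. min 1 (max 0 (y - 1)))"
      by (intro \<nu>.integrable_const_bound[where B = 1]) auto
    ultimately have "AE y in \<nu>. min 1 (max 0 (y - 1)) = 0"
      by (subst (asm) integral_nonneg_eq_0_iff_AE) auto
    then show ?thesis by eventually_elim (auto simp: min_def max_def split: if_splits)
  qed
  have pos: "AE y in \<nu>. y > 0"
  proof -
    \<comment> \<open>As \<open>0 powr l = 0\<close>, the integrand is at most the indicator of the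
      positive reals; letting \<open>l\<close> tend to 0 gives this set full mass.\<close>
    have "\<phi> l \<le> measure \<nu> {0<..}" if l: "l > 0" for l
    proof -
      have "(LINT y|\<nu>. clip y powr l) \<le> (LINT y|\<nu>. indicator {0<..} y)"
      proof (rule integral_mono)
        show "integrable \<nu> (\<lambda>y. clip y powr l)"
          using clip l by (intro \<nu>.integrable_const_bound[where B = 1]) (auto simp: powr_le1)
        show "integrable \<nu> (\<lambda>y. indicator {0<..} y :: real)"
          by (intro \<nu>.integrable_const_bound[where B = 1]) auto
        show "clip y powr l \<le> indicator {0<..} y" for y
          using clip(1,2)[of y] l by (auto simp: powr_le1 indicator_def clip_def)
      qed
      then show ?thesis using int[OF l] by simp
    qed
    then have "1 \<le> measure \<nu> {0<..}"
      by (intro tendsto_upperbound[OF phi]) (auto intro!: eventually_mono[OF eventually_at_right_less])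
    then have "measure \<nu> {0<..} = 1" using \<nu>.prob_le_1[of "{0<..}"] by linarith
    then show ?thesis using \<nu>.prob_eq_1[of "{0<..}"] by simp
  qed
  \<comment> \<open>The values off (0,1] matter only on a null set and are chosen so that
    \<open>X\<close> is nonnegative everywhere.\<close>
  define X where "X y = (if 0 < y then max 0 (- ln y) else 0)" for y :: real
  show thesis
  proof (rule that[of \<nu> X])
    show "prob_space \<nu>" by (rule \<nu>.prob_space_axioms)
    show "X \<in> borel_measurable \<nu>" unfolding X_def[abs_def] by simp
    show "X y \<ge> 0" for y by (simp add: X_def)
    show "(LINT y|\<nu>. exp (- l * X y)) = \<phi> l" if l: "l > 0" for l
      unfolding int[OF l, symmetric]
    proof (rule integral_cong_AE)
      show "AE y in \<nu>. exp (- l * X y) = clip y powr l"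
        using le1 pos by eventually_elim (auto simp: X_def clip_def powr_def max_def)
    qed (use clip in \<open>auto simp: X_def[abs_def]\<close>)
  qed
qed

section \<open>Laplace transforms near the origin\<close>

text \<open>The transform of a finite random variable tends to 1 as \<open>l\<close> tends to 0, by
  dominated convergence. A common bound below 1, inherited from the transforms of
  \<open>R t\<close>, thus refutes convergence in distribution.\<close>

lemma laplace_bound_ge_1:
  fixes X :: "'b \<Rightarrow> real"
  assumes N: "prob_space N" and X [measurable]: "X \<in> borel_measurable N" and pos: "AE \<omega> in N. X \<omega> \<ge> 0"
    and le: "\<And>l. l > 0 \<Longrightarrow> (LINT \<omega>|N. exp (- l * X \<omega>)) \<le> \<theta>"
  shows "1 \<le> \<theta>"
proof -
  interpret N: prob_space N by (rule N)
  have "(\<lambda>n. LINT \<omega>|N. exp (- (1 / real (Suc n)) * X \<omega>)) \<longlonglongrightarrow> (LINT \<omega>|N. 1)"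
  proof (rule integral_dominated_convergence[where w = "\<lambda>_. 1"])
    show "AE \<omega> in N. (\<lambda>n. exp (- (1 / real (Suc n)) * X \<omega>)) \<longlonglongrightarrow> 1"
    proof (rule AE_I2)
      fix \<omega>
      have "(\<lambda>n. exp (- (1 / real (Suc n)) * X \<omega>)) \<longlonglongrightarrow> exp (- 0 * X \<omega>)"
        by (intro tendsto_intros LIMSEQ_Suc lim_1_over_n)
      then show "(\<lambda>n. exp (- (1 / real (Suc n)) * X \<omega>)) \<longlonglongrightarrow> 1" by simp
    qed
    show "AE \<omega> in N. norm (exp (- (1 / real (Suc n)) * X \<omega>)) \<le> 1" for n
      using pos by eventually_elim simp
  qed auto
  then have "(\<lambda>n. LINT \<omega>|N. exp (- (1 / real (Suc n)) * X \<omega>)) \<longlonglongrightarrow> 1"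
    by (simp add: N.prob_space)
  then show ?thesis
  proof (rule LIMSEQ_le_const2, intro exI allI impI)
    show "(LINT \<omega>|N. exp (- (1 / real (Suc n)) * X \<omega>)) \<le> \<theta>" for n
      by (rule le) simp
  qed
qed

lemma laplace_one_imp_zero:
  fixes X :: "'b \<Rightarrow> real"
  assumes N: "prob_space N" and X [measurable]: "X \<in> borel_measurable N" and pos: "AE \<omega> in N. X \<omega> \<ge> 0"
    and one: "(LINT \<omega>|N. exp (- X \<omega>)) = 1"
  shows "measure N {\<omega> \<in> space N. X \<omega> = 0} = 1"
proof -
  interpret N: prob_space N by (rule N)
  have i: "integrable N (\<lambda>\<omega>. exp (- X \<omega>))"
    using pos by (intro N.integrable_const_bound[where B = 1]) auto
  then have "(LINT \<omega>|N. 1 - exp (- X \<omega>)) = 0"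
    by (simp add: one N.prob_space)
  moreover have "AE \<omega> in N. 0 \<le> 1 - exp (- X \<omega>)"
    using pos by eventually_elim simp
  ultimately have "AE \<omega> in N. 1 - exp (- X \<omega>) = 0"
    using i by (subst (asm) integral_nonneg_eq_0_iff_AE) auto
  then have "AE \<omega> in N. X \<omega> = 0" by eventually_elim simp
  then show ?thesis by (subst N.prob_Collect_eq_1) auto
qed

text \<open>Halving \<open>l\<close> increases \<open>(1 - exp (- l * x)) / l\<close>, so along
  powers of 1/2 the monotone convergence theorem yields integrability together with the
  mean.\<close>

lemma laplace_derivative_imp_mean:
  fixes X :: "'b \<Rightarrow> real"
  assumes N: "prob_space N" and X [measurable]: "X \<in> borel_measurable N" and pos: "AE \<omega> in N. X \<omega> \<ge> 0"
    and lim: "((\<lambda>l. (1 - (LINT \<omega>|N. exp (- l * X \<omega>))) / l) \<longlongrightarrow> m) (at_right 0)"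
  shows "integrable N X" "(LINT \<omega>|N. X \<omega>) = m"
proof -
  interpret N: prob_space N by (rule N)
  define l :: "nat \<Rightarrow> real" where "l n = (1 / 2) ^ n" for n
  have l0: "l n > 0" for n by (simp add: l_def)
  have l_lim: "l \<longlonglongrightarrow> 0"
    unfolding l_def[abs_def] by (rule LIMSEQ_power_zero) simp
  have l_at: "filterlim l (at_right 0) sequentially"
  proof -
    have "l n \<noteq> 0" for n using l0[of n] by simp
    then show ?thesis using l_lim l0 by (simp add: filterlim_at)
  qed
  define f where "f n \<omega> = (1 - exp (- l n * X \<omega>)) / l n" for n \<omega>
  have iexp: "integrable N (\<lambda>\<omega>. exp (- l n * X \<omega>))" for n
    using pos l0[of n] by (intro N.integrable_const_bound[where B = 1]) (auto elim!: eventually_mono)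
  have "f n \<omega> \<le> f (Suc n) \<omega>" for n \<omega>
  proof -
    define y where "y = exp (- l (Suc n) * X \<omega>)"
    have "exp (- l n * X \<omega>) = y * y"
      by (simp add: y_def mult_exp_exp l_def)
    moreover have "l n = 2 * l (Suc n)" by (simp add: l_def)
    \<comment> \<open>Monotonicity under halving reduces to the nonnegativity of
      \<open>(1 - y)\<^sup>2\<close>.\<close>
    moreover have "(1 - y * y) / 2 \<le> 1 - y"
    proof -
      have "0 \<le> (1 - y) * (1 - y)" by simp
      then show ?thesis by (simp add: field_simps)
    qed
    ultimately show ?thesis
      using l0[of "Suc n"] divide_right_mono[of "(1 - y * y) / 2" "1 - y" "l (Suc n)"]
      by (simp add: f_def y_def)
  qed
  then have mono: "mono (\<lambda>n. f n \<omega>)" for \<omega> by (simp add: mono_iff_le_Suc)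
  have flim: "(\<lambda>n. f n \<omega>) \<longlonglongrightarrow> X \<omega>" for \<omega>
  proof -
    have "((\<lambda>s. - exp (- s * X \<omega>)) has_real_derivative X \<omega>) (at 0)"
      by (auto intro!: derivative_eq_intros)
    then have "((\<lambda>h. (- exp (- h * X \<omega>) - - exp (- 0 * X \<omega>)) / h) \<longlongrightarrow> X \<omega>) (at 0)"
      by (simp add: DERIV_def)
    then have "((\<lambda>h. (- exp (- h * X \<omega>) - - exp (- 0 * X \<omega>)) / h) \<longlongrightarrow> X \<omega>) (at_right 0)"
      by (rule tendsto_within_subset) simp
    from filterlim_compose[OF this l_at] show ?thesis by (simp add: f_def)
  qed
  have ilim: "(\<lambda>n. LINT \<omega>|N. f n \<omega>) \<longlonglongrightarrow> m"
    using filterlim_compose[OF lim l_at] iexp by (simp add: f_def N.prob_space)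
  have fi: "integrable N (f n)" for n
    using iexp by (simp add: f_def[abs_def])
  have fpos: "AE \<omega> in N. 0 \<le> f n \<omega>" for n
    using pos by eventually_elim (use l0[of n] in \<open>simp add: f_def\<close>)
  show "integrable N X" "(LINT \<omega>|N. X \<omega>) = m"
    using integral_monotone_convergence_nonneg[OF fi AE_I2[OF mono] fpos AE_I2[OF flim] ilim X] by auto
qed

text \<open>Karamata's argument, applied to the finite measures \<open>W r dN\<close> rather than to the tail function:
  multiplying the law by \<open>1 - exp (- X / r)\<close> removes the singularity of \<open>x powr (- 1 - \<beta>)\<close> at the
  origin, and convergence against \<open>1 - cts_step u v\<close> for \<open>v \<down> 1\<close> and \<open>u \<up> 1\<close> then gives the tail itself,
  so that no monotone density theorem is needed.\<close>

lemma laplace_tauberian: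
  fixes X :: "'b \<Rightarrow> real"
  assumes N: "prob_space N" and X [measurable]: "X \<in> borel_measurable N" and X0: "\<And>\<omega>. \<omega> \<in> space N \<Longrightarrow> X \<omega> \<ge> 0"
    and b: "0 < \<beta>" "\<beta> < 1" and C: "C > 0"
    and lim: "((\<lambda>l. (1 - (LINT \<omega>|N. exp (- l * X \<omega>))) / l powr \<beta>) \<longlongrightarrow> C) (at_right 0)"
  shows "((\<lambda>r. r powr \<beta> * measure N {\<omega> \<in> space N. X \<omega> > r}) \<longlongrightarrow> C / Gamma (1 - \<beta>)) at_top"
proof -
  interpret N: prob_space N by (rule N)
  define L where "L l = (LINT \<omega>|N. exp (- l * X \<omega>))" for l
  \<comment> \<open>The lemma on weighted moments asks for admissible weights at every index, hence
    the truncation; the limit sees only \<open>r \<ge> 1\<close>.\<close>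
  define m where "m r = max r 1" for r :: real
  have m: "m r \<ge> 1" "m r > 0" for r by (auto simp: m_def)
  \<comment> \<open>Chosen so that \<open>c * x powr (- 1 - \<beta>)\<close> is the density of the
    limiting tail \<open>C / Gamma (1 - \<beta>) * x powr (- \<beta>)\<close>.\<close>
  define c where "c = C * \<beta> / Gamma (1 - \<beta>)"
  have G: "Gamma (1 - \<beta>) > 0" using b by (intro Gamma_real_pos) auto
  have c: "c > 0" using C b G by (simp add: c_def)
  have iexp: "integrable N (\<lambda>\<omega>. exp (- l * X \<omega>))" if "l \<ge> 0" for l
    using X0 that by (intro N.integrable_const_bound[where B = 1] AE_I2) auto
  define W Y where "W r \<omega> = m r powr \<beta> * (1 - exp (- (1 / m r) * X \<omega>))" and "Y r \<omega> = exp (- (1 / m r) * X \<omega>)" for r \<omega>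
  define V Z where "V x = c * (indicator {0<..} x * ((1 - exp (- x)) * x powr (- 1 - \<beta>)))"
    and "Z x = exp (- max 0 x)" for x :: real
  have W: "integrable N (W r)" for r
    unfolding W_def[abs_def] using iexp[of "1 / m r"] m(2)[of r] by simp
  have V: "integrable lborel V"
    unfolding V_def[abs_def] using has_bochner_integral_one_minus_exp[of 1 \<beta>] b
    by (simp add: has_bochner_integral_iff)
  \<comment> \<open>The hypothesis at \<open>l = k / r\<close>, multiplied by
    \<open>k powr \<beta>\<close>.\<close>
  have Lk: "((\<lambda>r. m r powr \<beta> * (1 - L (real k / m r))) \<longlongrightarrow> C * real k powr \<beta>) at_top" for k
  proof (cases "k = 0")
    case True
    then show ?thesis by (simp add: L_def N.prob_space)
  next
    case False
    then have k: "real k > 0" by simp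
    have "filterlim (\<lambda>r::real. real k / r) (at_right 0) at_top"
      unfolding filterlim_at
    proof
      show "((\<lambda>r::real. real k / r) \<longlongrightarrow> 0) at_top"
        by (rule tendsto_divide_0[OF tendsto_const filterlim_mono[OF filterlim_ident at_top_le_at_infinity order_refl]])
      show "eventually (\<lambda>r. real k / r \<in> {0<..} \<and> real k / r \<noteq> 0) at_top"
        using eventually_gt_at_top[of "0::real"] by eventually_elim (use k in auto)
    qed
    from tendsto_mult[OF filterlim_compose[OF lim this] tendsto_const[of "real k powr \<beta>"]]
    have "((\<lambda>r. (1 - L (real k / r)) / (real k / r) powr \<beta> * real k powr \<beta>) \<longlongrightarrow> C * real k powr \<beta>) at_top"
      by (simp add: L_def)
    then show ?thesis
    proof (rule Lim_transform_eventually)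
      show "eventually (\<lambda>r. (1 - L (real k / r)) / (real k / r) powr \<beta> * real k powr \<beta> = m r powr \<beta> * (1 - L (real k / m r))) at_top"
        using eventually_ge_at_top[of "1::real"]
        by eventually_elim (use k in \<open>simp add: m_def max_def powr_divide\<close>)
    qed
  qed
  \<comment> \<open>Since \<open>(1 - y) * y ^ n = y ^ n - y ^ Suc n\<close>, the moments on both
    sides are differences of quantities at consecutive integers.\<close>
  have mom: "((\<lambda>r. LINT \<omega>|N. W r \<omega> * Y r \<omega> ^ n) \<longlongrightarrow> (LINT x|lborel. V x * Z x ^ n)) at_top" for n
  proof -
    have Yn: "Y r \<omega> ^ k = exp (- (real k / m r) * X \<omega>)" for r \<omega> k
      by (simp add: Y_def exp_of_nat_mult[symmetric])
    have "(LINT \<omega>|N. W r \<omega> * Y r \<omega> ^ n) = m r powr \<beta> * (1 - L (real (Suc n) / m r)) - m r powr \<beta> * (1 - L (real n / m r))" for r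
    proof -
      have "W r \<omega> * Y r \<omega> ^ n = m r powr \<beta> * (Y r \<omega> ^ n - Y r \<omega> ^ Suc n)" for \<omega>
        by (simp add: W_def Y_def algebra_simps)
      then have "(LINT \<omega>|N. W r \<omega> * Y r \<omega> ^ n) = m r powr \<beta> * (LINT \<omega>|N. Y r \<omega> ^ n - Y r \<omega> ^ Suc n)"
        by simp
      also have "(LINT \<omega>|N. Y r \<omega> ^ n - Y r \<omega> ^ Suc n) = L (real n / m r) - L (real (Suc n) / m r)"
        unfolding Yn L_def using m(2)[of r] by (intro Bochner_Integration.integral_diff iexp) auto
      finally show ?thesis by (simp add: right_diff_distrib)
    qed
    moreover have "(LINT x|lborel. V x * Z x ^ n) = C * real (Suc n) powr \<beta> - C * real n powr \<beta>"
    proof -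
      have "V x * Z x ^ n = c * (indicator {0<..} x * ((1 - exp (- real (Suc n) * x)) * x powr (- 1 - \<beta>))
          - indicator {0<..} x * ((1 - exp (- real n * x)) * x powr (- 1 - \<beta>)))" for x
      proof (cases "x > 0")
        case True
        have "(1 - exp (- x)) * exp (- real n * x) = (1 - exp (- real (Suc n) * x)) - (1 - exp (- real n * x))"
          by (simp add: left_diff_distrib mult_exp_exp distrib_right)
        moreover have "Z x ^ n = exp (- real n * x)"
          using True by (simp add: Z_def exp_of_nat_mult[symmetric])
        ultimately show ?thesis
          using True by (simp add: V_def left_diff_distrib[symmetric] del: of_nat_Suc)
      qed (simp add: V_def)
      then have "(LINT x|lborel. V x * Z x ^ n) =
          c * (Gamma (1 - \<beta>) / \<beta> * real (Suc n) powr \<beta> - Gamma (1 - \<beta>) / \<beta> * real n powr \<beta>)"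
        using has_bochner_integral_one_minus_exp[of "real (Suc n)" \<beta>] has_bochner_integral_one_minus_exp[of "real n" \<beta>] b
        by (simp add: has_bochner_integral_iff del: of_nat_Suc)
      then show ?thesis using b G by (simp add: c_def right_diff_distrib)
    qed
    ultimately show ?thesis
      using tendsto_diff[OF Lk[of "Suc n"] Lk[of n]] by simp
  qed
  define I where "I u v = (LINT x|lborel. c * (indicator {0<..} x * x powr (- 1 - \<beta>) * (1 - cts_step u v x)))" for u v
  have step_lim: "((\<lambda>r. m r powr \<beta> * (LINT \<omega>|N. 1 - cts_step u v (X \<omega> / m r))) \<longlongrightarrow> I u v) at_top
      \<and> integrable lborel (\<lambda>x. c * (indicator {0<..} x * x powr (- 1 - \<beta>) * (1 - cts_step u v x)))"
    if uv: "0 < u" "u < v" for u v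
  proof -
    \<comment> \<open>Dividing by \<open>1 - y\<close> undoes the weight. Truncating the denominator
      at \<open>exp (- u)\<close> is harmless, since the numerator is 0 for larger
      \<open>y\<close>.\<close>
    define h where "h y = (1 - cts_step u v (- ln (max y (exp (- v))))) / (1 - min y (exp (- u)))" for y
    have d: "1 - min y (exp (- u)) > 0" for y :: real using uv by (simp add: min_less_iff_disj)
    have h: "continuous_on {0..1} h"
      unfolding h_def[abs_def] using d uv
      by (intro continuous_on_divide continuous_on_diff continuous_on_const continuous_on_cts_step_ln
          continuous_on_min continuous_on_id) (auto simp: less_le)
    have key: "(1 - exp (- x)) * h (exp (- x)) = 1 - cts_step u v x" if "x \<ge> 0" for x
    proof (cases "x \<ge> u")
      case True
      then have "exp (- x) \<le> exp (- u)" "exp (- x) < 1" using uv by auto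
      then show ?thesis using uv by (simp add: h_def cts_step_ln_exp min_absorb1)
    next
      case False
      then have "cts_step u v x = 1" by (simp add: cts_step_def)
      then show ?thesis using uv by (simp add: h_def cts_step_ln_exp)
    qed
    have Y01: "Y r \<omega> \<in> {0..1}" "W r \<omega> \<ge> 0" if "\<omega> \<in> space N" for r \<omega>
      using X0[OF that] m(2)[of r] by (auto simp: Y_def W_def)
    have Vh: "V x * h (Z x) = c * (indicator {0<..} x * x powr (- 1 - \<beta>) * (1 - cts_step u v x))" for x
      using key[of x] by (cases "x > 0") (simp_all add: V_def Z_def mult_ac)
    have "((\<lambda>r. LINT \<omega>|N. W r \<omega> * h (Y r \<omega>)) \<longlongrightarrow> (LINT x|lborel. V x * h (Z x))) at_top"
    proof (rule tendsto_weighted_moments[OF W Y01(2) _ Y01(1) V _ _ _ mom h])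
      show "Y r \<in> borel_measurable N" for r unfolding Y_def[abs_def] by simp
      show "Z \<in> borel_measurable lborel" unfolding Z_def[abs_def] by simp
      show "V x \<ge> 0" for x using c by (auto simp: V_def indicator_def)
      show "Z x \<in> {0..1}" for x by (simp add: Z_def)
    qed auto
    moreover have "(LINT \<omega>|N. W r \<omega> * h (Y r \<omega>)) = m r powr \<beta> * (LINT \<omega>|N. 1 - cts_step u v (X \<omega> / m r))" for r
    proof -
      have "W r \<omega> * h (Y r \<omega>) = m r powr \<beta> * (1 - cts_step u v (X \<omega> / m r))" if "\<omega> \<in> space N" for \<omega>
        using key[of "X \<omega> / m r"] X0[OF that] m(2)[of r] by (simp add: W_def Y_def mult.assoc)
      then have "(LINT \<omega>|N. W r \<omega> * h (Y r \<omega>)) = (LINT \<omega>|N. m r powr \<beta> * (1 - cts_step u v (X \<omega> / m r)))"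
        by (intro Bochner_Integration.integral_cong) auto
      then show ?thesis by simp
    qed
    moreover have "integrable lborel (\<lambda>x. V x * h (Z x))"
      by (rule weighted_continuous_integrable[OF V _ _ h]) (auto simp: Z_def[abs_def])
    ultimately show ?thesis unfolding I_def Vh by simp
  qed
  have icts: "integrable N (\<lambda>\<omega>. 1 - cts_step u v (X \<omega> / m r))" if "u < v" for u v r
  proof (rule N.integrable_const_bound[where B = 1])
    have "cts_step u v \<in> borel_measurable borel"
      by (intro borel_measurable_continuous_onI uniformly_continuous_imp_continuous cts_step_uniformly_continuous that)
    then show "(\<lambda>\<omega>. 1 - cts_step u v (X \<omega> / m r)) \<in> borel_measurable N" by simp
  qed (use that in \<open>auto simp: cts_step_def field_simps\<close>)
  define T where "T r = measure N {\<omega> \<in> space N. X \<omega> > m r}" for r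
  have T_eq: "T r = (LINT \<omega>|N. indicator {1<..} (X \<omega> / m r))" for r
  proof -
    have "(LINT \<omega>|N. indicator {1<..} (X \<omega> / m r)) = (LINT \<omega>|N. indicator {\<omega> \<in> space N. X \<omega> > m r} \<omega> :: real)"
      using m(2)[of r] by (intro Bochner_Integration.integral_cong) (auto simp: indicator_def field_simps)
    then show ?thesis by (simp add: T_def)
  qed
  have iT: "integrable N (\<lambda>\<omega>. indicator {1<..} (X \<omega> / m r) :: real)" for r
    by (intro N.integrable_const_bound[where B = 1]) auto
  \<comment> \<open>The ramp from 1 to \<open>v\<close> lies below the indicator of
    \<open>{1<..}\<close>; the ramp from \<open>u\<close> to 1 lies above it.\<close>
  have T_lower: "m r powr \<beta> * (LINT \<omega>|N. 1 - cts_step 1 v (X \<omega> / m r)) \<le> m r powr \<beta> * T r" if "v > 1" for v r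
    unfolding T_eq using that by (intro mult_left_mono integral_mono icts iT) (auto simp: cts_step_def indicator_def field_simps)
  have T_upper: "m r powr \<beta> * T r \<le> m r powr \<beta> * (LINT \<omega>|N. 1 - cts_step u 1 (X \<omega> / m r))" if "u < 1" for u r
    unfolding T_eq using that by (intro mult_left_mono integral_mono icts iT) (auto simp: cts_step_def indicator_def field_simps)
  have I_lower: "c * (v powr (- \<beta>) / \<beta>) \<le> I 1 v" if v: "v > 1" for v
  proof -
    have *: "has_bochner_integral lborel (\<lambda>x. c * (indicator {v..} x * x powr (- 1 - \<beta>))) (c * (v powr (- \<beta>) / \<beta>))"
      by (intro has_bochner_integral_mult_right has_bochner_integral_powr_tail b) (use v in simp)
    have "(LINT x|lborel. c * (indicator {v..} x * x powr (- 1 - \<beta>))) \<le> I 1 v"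
      unfolding I_def
    proof (rule integral_mono)
      show "c * (indicator {v..} x * x powr (- 1 - \<beta>)) \<le> c * (indicator {0<..} x * x powr (- 1 - \<beta>) * (1 - cts_step 1 v x))" for x
        using c v by (intro mult_left_mono) (auto simp: cts_step_def indicator_def field_simps)
    qed (use * step_lim[of 1 v] v in \<open>auto simp: has_bochner_integral_iff\<close>)
    then show ?thesis using * by (simp add: has_bochner_integral_iff)
  qed
  have I_upper: "I u 1 \<le> c * (u powr (- \<beta>) / \<beta>)" if u: "0 < u" "u < 1" for u
  proof -
    have *: "has_bochner_integral lborel (\<lambda>x. c * (indicator {u..} x * x powr (- 1 - \<beta>))) (c * (u powr (- \<beta>) / \<beta>))"
      by (intro has_bochner_integral_mult_right has_bochner_integral_powr_tail b u)
    have "I u 1 \<le> (LINT x|lborel. c * (indicator {u..} x * x powr (- 1 - \<beta>)))"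
      unfolding I_def
    proof (rule integral_mono)
      have "0 \<le> cts_step u 1 x" for x using u by (auto simp: cts_step_def)
      then have "x powr (- 1 - \<beta>) * (1 - cts_step u 1 x) \<le> x powr (- 1 - \<beta>) * 1" for x
        by (intro mult_left_mono) auto
      then show "c * (indicator {0<..} x * x powr (- 1 - \<beta>) * (1 - cts_step u 1 x)) \<le> c * (indicator {u..} x * x powr (- 1 - \<beta>))" for x
        using c u by (intro mult_left_mono) (auto simp: indicator_def cts_step_def)
    qed (use * step_lim[of u 1] u in \<open>auto simp: has_bochner_integral_iff\<close>)
    then show ?thesis using * by (simp add: has_bochner_integral_iff)
  qed
  \<comment> \<open>Both bounds for the smoothed tails become \<open>c / \<beta>\<close> as
    \<open>v\<close> and \<open>u\<close> tend to 1.\<close>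
  have cts: "((\<lambda>u. c * (u powr (- \<beta>) / \<beta>)) \<longlongrightarrow> C / Gamma (1 - \<beta>)) (at 1 within S)" for S
  proof -
    have "((\<lambda>u. c * (u powr (- \<beta>) / \<beta>)) \<longlongrightarrow> c * (1 powr (- \<beta>) / \<beta>)) (at 1 within S)"
      using b by (intro tendsto_intros) auto
    then show ?thesis using b by (simp add: c_def)
  qed
  have "((\<lambda>r. m r powr \<beta> * T r) \<longlongrightarrow> C / Gamma (1 - \<beta>)) at_top"
  proof (rule order_tendstoI)
    fix e assume "e < C / Gamma (1 - \<beta>)"
    with cts have "eventually (\<lambda>v. e < c * (v powr (- \<beta>) / \<beta>)) (at_right 1)"
      by (rule order_tendstoD(1))
    then have "eventually (\<lambda>v. e < c * (v powr (- \<beta>) / \<beta>) \<and> v > 1) (at_right 1)"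
      using eventually_at_right_less by (rule eventually_conj)
    then obtain v where v: "e < c * (v powr (- \<beta>) / \<beta>)" "v > 1"
      using eventually_happens[of _ "at_right (1::real)"] trivial_limit_at_right_real by blast
    have "e < I 1 v" using v(1) I_lower[OF v(2)] by linarith
    with conjunct1[OF step_lim[of 1 v]] v(2)
    have "eventually (\<lambda>r. e < m r powr \<beta> * (LINT \<omega>|N. 1 - cts_step 1 v (X \<omega> / m r))) at_top"
      by (auto dest: order_tendstoD(1))
    then show "eventually (\<lambda>r. e < m r powr \<beta> * T r) at_top"
      by eventually_elim (rule less_le_trans[OF _ T_lower[OF v(2)]])
  next
    fix e assume "C / Gamma (1 - \<beta>) < e"
    with cts have "eventually (\<lambda>u. c * (u powr (- \<beta>) / \<beta>) < e) (at_left 1)"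
      by (rule order_tendstoD(2))
    moreover have "eventually (\<lambda>u::real. u \<in> {0<..<1}) (at_left 1)"
      by (rule eventually_at_left_real) simp
    ultimately have "eventually (\<lambda>u. c * (u powr (- \<beta>) / \<beta>) < e \<and> u \<in> {0<..<1}) (at_left 1)"
      by (rule eventually_conj)
    then obtain u where u: "c * (u powr (- \<beta>) / \<beta>) < e" "0 < u" "u < 1"
      using eventually_happens[of _ "at_left (1::real)"] trivial_limit_at_left_real by force
    have "I u 1 < e" using u(1) I_upper[OF u(2,3)] by linarith
    with conjunct1[OF step_lim[of u 1]] u(2,3)
    have "eventually (\<lambda>r. m r powr \<beta> * (LINT \<omega>|N. 1 - cts_step u 1 (X \<omega> / m r)) < e) at_top"
      by (auto dest: order_tendstoD(2))
    then show "eventually (\<lambda>r. m r powr \<beta> * T r < e) at_top"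
      by eventually_elim (rule le_less_trans[OF T_upper[OF u(3)]])
  qed
  then show ?thesis
    by (rule Lim_transform_eventually)
      (auto simp: m_def T_def max_def intro!: eventually_mono[OF eventually_ge_at_top[of 1]])
qed

section \<open>Limiting behaviour of the short rate\<close>

text \<open>With \<open>z = b * K l\<close> the error of linearising the exponential is of order
  \<open>z\<^sup>2\<close>; divided by \<open>l powr \<beta>\<close> it is \<open>z\<close>, which
  tends to 0, times a convergent quotient.\<close>

lemma one_minus_exp_asymptotics:
  fixes K :: "real \<Rightarrow> real"
  assumes K: "(K \<longlongrightarrow> 0) (at_right 0)" and lim: "((\<lambda>l. K l / l powr \<beta>) \<longlongrightarrow> k) (at_right 0)"
  shows "((\<lambda>l. (1 - exp (- b * K l)) / l powr \<beta>) \<longlongrightarrow> b * k) (at_right 0)"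
proof -
  define z where "z l = b * K l" for l
  have z: "(z \<longlongrightarrow> 0) (at_right 0)" "((\<lambda>l. z l / l powr \<beta>) \<longlongrightarrow> b * k) (at_right 0)"
    using tendsto_mult_right_zero[OF K, of b] tendsto_mult_left[OF lim, of b] by (simp_all add: z_def[abs_def])
  have "((\<lambda>l. \<bar>z l / l powr \<beta>\<bar> * (\<bar>z l\<bar> * exp \<bar>z l\<bar>)) \<longlongrightarrow> \<bar>b * k\<bar> * (\<bar>0\<bar> * exp \<bar>0\<bar>)) (at_right 0)"
    by (intro tendsto_intros z)
  then have bd: "((\<lambda>l. \<bar>z l / l powr \<beta>\<bar> * (\<bar>z l\<bar> * exp \<bar>z l\<bar>)) \<longlongrightarrow> 0) (at_right 0)" by simp
  have "((\<lambda>l. (1 - exp (- z l)) / l powr \<beta> - z l / l powr \<beta>) \<longlongrightarrow> 0) (at_right 0)"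
  proof (rule Lim_null_comparison[OF always_eventually bd], rule allI)
    fix l
    have "\<bar>1 - exp (- z l) - z l\<bar> \<le> (z l)\<^sup>2 * exp \<bar>z l\<bar>"
      using abs_exp_minus_linear_le[of "- z l"] by (simp add: abs_minus_commute)
    then have "\<bar>1 - exp (- z l) - z l\<bar> / l powr \<beta> \<le> (z l)\<^sup>2 * exp \<bar>z l\<bar> / l powr \<beta>"
      by (intro divide_right_mono) auto
    then show "norm ((1 - exp (- z l)) / l powr \<beta> - z l / l powr \<beta>) \<le> \<bar>z l / l powr \<beta>\<bar> * (\<bar>z l\<bar> * exp \<bar>z l\<bar>)"
      by (simp add: diff_divide_distrib[symmetric] abs_divide power2_eq_square abs_mult[symmetric] mult.assoc)
  qed
  from tendsto_add[OF this z(2)] show ?thesis by (simp add: z_def)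
qed

text \<open>Started at 0 with \<open>b = 0\<close>, the process stays at 0 and converges for every
  \<open>a\<close>; for \<open>a > 0\<close> this lies outside the three cases, hence the exclusion.
  Existence is stated over measures on the reals because a quantifier cannot range over types; a law
  on the reals is always realised there.\<close>

theorem proposition3p10:
  fixes g :: nat and a b r\<^sub>0 :: real and \<alpha> \<eta> :: "nat \<Rightarrow> real"
    and M :: "'a measure" and R :: "real \<Rightarrow> 'a \<Rightarrow> real"
    and N :: "'b measure" and X :: "'b \<Rightarrow> real"
  assumes "g \<ge> 1" and "b \<ge> 0"
    and "\<alpha> 1 \<le> 2" and "strict_antimono_on {1..g} \<alpha>" and "\<alpha> g > 1"
    and "\<forall>i\<in>{1..g}. \<eta> i > 0"
    and "r\<^sub>0 \<ge> 0"
    and "\<not> (r\<^sub>0 = 0 \<and> b = 0 \<and> a > 0)"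
    and "short_rate g a b \<alpha> \<eta> r\<^sub>0 M R"
  shows "((\<exists>(N' :: real measure) X'. conv_in_distr M R N' X') \<longleftrightarrow>
            (b = 0 \<and> a \<le> 0) \<or> (b > 0 \<and> a < 0) \<or> (b > 0 \<and> a = 0 \<and> \<alpha> g < 2)) \<and>
         (conv_in_distr M R N X \<longrightarrow>
            (b = 0 \<and> a \<le> 0 \<longrightarrow> measure N {\<omega> \<in> space N. X \<omega> = 0} = 1) \<and>
            (b > 0 \<and> a < 0 \<longrightarrow> integrable N X \<and> (LINT \<omega>|N. X \<omega>) = - b / a) \<and>
            (b > 0 \<and> a = 0 \<and> \<alpha> g < 2 \<longrightarrow>
               (\<lambda>r. measure N {\<omega> \<in> space N. X \<omega> > r}) \<sim>[at_top]
               (\<lambda>r. b / (\<eta> g * (2 - \<alpha> g) * Gamma (\<alpha> g - 1)) * (1 / r powr (2 - \<alpha> g)))))"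
proof -
  note g = assms(1) and b = assms(2) and a1 = assms(3) and am = assms(4) and ag = assms(5) and eta = assms(6)
    and r0 = assms(7) and nontriv = assms(8)
  let ?J = "branching_mechanism g a \<alpha> \<eta>"
  obtain P where P: "feller_semigroup P" and gen: "has_generator_on P (generator g a b \<alpha> \<eta>) test_functions"
    and markov: "markov_process_with M R P" and start: "AE \<omega> in M. R 0 \<omega> = r\<^sub>0"
    using assms(9) by (auto simp: short_rate_def)
  have M: "prob_space M" and R: "\<And>t. t \<ge> 0 \<Longrightarrow> R t \<in> measurable M half_line"
    using markov by (auto simp: markov_process_with_def)
  define L where "L t l = (LINT \<omega>|M. exp (- l * R t \<omega>))" for t l
  have L: "L t l = trans_op P t (\<lambda>y. exp (- l * y)) r\<^sub>0" if "t \<ge> 0" "l > 0" for t l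
    unfolding L_def
    using markov_process_expectation[OF P markov start r0 that(1), of "\<lambda>y. exp (- l * y)"] C0_half_line_exp[OF that(2), of 1]
    by simp

  \<comment> \<open>The condition concerns \<open>b * K\<close>, so that for \<open>b = 0\<close>
    every antiderivative is admissible, even one that diverges at 0.\<close>
  have limit: "((\<lambda>t. L t l) \<longlongrightarrow> exp (- b * K l)) at_top"
    if a: "a \<le> 0" and K: "\<And>y. y > 0 \<Longrightarrow> (K has_real_derivative y / ?J y) (at y)"
      and K0: "((\<lambda>y. b * K y) \<longlongrightarrow> 0) (at_right 0)" and l: "l > 0" for K l
  proof -
    obtain w where w: "\<And>T. T \<ge> 0 \<Longrightarrow> w T > 0" "(w \<longlongrightarrow> 0) at_top"
      "\<And>T x. T \<ge> 0 \<Longrightarrow> x \<ge> 0 \<Longrightarrow> trans_op P T (\<lambda>y. exp (- l * y)) x = exp (- b * (K l - K (w T)) - w T * x)"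
      using laplace_nonpos_drift[OF P gen g a1 am ag eta a l K] by blast
    have "eventually (\<lambda>T. w T > 0) at_top"
      using eventually_ge_at_top[of 0] by (rule eventually_mono) (rule w(1))
    then have "filterlim w (at_right 0) at_top"
      using w(2) by (auto simp: filterlim_at elim: eventually_mono)
    from filterlim_compose[OF K0 this] have "((\<lambda>T. b * K (w T)) \<longlongrightarrow> 0) at_top" .
    then have "((\<lambda>T. exp (- b * K l + b * K (w T) - w T * r\<^sub>0)) \<longlongrightarrow> exp (- b * K l + 0 - 0 * r\<^sub>0)) at_top"
      by (intro tendsto_intros w(2))
    then have "((\<lambda>T. exp (- b * K l + b * K (w T) - w T * r\<^sub>0)) \<longlongrightarrow> exp (- b * K l)) at_top"
      by simp
    then show ?thesis
    proof (rule Lim_transform_eventually)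
      show "eventually (\<lambda>T. exp (- b * K l + b * K (w T) - w T * r\<^sub>0) = L T l) at_top"
        using eventually_ge_at_top[of 0] by eventually_elim (use L l w(3) r0 in \<open>simp add: right_diff_distrib\<close>)
    qed
  qed
  have exists: "\<exists>(N' :: real measure) X'. conv_in_distr M R N' X'"
    if lim: "\<And>l. l > 0 \<Longrightarrow> ((\<lambda>t. L t l) \<longlongrightarrow> exp (- b * K l)) at_top"
      and K0: "((\<lambda>y. b * K y) \<longlongrightarrow> 0) (at_right 0)" for K
  proof -
    have "((\<lambda>l. exp (- (b * K l))) \<longlongrightarrow> exp (- 0)) (at_right 0)"
      by (intro tendsto_intros K0)
    then have "((\<lambda>l. exp (- b * K l)) \<longlongrightarrow> 1) (at_right 0)" by simp
    then obtain N' :: "real measure" and X' where N': "prob_space N'" "X' \<in> borel_measurable N'" "\<And>\<omega>. X' \<omega> \<ge> 0"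
      "\<And>l. l > 0 \<Longrightarrow> (LINT \<omega>|N'. exp (- l * X' \<omega>)) = exp (- b * K l)"
      using laplace_limit_realised[OF M R lim[unfolded L_def]] by metis
    have "conv_in_distr M R N' X'"
      using lim N' by (intro laplace_convergence_imp_conv_in_distr[OF M R]) (auto simp: L_def)
    then show ?thesis by blast
  qed
  \<comment> \<open>Any limit variable, on whatever space, has the computed transform by uniqueness
    of limits; its law is then read off from the transform without inversion.\<close>
  have identify: "(LINT \<omega>|N'. exp (- l * X' \<omega>)) = c"
    if "conv_in_distr M R N' X'" "((\<lambda>t. L t l) \<longlongrightarrow> c) at_top" "l > 0" for N' :: "'c measure" and X' l c
    using tendsto_unique[OF trivial_limit_at_top_linorder conv_in_distr_imp_laplace(2)[OF M R that(1,3)] that(2)[unfolded L_def]] .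

  obtain K0 where K0: "\<And>y. y > 0 \<Longrightarrow> a \<le> 0 \<Longrightarrow> (K0 has_real_derivative y / ?J y) (at y)"
    using branching_potential_exists[OF g am ag eta, of a] by metis

  have no_limit: False
    if conv: "conv_in_distr M R N' X'" and "\<theta> < 1" "\<And>l. l > 0 \<Longrightarrow> eventually (\<lambda>t. L t l \<le> \<theta>) at_top"
    for N' :: "real measure" and X' \<theta>
  proof -
    have "(LINT \<omega>|N'. exp (- l * X' \<omega>)) \<le> \<theta>" if l: "l > 0" for l
      using tendsto_upperbound[OF conv_in_distr_imp_laplace(2)[OF M R conv l], of \<theta>] that \<open>\<And>l. l > 0 \<Longrightarrow> _\<close>
      by (simp add: L_def)
    then have "1 \<le> \<theta>"
      using conv conv_in_distr_imp_laplace(1)[OF M R conv] by (intro laplace_bound_ge_1[of N' X']) (auto simp: conv_in_distr_def)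
    then show False using \<open>\<theta> < 1\<close> by simp
  qed

  have necessary: "(b = 0 \<and> a \<le> 0) \<or> (b > 0 \<and> a < 0) \<or> (b > 0 \<and> a = 0 \<and> \<alpha> g < 2)"
    if conv: "conv_in_distr M R N' X'" for N' :: "real measure" and X'
  proof (rule ccontr)
    assume neg: "\<not> ?thesis"
    show False
    proof (cases "a > 0")
      case True
      then have "r\<^sub>0 > 0 \<or> b > 0" using nontriv r0 b by auto
      from laplace_pos_drift[OF P gen g a1 am ag eta True b r0 this]
      obtain \<theta> where \<theta>: "\<theta> < 1" "\<And>l. l > 0 \<Longrightarrow> eventually (\<lambda>T. trans_op P T (\<lambda>y. exp (- l * y)) r\<^sub>0 \<le> \<theta>) at_top"
        by blast
      have "eventually (\<lambda>t. L t l \<le> \<theta>) at_top" if "l > 0" for l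
        using \<theta>(2)[OF that] eventually_ge_at_top[of 0] by eventually_elim (simp add: L that)
      then show False using no_limit[OF conv \<theta>(1)] by blast
    next
      case False
      with neg b have ab: "a = 0" "b > 0" "\<alpha> g \<ge> 2" by auto
      \<comment> \<open>Since \<open>\<alpha> 1 \<le> 2\<close>, strict decrease leaves a single
        index, equal to 2. Then \<open>J\<close> is a square up to a constant, and its potential is
        a logarithm, unbounded at 0.\<close>
      have g1: "g = 1"
        using monotone_onD[OF am, of 1 g] g a1 ab(3) by (cases "g = 1") auto
      then have J: "?J y = \<eta> 1 * y\<^sup>2" if "y > 0" for y
        using that ab a1 by (simp add: branching_mechanism_def powr_numeral)
      have e1: "\<eta> 1 > 0" using eta g by auto
      define K where "K y = ln y / \<eta> 1" for y
      have K: "(K has_real_derivative y / ?J y) (at y)" if "y > 0" for y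
        unfolding K_def[abs_def] J[OF that] using that e1
        by (auto intro!: derivative_eq_intros simp: power2_eq_square)
      have "eventually (\<lambda>t. L t l \<le> 1 / 2) at_top" if l: "l > 0" for l
      proof -
        obtain w where w: "\<And>T. T \<ge> 0 \<Longrightarrow> w T > 0" "(w \<longlongrightarrow> 0) at_top"
          "\<And>T x. T \<ge> 0 \<Longrightarrow> x \<ge> 0 \<Longrightarrow> trans_op P T (\<lambda>y. exp (- l * y)) x = exp (- b * (K l - K (w T)) - w T * x)"
          using laplace_nonpos_drift[OF P gen g a1 am ag eta _ l K] ab(1) by auto
        \<comment> \<open>Chosen so that \<open>K q = K l - ln 2 / b\<close>; once
          \<open>w T < q\<close>, the transform is at most 1/2, whatever \<open>l\<close>
          is.\<close>
        define q where "q = l * exp (- ln 2 * \<eta> 1 / b)"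
        have q: "q > 0" using l by (simp add: q_def)
        have "eventually (\<lambda>T. w T < q) at_top"
          using w(2) q by (rule order_tendstoD(2))
        then show ?thesis
          using eventually_ge_at_top[of 0]
        proof eventually_elim
          case (elim T)
          have "K (w T) \<le> K q"
            using elim w(1) e1 q by (auto simp: K_def intro!: divide_right_mono)
          also have "K q = K l - ln 2 / b"
            using l e1 ab(2) by (simp add: K_def q_def ln_mult field_simps)
          finally have "- b * (K l - K (w T)) \<le> - ln 2"
            using ab(2) by (simp add: field_simps)
          moreover have "w T * r\<^sub>0 \<ge> 0" using w(1)[of T] elim r0 by simp
          ultimately have "L T l \<le> exp (- ln 2)"
            using L[of T l] w(3)[of T r\<^sub>0] elim l r0 by simp
          then show ?case by (simp add: exp_minus)
        qed
      qed
      then show False using no_limit[OF conv, of "1 / 2"] by simp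
    qed
  qed

  have case1: "((\<lambda>t. L t l) \<longlongrightarrow> exp (- b * K0 l)) at_top" if "b = 0" "a \<le> 0" "l > 0" for l
    by (rule limit) (use that K0 in auto)

  have sufficient: "\<exists>(N' :: real measure) X'. conv_in_distr M R N' X'"
    if "(b = 0 \<and> a \<le> 0) \<or> (b > 0 \<and> a < 0) \<or> (b > 0 \<and> a = 0 \<and> \<alpha> g < 2)"
    using that
  proof (elim disjE conjE)
    assume "b = 0" "a \<le> 0"
    then show ?thesis using exists[of K0] case1 by simp
  next
    assume "b > 0" "a < 0"
    obtain K where K: "\<And>y. y > 0 \<Longrightarrow> (K has_real_derivative y / ?J y) (at y)" "(K \<longlongrightarrow> 0) (at_right 0)"
      using branching_potential_neg_drift[OF g am ag eta \<open>a < 0\<close>] by metis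
    have bK: "((\<lambda>y. b * K y) \<longlongrightarrow> 0) (at_right 0)" by (rule tendsto_mult_right_zero[OF K(2)])
    show ?thesis by (rule exists[OF limit[OF less_imp_le[OF \<open>a < 0\<close>] K(1) bK] bK])
  next
    assume "b > 0" "a = 0" "\<alpha> g < 2"
    obtain K where K: "\<And>y. y > 0 \<Longrightarrow> (K has_real_derivative y / ?J y) (at y)" "(K \<longlongrightarrow> 0) (at_right 0)"
      using branching_potential_zero_drift[OF g am ag eta \<open>a = 0\<close> \<open>\<alpha> g < 2\<close>] by metis
    have bK: "((\<lambda>y. b * K y) \<longlongrightarrow> 0) (at_right 0)" by (rule tendsto_mult_right_zero[OF K(2)])
    show ?thesis by (rule exists[OF limit[OF eq_refl[OF \<open>a = 0\<close>] K(1) bK] bK])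
  qed

  have law: "(b = 0 \<and> a \<le> 0 \<longrightarrow> measure N {\<omega> \<in> space N. X \<omega> = 0} = 1) \<and>
            (b > 0 \<and> a < 0 \<longrightarrow> integrable N X \<and> (LINT \<omega>|N. X \<omega>) = - b / a) \<and>
            (b > 0 \<and> a = 0 \<and> \<alpha> g < 2 \<longrightarrow>
               (\<lambda>r. measure N {\<omega> \<in> space N. X \<omega> > r}) \<sim>[at_top]
               (\<lambda>r. b / (\<eta> g * (2 - \<alpha> g) * Gamma (\<alpha> g - 1)) * (1 / r powr (2 - \<alpha> g))))"
    if conv: "conv_in_distr M R N X"
  proof (intro conjI impI; (elim conjE)?)
    have N: "prob_space N" and X [measurable]: "X \<in> borel_measurable N"
      using conv by (auto simp: conv_in_distr_def)
    have pos: "AE \<omega> in N. X \<omega> \<ge> 0" by (rule conv_in_distr_imp_laplace(1)[OF M R conv])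
    have ev: "eventually (\<lambda>l::real. l > 0) (at_right 0)" by (simp add: eventually_at_right_less)
    {
      assume "b = 0" "a \<le> 0"
      then have "(LINT \<omega>|N. exp (- X \<omega>)) = 1"
        using identify[OF conv case1[of 1]] by simp
      then show "measure N {\<omega> \<in> space N. X \<omega> = 0} = 1"
        by (rule laplace_one_imp_zero[OF N X pos])
    next
      assume "b > 0" "a < 0"
      obtain K where K: "\<And>y. y > 0 \<Longrightarrow> (K has_real_derivative y / ?J y) (at y)" "(K \<longlongrightarrow> 0) (at_right 0)"
        "((\<lambda>y. K y / y) \<longlongrightarrow> - 1 / a) (at_right 0)"
        using branching_potential_neg_drift[OF g am ag eta \<open>a < 0\<close>] by metis
      have bK: "((\<lambda>y. b * K y) \<longlongrightarrow> 0) (at_right 0)" by (rule tendsto_mult_right_zero[OF K(2)])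
      have id: "(LINT \<omega>|N. exp (- l * X \<omega>)) = exp (- b * K l)" if "l > 0" for l
        by (rule identify[OF conv limit[OF less_imp_le[OF \<open>a < 0\<close>] K(1) bK that] that])
      have "((\<lambda>y. K y / y powr 1) \<longlongrightarrow> - 1 / a) (at_right 0)"
        by (rule Lim_transform_eventually[OF K(3)]) (use ev in \<open>auto elim: eventually_mono\<close>)
      from one_minus_exp_asymptotics[OF K(2) this, of b]
      have "((\<lambda>l. (1 - exp (- b * K l)) / l powr 1) \<longlongrightarrow> - b / a) (at_right 0)" by simp
      then have "((\<lambda>l. (1 - (LINT \<omega>|N. exp (- l * X \<omega>))) / l) \<longlongrightarrow> - b / a) (at_right 0)"
        by (rule Lim_transform_eventually) (rule eventually_mono[OF ev], subst id, simp_all)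
      from laplace_derivative_imp_mean[OF N X pos this]
      show "integrable N X" "(LINT \<omega>|N. X \<omega>) = - b / a" by auto
    next
      assume bp: "b > 0" and a0: "a = 0" and a2: "\<alpha> g < 2"
      \<comment> \<open>With this choice \<open>1 - \<beta> = \<alpha> g - 1\<close>, the argument
        of the Gamma factor in the tail.\<close>
      define \<beta> where "\<beta> = 2 - \<alpha> g"
      have \<beta>: "0 < \<beta>" "\<beta> < 1" using ag a2 by (auto simp: \<beta>_def)
      obtain K where K: "\<And>y. y > 0 \<Longrightarrow> (K has_real_derivative y / ?J y) (at y)" "(K \<longlongrightarrow> 0) (at_right 0)"
        "((\<lambda>y. K y / y powr \<beta>) \<longlongrightarrow> 1 / (\<eta> g * \<beta>)) (at_right 0)"
        using branching_potential_zero_drift[OF g am ag eta a0 a2] unfolding \<beta>_def by metis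
      have bK: "((\<lambda>y. b * K y) \<longlongrightarrow> 0) (at_right 0)" by (rule tendsto_mult_right_zero[OF K(2)])
      \<comment> \<open>The Tauberian theorem wants nonnegativity everywhere, while \<open>X\<close>
        has it almost surely; the events \<open>X > r\<close> and \<open>X1 > r\<close> agree for
        \<open>r \<ge> 0\<close>.\<close>
      define X1 where "X1 \<omega> = max 0 (X \<omega>)" for \<omega>
      have X1: "X1 \<in> borel_measurable N" unfolding X1_def[abs_def] by simp
      have id: "(LINT \<omega>|N. exp (- l * X1 \<omega>)) = exp (- b * K l)" if "l > 0" for l
      proof -
        have "(LINT \<omega>|N. exp (- l * X1 \<omega>)) = (LINT \<omega>|N. exp (- l * X \<omega>))"
        proof (rule integral_cong_AE)
          show "AE \<omega> in N. exp (- l * X1 \<omega>) = exp (- l * X \<omega>)"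
            using pos by eventually_elim (simp add: X1_def max_def)
        qed (use X1 in simp_all)
        also have "\<dots> = exp (- b * K l)"
          by (rule identify[OF conv limit[OF eq_refl[OF a0] K(1) bK that] that])
        finally show ?thesis .
      qed
      have "((\<lambda>l. (1 - exp (- b * K l)) / l powr \<beta>) \<longlongrightarrow> b * (1 / (\<eta> g * \<beta>))) (at_right 0)"
        by (rule one_minus_exp_asymptotics[OF K(2,3)])
      then have "((\<lambda>l. (1 - (LINT \<omega>|N. exp (- l * X1 \<omega>))) / l powr \<beta>) \<longlongrightarrow> b * (1 / (\<eta> g * \<beta>))) (at_right 0)"
        by (rule Lim_transform_eventually) (rule eventually_mono[OF ev], subst id, simp_all)
      moreover have eg: "\<eta> g > 0" using eta g by auto
      ultimately have lim: "((\<lambda>r. r powr \<beta> * measure N {\<omega> \<in> space N. X1 \<omega> > r}) \<longlongrightarrow> b * (1 / (\<eta> g * \<beta>)) / Gamma (1 - \<beta>)) at_top"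
        using \<beta> bp by (intro laplace_tauberian[OF N X1]) (auto simp: X1_def)
      define C where "C = b / (\<eta> g * \<beta> * Gamma (1 - \<beta>))"
      have C: "C > 0" unfolding C_def using bp eg \<beta> by (intro divide_pos_pos mult_pos_pos Gamma_real_pos) auto
      have "b * (1 / (\<eta> g * \<beta>)) / Gamma (1 - \<beta>) = C" by (simp add: C_def)
      from tendsto_divide[OF lim[unfolded this] tendsto_const[of C]]
      have "((\<lambda>r. r powr \<beta> * measure N {\<omega> \<in> space N. X1 \<omega> > r} / C) \<longlongrightarrow> 1) at_top"
        using C by simp
      then have "((\<lambda>r. measure N {\<omega> \<in> space N. X \<omega> > r} / (C * (1 / r powr \<beta>))) \<longlongrightarrow> 1) at_top"
      proof (rule Lim_transform_eventually)
        show "eventually (\<lambda>r. r powr \<beta> * measure N {\<omega> \<in> space N. X1 \<omega> > r} / C =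
            measure N {\<omega> \<in> space N. X \<omega> > r} / (C * (1 / r powr \<beta>))) at_top"
          using eventually_ge_at_top[of 0]
        proof eventually_elim
          case (elim r)
          then have "{\<omega> \<in> space N. X1 \<omega> > r} = {\<omega> \<in> space N. X \<omega> > r}" by (auto simp: X1_def)
          then show ?case by simp
        qed
      qed
      then have "(\<lambda>r. measure N {\<omega> \<in> space N. X \<omega> > r}) \<sim>[at_top] (\<lambda>r. C * (1 / r powr \<beta>))"
        by (rule asymp_equivI')
      then show "(\<lambda>r. measure N {\<omega> \<in> space N. X \<omega> > r}) \<sim>[at_top]
          (\<lambda>r. b / (\<eta> g * (2 - \<alpha> g) * Gamma (\<alpha> g - 1)) * (1 / r powr (2 - \<alpha> g)))"
        by (simp add: C_def \<beta>_def)
    }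
  qed

  show ?thesis
    using necessary sufficient law by blast
qed

end
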